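(* Let $q\in L^1(0,1)$ be real-valued, let $d\nu$ be a finite signed Borel measure on $(0,1)$ which is singular with respect to Lebesgue measure, and let $\{d\nu_k\}_{k=1}^\infty$ be a sequence of finite (signed) Borel measures on $(0,1)$. Let $\mathrm{H}_{\mathrm{D}}$ and $\mathrm{H}_{\mathrm{D},k}$ be the Dirichlet operators in $L^2(0,1)$ associated with $-\frac{d}{dx}\frac{d}{dP(x)}+q(x)$ and $-\frac{d}{dx}\frac{d}{dP_k(x)}+q(x)$, respectively, where $dP=dx+d\nu$ and $dP_k=dx+d\nu_k$ (with the same potential $q$). (i) If $d\nu_k$ converges to $d\nu$ in the weak-$*$ topology, that is, for all $f\in C[0,1]$ $$\int_{(0,1)}f(t)\,d\nu_k(t)\to\int_{(0,1)}f(t)\,d\nu(t),\qquad k\to\infty,$$ then there is a subsequence $\{d\nu_{k(j)}\}_{j=1}^\infty$ such that the corresponding operators $\mathrm{H}_{\mathrm{D},k(j)}$ converge to $\mathrm{H}_{\mathrm{D}}$ in the norm resolvent sense. (ii) If, in addition, $d\nu$ and all $d\nu_k$ are nonnegative measures satisfying $\int_{(0,1)}f(t)\,d\nu_k(t)\to\int_{(0,1)}f(t)\,d\nu(t)$ as $k\to\infty$ for all $f\in C[0,1]$, then the operators $\mathrm{H}_{\mathrm{D},k}$ converge to $\mathrm{H}_{\mathrm{D}}$ in the norm resolvent sense and, moreover, for all $n\in\mathbb{N}$ $$\lambda_n(k)\to\lambda_n,\qquad k\to\infty.$$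
   Context: A function $f$ on $(0,1)$ is locally absolutely continuous with respect to $dP$ if it is locally of bounded variation and its Borel measure satisfies $df=f^{[1]}\,dP$ for some $f^{[1]}\in L^1_{\mathrm{loc}}((0,1);dP)$ (the quasi-derivative; left-continuous representatives of $f$ are used). The Dirichlet operator is $\mathrm{H}_{\mathrm{D}}f=\tau f:=-(f^{[1]})'+qf$ on all $f\in L^2(0,1)$ such that $f$ is locally absolutely continuous with respect to $dP$, $f^{[1]}$ is locally absolutely continuous on $(0,1)$ with respect to Lebesgue measure, $\tau f\in L^2(0,1)$ and $f(0)=f(1)=0$ (boundary values as limits); this operator is self-adjoint. The operator $\mathrm{H}_{\mathrm{D},k}$ is defined in the same way with $dP_k$ in place of $dP$. In (ii), $\lambda_n$ and $\lambda_n(k)$ denote the $n$-th eigenvalue, listed in increasing order, of $\mathrm{H}_{\mathrm{D}}$ and $\mathrm{H}_{\mathrm{D},k}$, respectively (the spectra are purely discrete and bounded from below in this case). *)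

theory Defs
  imports "HOL-Analysis.Analysis"
begin

abbreviation unit_ivl :: "real set" where
  "unit_ivl \<equiv> {0<..<1}"

abbreviation borel_unit :: "real set set" where
  "borel_unit \<equiv> sets (restrict_space borel unit_ivl)"


section \<open>Finite signed Borel measures on the open unit interval\<close>

text \<open>A finite signed measure is a real-valued set function; its values outside
  \<^const>\<open>borel_unit\<close> are irrelevant everywhere below.\<close>

definition finite_signed_measure :: "(real set \<Rightarrow> real) \<Rightarrow> bool" where
  "finite_signed_measure \<mu> \<longleftrightarrow>
     \<mu> {} = 0 \<and>
     (\<forall>A :: nat \<Rightarrow> real set. range A \<subseteq> borel_unit \<and> disjoint_family A \<longrightarrow>
        (\<lambda>n. \<mu> (A n)) sums \<mu> (\<Union>n. A n))"

definition nonneg_signed_measure :: "(real set \<Rightarrow> real) \<Rightarrow> bool" where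
  "nonneg_signed_measure \<mu> \<longleftrightarrow> (\<forall>A \<in> borel_unit. 0 \<le> \<mu> A)"

definition singular_signed_measure :: "(real set \<Rightarrow> real) \<Rightarrow> bool" where
  "singular_signed_measure \<mu> \<longleftrightarrow>
     (\<exists>N \<in> borel_unit. N \<in> null_sets lborel \<and> (\<forall>A \<in> borel_unit. A \<inter> N = {} \<longrightarrow> \<mu> A = 0))"

text \<open>The two parts of the Jordan decomposition. The map \<^const>\<open>ennreal\<close> sends negative reals
  to \<open>0\<close>, which does not affect the supremum because \<open>B = {}\<close> contributes \<open>0\<close>.\<close>

definition pos_variation :: "(real set \<Rightarrow> real) \<Rightarrow> real measure" where
  "pos_variation \<mu> = measure_of unit_ivl borel_unit
     (\<lambda>A. SUP B \<in> {B \<in> borel_unit. B \<subseteq> A}. ennreal (\<mu> B))"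

definition neg_variation :: "(real set \<Rightarrow> real) \<Rightarrow> real measure" where
  "neg_variation \<mu> = pos_variation (\<lambda>A. - \<mu> A)"

definition signed_integral ::
  "(real set \<Rightarrow> real) \<Rightarrow> (real \<Rightarrow> 'a :: {banach, second_countable_topology}) \<Rightarrow> 'a" where
  "signed_integral \<mu> f = integral\<^sup>L (pos_variation \<mu>) f - integral\<^sup>L (neg_variation \<mu>) f"

definition weak_star_tendsto :: "(nat \<Rightarrow> real set \<Rightarrow> real) \<Rightarrow> (real set \<Rightarrow> real) \<Rightarrow> bool" where
  "weak_star_tendsto \<mu>s \<mu> \<longleftrightarrow>
     (\<forall>f :: real \<Rightarrow> real. continuous_on {0..1} f \<longrightarrow>
        (\<lambda>k. signed_integral (\<mu>s k) f) \<longlonglongrightarrow> signed_integral \<mu> f)"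

text \<open>The measure \<open>dP = dx + d\<nu>\<close>.\<close>

definition dx_plus :: "(real set \<Rightarrow> real) \<Rightarrow> real set \<Rightarrow> real" where
  "dx_plus \<nu> A = measure lborel A + \<nu> A"


section \<open>Local absolute continuity\<close>

definition bounded_variation_on :: "real \<Rightarrow> real \<Rightarrow> (real \<Rightarrow> complex) \<Rightarrow> bool" where
  "bounded_variation_on a b f \<longleftrightarrow>
     (\<exists>C. \<forall>(n :: nat) (t :: nat \<Rightarrow> real). mono t \<and> range t \<subseteq> {a..b} \<longrightarrow>
        (\<Sum>i<n. norm (f (t (Suc i)) - f (t i))) \<le> C)"

text \<open>Local integrability with respect to the total variation
  \<open>\<bar>\<mu>\<bar> = pos_variation \<mu> + neg_variation \<mu>\<close>.\<close>

definition loc_integrable_wrt :: "(real set \<Rightarrow> real) \<Rightarrow> (real \<Rightarrow> complex) \<Rightarrow> bool" where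
  "loc_integrable_wrt \<mu> h \<longleftrightarrow>
     (\<forall>a b. 0 < a \<and> a \<le> b \<and> b < 1 \<longrightarrow>
        set_integrable (pos_variation \<mu>) {a..b} h \<and> set_integrable (neg_variation \<mu>) {a..b} h)"

text \<open>\<open>f\<close> is the left-continuous representative of a function which is locally absolutely
  continuous with respect to \<open>\<mu>\<close>, and \<open>df = h d\<mu>\<close>. The Borel measure \<open>df\<close> of a left-continuous
  function \<open>f\<close> of locally bounded variation is the one with \<open>df [a,b) = f b - f a\<close>.\<close>

definition loc_abs_cont_wrt ::
  "(real set \<Rightarrow> real) \<Rightarrow> (real \<Rightarrow> complex) \<Rightarrow> (real \<Rightarrow> complex) \<Rightarrow> bool" where
  "loc_abs_cont_wrt \<mu> f h \<longleftrightarrow>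
     (\<forall>x \<in> unit_ivl. continuous (at_left x) f) \<and>
     (\<forall>a b. 0 < a \<and> a \<le> b \<and> b < 1 \<longrightarrow> bounded_variation_on a b f) \<and>
     loc_integrable_wrt \<mu> h \<and>
     (\<forall>a b. 0 < a \<and> a \<le> b \<and> b < 1 \<longrightarrow>
        f b - f a = signed_integral \<mu> (\<lambda>x. indicator {a..<b} x *\<^sub>R h x))"

text \<open>\<open>h\<close> is locally absolutely continuous with respect to Lebesgue measure, with
  derivative \<open>h'\<close> almost everywhere.\<close>

definition loc_abs_cont_lebesgue :: "(real \<Rightarrow> complex) \<Rightarrow> (real \<Rightarrow> complex) \<Rightarrow> bool" where
  "loc_abs_cont_lebesgue h h' \<longleftrightarrow>
     (\<forall>a b. 0 < a \<and> a \<le> b \<and> b < 1 \<longrightarrow>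
        integrable (lebesgue_on {a..b}) h' \<and> h b - h a = integral\<^sup>L (lebesgue_on {a..b}) h')"


section \<open>The Hilbert space of square integrable functions and its linear relations\<close>

text \<open>Elements of \<open>L\<^sup>2(0,1)\<close> are represented by complex functions on \<open>(0,1)\<close>, understood modulo
  equality almost everywhere.\<close>

definition L2_space :: "(real \<Rightarrow> complex) set" where
  "L2_space = {f \<in> borel_measurable (lebesgue_on unit_ivl).
                 integrable (lebesgue_on unit_ivl) (\<lambda>x. (norm (f x))\<^sup>2)}"

definition normL2 :: "(real \<Rightarrow> complex) \<Rightarrow> real" where
  "normL2 f = sqrt (integral\<^sup>L (lebesgue_on unit_ivl) (\<lambda>x. (norm (f x))\<^sup>2))"

text \<open>Operators are given by their graphs, so \<open>(f, g) \<in> T\<close> means \<open>T f = g\<close>.\<close>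

type_synonym L2_relation = "((real \<Rightarrow> complex) \<times> (real \<Rightarrow> complex)) set"

definition in_resolvent_set :: "L2_relation \<Rightarrow> complex \<Rightarrow> bool" where
  "in_resolvent_set T z \<longleftrightarrow>
     (\<forall>g \<in> L2_space. \<exists>f. (f, \<lambda>x. g x + z * f x) \<in> T) \<and>
     (\<exists>C. \<forall>(f, h) \<in> T. normL2 f \<le> C * normL2 (\<lambda>x. h x - z * f x))"

text \<open>\<open>(T - z)\<^sup>-\<^sup>1\<close>: for \<open>z\<close> in the resolvent set the chosen function is unique up to a null set.\<close>

definition resolvent :: "L2_relation \<Rightarrow> complex \<Rightarrow> (real \<Rightarrow> complex) \<Rightarrow> real \<Rightarrow> complex" where
  "resolvent T z g = (SOME f. (f, \<lambda>x. g x + z * f x) \<in> T)"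

definition operator_norm :: "((real \<Rightarrow> complex) \<Rightarrow> (real \<Rightarrow> complex)) \<Rightarrow> real" where
  "operator_norm A = (SUP g \<in> {g \<in> L2_space. normL2 g \<le> 1}. normL2 (A g))"

definition norm_resolvent_tendsto :: "(nat \<Rightarrow> L2_relation) \<Rightarrow> L2_relation \<Rightarrow> bool" where
  "norm_resolvent_tendsto Ts T \<longleftrightarrow>
     (\<forall>z. Im z \<noteq> 0 \<longrightarrow>
        in_resolvent_set T z \<and> (\<forall>k. in_resolvent_set (Ts k) z) \<and>
        (\<lambda>k. operator_norm (\<lambda>g x. resolvent (Ts k) z g x - resolvent T z g x)) \<longlonglongrightarrow> 0)"


section \<open>Eigenvalues\<close>

definition eigenspace :: "L2_relation \<Rightarrow> complex \<Rightarrow> (real \<Rightarrow> complex) set" where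
  "eigenspace T z = {f. (f, \<lambda>x. z * f x) \<in> T}"

definition independent_ae :: "nat \<Rightarrow> (nat \<Rightarrow> real \<Rightarrow> complex) \<Rightarrow> bool" where
  "independent_ae n u \<longleftrightarrow>
     (\<forall>c :: nat \<Rightarrow> complex. (AE x in lebesgue_on unit_ivl. (\<Sum>i<n. c i * u i x) = 0) \<longrightarrow>
        (\<forall>i<n. c i = 0))"

text \<open>Complex dimension modulo null functions.\<close>

definition has_dim_ae :: "(real \<Rightarrow> complex) set \<Rightarrow> nat \<Rightarrow> bool" where
  "has_dim_ae E n \<longleftrightarrow>
     (\<exists>u. (\<forall>i<n. u i \<in> E) \<and> independent_ae n u) \<and>
     \<not> (\<exists>u. (\<forall>i<Suc n. u i \<in> E) \<and> independent_ae (Suc n) u)"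

text \<open>\<open>\<lambda>\<^sub>0 \<le> \<lambda>\<^sub>1 \<le> \<dots>\<close> lists all eigenvalues, each one as often as its multiplicity
  (a number which is not an eigenvalue has multiplicity \<open>0\<close>).\<close>

definition eigenvalue_listing :: "L2_relation \<Rightarrow> (nat \<Rightarrow> real) \<Rightarrow> bool" where
  "eigenvalue_listing T l \<longleftrightarrow>
     mono l \<and>
     (\<forall>z :: complex. finite {n. complex_of_real (l n) = z} \<and>
        has_dim_ae (eigenspace T z) (card {n. complex_of_real (l n) = z}))"

lemma independent_ae_mono:
  assumes "independent_ae n u" "m \<le> n"
  shows "independent_ae m u"
  unfolding independent_ae_def
proof (intro allI impI)
  fix c :: "nat \<Rightarrow> complex" and i
  assume ae: "AE x in lebesgue_on unit_ivl. (\<Sum>i<m. c i * u i x) = 0" and i: "i < m"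
  define d where "d j = (if j < m then c j else 0)" for j
  have eq: "(\<Sum>j<n. d j * u j x) = (\<Sum>j<m. c j * u j x)" for x
  proof -
    have "(\<Sum>j<n. d j * u j x) = (\<Sum>j<m. d j * u j x)"
      using assms(2) by (intro sum.mono_neutral_right) (auto simp: d_def)
    then show ?thesis by (simp add: d_def)
  qed
  have "AE x in lebesgue_on unit_ivl. (\<Sum>j<n. d j * u j x) = 0"
    using ae by (simp only: eq)
  then have "d i = 0"
    using assms i unfolding independent_ae_def by (meson less_le_trans)
  then show "c i = 0" using i by (simp add: d_def)
qed

lemma has_dim_ae_unique:
  assumes "has_dim_ae E m" "has_dim_ae E n"
  shows "m = n"
proof -
  have False if m: "has_dim_ae E m" and n: "has_dim_ae E n" and less: "m < n" for m n
  proof -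
    obtain u where "\<forall>i<n. u i \<in> E" "independent_ae n u"
      using n unfolding has_dim_ae_def by blast
    moreover have "Suc m \<le> n" using less by simp
    ultimately have "(\<forall>i<Suc m. u i \<in> E) \<and> independent_ae (Suc m) u"
      using independent_ae_mono by fastforce
    then show False using m unfolding has_dim_ae_def by blast
  qed
  then show ?thesis using assms by (metis linorder_neqE_nat)
qed

lemma eigenvalue_listing_unique:
  assumes "eigenvalue_listing T l" "eigenvalue_listing T l'"
  shows "l = l'"
proof -
  have card_eq: "card {n. l n = t} = card {n. l' n = t}" for t
  proof -
    have "card {n. complex_of_real (l n) = of_real t} = card {n. complex_of_real (l' n) = of_real t}"
      using assms has_dim_ae_unique unfolding eigenvalue_listing_def by blast
    then show ?thesis by simp
  qed
  have fin: "finite {n. k n = t}" if "eigenvalue_listing T k" for k t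
  proof -
    have "finite {n. complex_of_real (k n) = of_real t}"
      using that unfolding eigenvalue_listing_def by blast
    then show ?thesis by simp
  qed
  have le: "\<not> k n < k' n"
    if fink: "eigenvalue_listing T k" and lst: "eigenvalue_listing T k'" and eqs: "\<And>i. i < n \<Longrightarrow> k i = k' i"
      and cards: "\<And>t. card {n. k n = t} = card {n. k' n = t}" for k k' and n :: nat
  proof
    assume less: "k n < k' n"
    have mon: "mono k'" using lst unfolding eigenvalue_listing_def by blast
    have "i < n" if eq: "k' i = k n" for i
      using less eq mon by (metis leD monoD not_le)
    then have "{i. k' i = k n} \<subseteq> {i. k i = k n}" using eqs by auto
    moreover have "n \<in> {i. k i = k n} - {i. k' i = k n}" using less by simp
    ultimately have "{i. k' i = k n} \<subset> {i. k i = k n}" by blast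
    then have "card {i. k' i = k n} < card {i. k i = k n}"
      using fin[OF fink] by (intro psubset_card_mono)
    then show False using cards[of "k n"] by simp
  qed
  have "l n = l' n" for n
  proof (induction n rule: less_induct)
    case (less n)
    have "\<not> l n < l' n" by (rule le[OF assms]) (use less card_eq in auto)
    moreover have "\<not> l' n < l n" by (rule le[OF assms(2,1)]) (use less card_eq in auto)
    ultimately show ?case by simp
  qed
  then show ?thesis by blast
qed


section \<open>The Dirichlet operator\<close>

text \<open>The graph of the Dirichlet operator for \<open>- d/dx d/dP + q\<close>: \<open>f\<^sub>0\<close> is the left-continuous
  representative of \<open>f\<close>, \<open>h\<close> its quasi-derivative and \<open>h'\<close> the derivative of \<open>h\<close>. If \<open>P\<close> vanishes
  on a subinterval, the quasi-derivative is not determined by \<open>f\<close> and the graph is that of a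
  (possibly multivalued) linear relation; resolvents are meaningful in this case as well.\<close>

definition dirichlet :: "(real \<Rightarrow> real) \<Rightarrow> (real set \<Rightarrow> real) \<Rightarrow> L2_relation" where
  "dirichlet q P = {(f, g). f \<in> L2_space \<and> g \<in> L2_space \<and>
     (\<exists>f\<^sub>0 h h'.
        (AE x in lebesgue_on unit_ivl. f x = f\<^sub>0 x) \<and>
        loc_abs_cont_wrt P f\<^sub>0 h \<and>
        loc_abs_cont_lebesgue h h' \<and>
        (AE x in lebesgue_on unit_ivl. g x = - h' x + complex_of_real (q x) * f\<^sub>0 x) \<and>
        (f\<^sub>0 \<longlongrightarrow> 0) (at_right 0) \<and> (f\<^sub>0 \<longlongrightarrow> 0) (at_left 1))}"

end

(* Let F(x) = P((0,x)) be the distribution function of P. Integration by parts turns df = h dP into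
   w' = - F h' for w = f - F h, so that the Dirichlet problem becomes a Caratheodory system for (w, h)
   on [0,1] whose coefficients depend on P through the bounded function F only. By Banach-Steinhaus and
   Arzela-Ascoli, weak-star convergence of the measures makes the distribution functions uniformly
   bounded and convergent in L^1, and Gronwall's inequality transfers this to the resolvents; no
   subsequence is needed, except for dropping the finitely many indices with F_k = 0 almost everywhere.
   For nonnegative measures the Pruefer angle of (w, h) satisfies phi' = (l - q) (sin phi + F cos phi)^2,
   and the n-th eigenvalue is the unique l with phi(1) + arctan F(1) = (n + 1) pi; convergence of the
   eigenvalues follows from strict monotonicity in l and the pointwise convergence of phi(1). *)

theory Submission
  imports Defs "HOL-Complex_Analysis.Great_Picard"
begin

text \<open>A solution of -h' + q f = g + z f with df = h dP jumps wherever P has an atom, so f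
  solves no ordinary differential equation. Subtracting F h removes exactly these jumps, since dw =
  df - h dF - F dh. They return in f = w + F h, and this shapes the estimates: (w, h) converges
  uniformly, but the bound for f contains K |F_k(x) - F(x)|, which need not tend to 0 at a given x.
  Its L2 norm does tend to 0, by L1 convergence and the uniform bound, and this is why resolvents
  are compared in L2 norm only. The one point value in use is F_k(1), from the boundary condition
  w(1) + F(1) h(1) = 0; it converges because 1 is a test function. The resolvent has the value at 1
  of a fundamental solution as denominator. Off the real axis it is nonzero by Green's identity,
  unless F = 0 almost everywhere, and singularity of nu excludes this for the limit. In the
  nonnegative case F grows at least as fast as x, which is used for the direction of zero crossings,
  for strict monotonicity in l and for the unboundedness of the angle.\<close>

section \<open>Absolutely continuous functions on an interval\<close>

text \<open>Telescoping over an equidistant partition of mesh below \<open>d\<close> bounds the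
  total increment by \<open>e * (M b - M a)\<close> for every \<open>e\<close>. This replaces almost
  everywhere differentiation: product and chain rule for primitives are proved by comparing
  increments, with \<open>M\<close> an indefinite integral of norms of densities.\<close>

lemma eq_if_locally_small_increments:
  fixes H :: "real \<Rightarrow> 'a::real_normed_vector" and M :: "real \<Rightarrow> real"
  assumes "a \<le> b"
    and loc: "\<And>e. 0 < e \<Longrightarrow> \<exists>d>0. \<forall>x y. a \<le> x \<and> x \<le> y \<and> y \<le> b \<and> y - x < d \<longrightarrow>
                 norm (H y - H x) \<le> e * (M y - M x)"
  shows "H b = H a"
proof -
  have bound: "norm (H b - H a) \<le> e * (M b - M a)" if e: "0 < e" for e
  proof -
    obtain d where "d > 0" and d: "\<And>x y. a \<le> x \<and> x \<le> y \<and> y \<le> b \<and> y - x < d \<Longrightarrow>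
                 norm (H y - H x) \<le> e * (M y - M x)"
      using loc[OF e] by blast
    obtain n :: nat where n: "(b - a) / d < real n"
      using reals_Archimedean2 by blast
    have "0 \<le> (b - a) / d" using \<open>a \<le> b\<close> \<open>d > 0\<close> by simp
    then have "0 < real n" using n by linarith
    then have npos: "0 < n" by simp
    define t where "t i = a + real i * ((b - a) / real n)" for i
    have step: "t (Suc i) - t i = (b - a) / real n" for i
      by (simp add: t_def algebra_simps add_divide_distrib diff_divide_distrib)
    have small: "(b - a) / real n < d"
      using n \<open>d > 0\<close> \<open>0 < real n\<close> by (simp add: field_simps)
    have t0: "t 0 = a" by (simp add: t_def)
    have tn: "t n = b" using npos by (simp add: t_def)
    have nonneg: "0 \<le> (b - a) / real n" using \<open>a \<le> b\<close> by simp
    have ta: "a \<le> t i" for i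
      using mult_nonneg_nonneg[OF _ nonneg, of "real i"] by (simp add: t_def)
    have tb: "t i \<le> b" if "i \<le> n" for i
    proof -
      have "real i * ((b - a) / real n) \<le> real n * ((b - a) / real n)"
        using that nonneg by (intro mult_right_mono) auto
      then show ?thesis using npos by (simp add: t_def)
    qed
    have "H b - H a = (\<Sum>i<n. H (t (Suc i)) - H (t i))"
      using sum_lessThan_telescope[of "\<lambda>i. H (t i)" n] by (simp add: tn t0)
    then have "norm (H b - H a) \<le> (\<Sum>i<n. norm (H (t (Suc i)) - H (t i)))"
      by (simp add: norm_sum)
    also have "\<dots> \<le> (\<Sum>i<n. e * (M (t (Suc i)) - M (t i)))"
    proof (rule sum_mono)
      fix i assume "i \<in> {..<n}"
      then have "t (Suc i) \<le> b" by (intro tb) auto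
      then show "norm (H (t (Suc i)) - H (t i)) \<le> e * (M (t (Suc i)) - M (t i))"
        using step[of i] small nonneg ta by (intro d) auto
    qed
    also have "\<dots> = e * (M b - M a)"
      using sum_lessThan_telescope[of "\<lambda>i. M (t i)" n]
      by (simp add: tn t0 flip: sum_distrib_left)
    finally show ?thesis .
  qed
  have "norm (H b - H a) \<le> 0 + e" if "e > 0" for e
  proof -
    \<comment> \<open>Nothing is known about the sign of \<open>M b - M a\<close>, so
      \<open>e\<close> is rescaled by a positive upper bound.\<close>
    define C where "C = \<bar>M b - M a\<bar> + 1"
    have C: "M b - M a \<le> C" "C > 0" by (auto simp: C_def)
    have "norm (H b - H a) \<le> (e / C) * (M b - M a)" using that C by (intro bound) simp
    also have "\<dots> \<le> (e / C) * C" using that C by (intro mult_left_mono) auto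
    finally show ?thesis using C by simp
  qed
  then have "norm (H b - H a) \<le> 0" by (rule field_le_epsilon)
  then show ?thesis by simp
qed


text \<open>Absolute continuity as a pair of a density and a function. The integral is the gauge
  integral, which absolute integrability reduces to the Lebesgue integral. The density is a genuine
  function; changing it on a null set is the matter of \<open>is_primitive_spike\<close>.\<close>

definition is_primitive :: "real \<Rightarrow> real \<Rightarrow> (real \<Rightarrow> 'a::euclidean_space) \<Rightarrow> (real \<Rightarrow> 'a) \<Rightarrow> bool" where
  "is_primitive a b p y \<longleftrightarrow> p absolutely_integrable_on {a..b} \<and>
     (\<forall>x\<in>{a..b}. y x = y a + integral {a..x} p)"

lemma integrable_on_subinterval_real:
  fixes p :: "real \<Rightarrow> 'a::euclidean_space"
  assumes "p absolutely_integrable_on {a..b}" "a \<le> c" "d \<le> b"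
  shows "p integrable_on {c..d}"
  using assms by (meson absolutely_integrable_on_def atLeastatMost_subset_iff integrable_subinterval_real)

lemma absolutely_integrable_on_subinterval_real:
  fixes p :: "real \<Rightarrow> 'a::euclidean_space"
  assumes "p absolutely_integrable_on {a..b}" "a \<le> c" "d \<le> b"
  shows "p absolutely_integrable_on {c..d}"
  using assms by (meson absolutely_integrable_on_subinterval atLeastatMost_subset_iff)

lemma is_primitive_absint: "is_primitive a b p y \<Longrightarrow> p absolutely_integrable_on {a..b}"
  by (simp add: is_primitive_def)

lemma is_primitive_eq:
  assumes "is_primitive a b p y" "a \<le> x" "x \<le> b"
  shows "y x = y a + integral {a..x} p"
proof -
  have "x \<in> {a..b}" using assms by simp
  then show ?thesis using assms(1) unfolding is_primitive_def by (elim conjE) (rule bspec)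
qed

lemma is_primitive_diff:
  assumes "is_primitive a b p y" "a \<le> x" "x \<le> x'" "x' \<le> b"
  shows "y x' - y x = integral {x..x'} p"
proof -
  have "integral {a..x} p + integral {x..x'} p = integral {a..x'} p"
    using assms
    by (intro Henstock_Kurzweil_Integration.integral_combine)
       (auto intro: integrable_on_subinterval_real[OF is_primitive_absint])
  moreover have "y x = y a + integral {a..x} p" "y x' = y a + integral {a..x'} p"
    using assms by (auto intro: is_primitive_eq)
  ultimately show ?thesis by (simp add: algebra_simps)
qed

lemma is_primitiveI:
  assumes "p absolutely_integrable_on {a..b}"
    "\<And>x. a \<le> x \<Longrightarrow> x \<le> b \<Longrightarrow> y x = y a + integral {a..x} p"
  shows "is_primitive a b p y"
  unfolding is_primitive_def
proof (intro conjI ballI)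
  show "y x = y a + integral {a..x} p" if "x \<in> {a..b}" for x
    using that by (intro assms(2)) auto
qed (fact assms(1))

lemma is_primitive_continuous:
  assumes "is_primitive a b p y"
  shows "continuous_on {a..b} y"
proof -
  have "continuous_on {a..b} (\<lambda>x. y a + integral {a..x} p)"
    using is_primitive_absint[OF assms]
    by (intro continuous_intros indefinite_integral_continuous_1) (auto simp: absolutely_integrable_on_def)
  then show ?thesis
    by (rule continuous_on_eq) (rule is_primitive_eq[OF assms, symmetric], auto)
qed

lemma is_primitive_subinterval:
  assumes "is_primitive a b p y" "a \<le> c" "d \<le> b"
  shows "is_primitive c d p y"
proof (rule is_primitiveI)
  show "p absolutely_integrable_on {c..d}"
    using absolutely_integrable_on_subinterval_real[OF is_primitive_absint[OF assms(1)]] assms by auto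
  show "y x = y c + integral {c..x} p" if "c \<le> x" "x \<le> d" for x
    using is_primitive_diff[OF assms(1), of c x] assms that by (simp add: algebra_simps)
qed

lemma is_primitive_integral:
  assumes "p absolutely_integrable_on {a..b}"
  shows "is_primitive a b p (\<lambda>x. c + integral {a..x} p)"
  using assms by (intro is_primitiveI) auto

lemma is_primitive_add:
  assumes "is_primitive a b p y" "is_primitive a b p' y'"
  shows "is_primitive a b (\<lambda>x. p x + p' x) (\<lambda>x. y x + y' x)"
proof (rule is_primitiveI)
  show "(\<lambda>x. p x + p' x) absolutely_integrable_on {a..b}"
    using assms by (intro set_integral_add) (auto simp: is_primitive_def)
  show "y x + y' x = y a + y' a + integral {a..x} (\<lambda>x. p x + p' x)" if x: "a \<le> x" "x \<le> b" for x
  proof -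
    have "integral {a..x} (\<lambda>x. p x + p' x) = integral {a..x} p + integral {a..x} p'"
      using assms x
      by (intro Henstock_Kurzweil_Integration.integral_add integrable_on_subinterval_real[of a b])
        (auto intro: is_primitive_absint)
    then show ?thesis
      using is_primitive_eq[OF assms(1) x] is_primitive_eq[OF assms(2) x] by (simp add: algebra_simps)
  qed
qed

lemma is_primitive_linear:
  assumes "is_primitive a b p y" "bounded_linear L"
  shows "is_primitive a b (\<lambda>x. L (p x)) (\<lambda>x. L (y x))"
proof (rule is_primitiveI)
  show "(\<lambda>x. L (p x)) absolutely_integrable_on {a..b}"
    using absolutely_integrable_linear[OF is_primitive_absint[OF assms(1)] assms(2)] by (simp add: o_def)
  show "L (y x) = L (y a) + integral {a..x} (\<lambda>x. L (p x))" if x: "a \<le> x" "x \<le> b" for x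
  proof -
    have "integral {a..x} (L \<circ> p) = L (integral {a..x} p)"
      using assms x
      by (intro integral_linear integrable_on_subinterval_real[of a b]) (auto intro: is_primitive_absint)
    moreover have "y x = y a + integral {a..x} p" by (rule is_primitive_eq[OF assms(1) x])
    ultimately show ?thesis using assms(2) by (simp add: o_def bounded_linear.linear linear_add)
  qed
qed

lemma is_primitive_cong:
  assumes "is_primitive a b p y" "\<And>x. x \<in> {a..b} \<Longrightarrow> p x = p' x" "\<And>x. x \<in> {a..b} \<Longrightarrow> y x = y' x"
  shows "is_primitive a b p' y'"
proof (rule is_primitiveI)
  show "p' absolutely_integrable_on {a..b}"
    using is_primitive_absint[OF assms(1)] set_integrable_cong[of lebesgue lebesgue "{a..b}" "{a..b}" p p'] assms(2) by blast
  show "y' x = y' a + integral {a..x} p'" if "a \<le> x" "x \<le> b" for x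
  proof -
    have "integral {a..x} p = integral {a..x} p'"
      using assms(2) that by (intro Henstock_Kurzweil_Integration.integral_cong) auto
    then show ?thesis using is_primitive_eq[OF assms(1) that] assms(3)[of x] assms(3)[of a] that by auto
  qed
qed

lemma is_primitive_const: "is_primitive a b (\<lambda>x. 0) (\<lambda>x. c)"
  by (rule is_primitiveI) auto

lemma absint_continuous_mult:
  fixes p u :: "real \<Rightarrow> 'a::{real_normed_algebra,euclidean_space}"
  assumes "p absolutely_integrable_on {a..b}" "continuous_on {a..b} u"
  shows "(\<lambda>x. u x * p x) absolutely_integrable_on {a..b}"
    "(\<lambda>x. p x * u x) absolutely_integrable_on {a..b}"
proof -
  have bl: "bilinear ((*) :: 'a \<Rightarrow> 'a \<Rightarrow> 'a)" "bilinear (\<lambda>x y :: 'a. y * x)"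
    unfolding bilinear_def
    by (auto intro!: bounded_linear.linear bounded_linear_mult_left bounded_linear_mult_right)
  have "u \<in> borel_measurable (lebesgue_on {a..b})"
    using assms(2) by (intro continuous_imp_measurable_on_sets_lebesgue) auto
  moreover have "bounded (u ` {a..b})"
    using assms(2) compact_continuous_image compact_imp_bounded compact_Icc by blast
  ultimately show "(\<lambda>x. u x * p x) absolutely_integrable_on {a..b}"
    "(\<lambda>x. p x * u x) absolutely_integrable_on {a..b}"
    using absolutely_integrable_bounded_measurable_product[OF bl(1), of u "{a..b}" p]
      absolutely_integrable_bounded_measurable_product[OF bl(2), of u "{a..b}" p] assms(1) by auto
qed

lemma norm_integral_le_mult:
  fixes f :: "real \<Rightarrow> 'a::euclidean_space"
  assumes "f integrable_on {x..y}" "M integrable_on {x..y}"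
    "\<And>t. t \<in> {x..y} \<Longrightarrow> norm (f t) \<le> e * M t"
  shows "norm (integral {x..y} f) \<le> e * integral {x..y} M"
proof -
  have "norm (integral {x..y} f) \<le> integral {x..y} (\<lambda>t. e * M t)"
    using assms by (intro Henstock_Kurzweil_Integration.integral_norm_bound_integral)
      (auto intro!: integrable_on_mult_right)
  then show ?thesis by simp
qed

text \<open>On a short interval the increment of the product is
  \<open>(y1 t - y1 s) * y2 t + y1 s * (y2 t - y2 s)\<close>, the integral of the density with
  \<open>y2\<close> and \<open>y1\<close> frozen at end points. Uniform continuity bounds the
  freezing error by \<open>e\<close> times the integral of
  \<open>norm (p1 r) + norm (p2 r)\<close>.\<close>

lemma is_primitive_mult:
  fixes y1 y2 :: "real \<Rightarrow> 'a::{real_normed_algebra,euclidean_space}"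
  assumes 1: "is_primitive a b p1 y1" and 2: "is_primitive a b p2 y2"
  shows "is_primitive a b (\<lambda>t. p1 t * y2 t + y1 t * p2 t) (\<lambda>t. y1 t * y2 t)"
proof (rule is_primitiveI)
  let ?p = "\<lambda>t. p1 t * y2 t + y1 t * p2 t"
  have c1: "continuous_on {a..b} y1" and c2: "continuous_on {a..b} y2"
    using 1 2 is_primitive_continuous by blast+
  have a1: "p1 absolutely_integrable_on {a..b}" and a2: "p2 absolutely_integrable_on {a..b}"
    using 1 2 by (auto simp: is_primitive_def)
  show ab: "?p absolutely_integrable_on {a..b}"
    using absint_continuous_mult(2)[OF a1 c2] absint_continuous_mult(1)[OF a2 c1]
    by (rule set_integral_add)
  define n where "n t = norm (p1 t) + norm (p2 t)" for t
  have n: "n absolutely_integrable_on {a..b}" unfolding n_def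
    using a1 a2 by (intro set_integral_add absolutely_integrable_norm[unfolded o_def])
  show "y1 x * y2 x = y1 a * y2 a + integral {a..x} ?p" if x: "a \<le> x" "x \<le> b" for x
  proof -
    define H where "H t = y1 t * y2 t - integral {a..t} ?p" for t
    have "H x = H a"
    proof (rule eq_if_locally_small_increments[OF x(1)])
      fix e :: real assume "0 < e"
      obtain d1 where d1: "d1 > 0" "\<And>s t. s \<in> {a..b} \<Longrightarrow> t \<in> {a..b} \<Longrightarrow> dist t s < d1 \<Longrightarrow> dist (y1 t) (y1 s) < e"
        using compact_uniformly_continuous[OF c1 compact_Icc] \<open>0 < e\<close>
        unfolding uniformly_continuous_on_def by meson
      obtain d2 where d2: "d2 > 0" "\<And>s t. s \<in> {a..b} \<Longrightarrow> t \<in> {a..b} \<Longrightarrow> dist t s < d2 \<Longrightarrow> dist (y2 t) (y2 s) < e"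
        using compact_uniformly_continuous[OF c2 compact_Icc] \<open>0 < e\<close>
        unfolding uniformly_continuous_on_def by meson
      show "\<exists>d>0. \<forall>s t. a \<le> s \<and> s \<le> t \<and> t \<le> x \<and> t - s < d \<longrightarrow>
          norm (H t - H s) \<le> e * (integral {a..t} n - integral {a..s} n)"
      proof (intro exI[of _ "min d1 d2"] conjI allI impI)
        show "0 < min d1 d2" using d1 d2 by simp
        fix s t assume st: "a \<le> s \<and> s \<le> t \<and> t \<le> x \<and> t - s < min d1 d2"
        have P: "is_primitive a b ?p (\<lambda>t. 0 + integral {a..t} ?p)"
          and N: "is_primitive a b n (\<lambda>t. 0 + integral {a..t} n)"
          by (rule is_primitive_integral[OF ab], rule is_primitive_integral[OF n])
        have sub: "f integrable_on {s..t}" if "f absolutely_integrable_on {a..b}" for f :: "real \<Rightarrow> 'a"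
          using that st x by (intro integrable_on_subinterval_real[of a b f]) auto
        have bl: "bounded_linear (\<lambda>u. u * y2 t)" "bounded_linear (\<lambda>u. y1 s * u)"
          by (simp_all add: bounded_linear_mult_left bounded_linear_mult_right)
        have e1: "(y1 t - y1 s) * y2 t = integral {s..t} (\<lambda>r. p1 r * y2 t)"
          using integral_linear[OF sub[OF a1] bl(1)] is_primitive_diff[OF 1, of s t] st x
          by (simp add: o_def)
        have e2: "y1 s * (y2 t - y2 s) = integral {s..t} (\<lambda>r. y1 s * p2 r)"
          using integral_linear[OF sub[OF a2] bl(2)] is_primitive_diff[OF 2, of s t] st x
          by (simp add: o_def)
        have i1: "(\<lambda>r. p1 r * y2 t) integrable_on {s..t}"
          using integrable_linear[OF sub[OF a1] bl(1)] by (simp add: o_def)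
        have i2: "(\<lambda>r. y1 s * p2 r) integrable_on {s..t}"
          using integrable_linear[OF sub[OF a2] bl(2)] by (simp add: o_def)
        have ip: "?p integrable_on {s..t}" using sub ab by blast
        have "H t - H s = (y1 t - y1 s) * y2 t + y1 s * (y2 t - y2 s) - integral {s..t} ?p"
          using is_primitive_diff[OF P, of s t] st x by (simp add: H_def algebra_simps)
        also have "\<dots> = integral {s..t} (\<lambda>r. p1 r * y2 t + y1 s * p2 r - ?p r)"
          unfolding e1 e2
          by (simp only: Henstock_Kurzweil_Integration.integral_diff[OF integrable_add[OF i1 i2] ip]
            Henstock_Kurzweil_Integration.integral_add[OF i1 i2])
        finally have "norm (H t - H s) = norm (integral {s..t} (\<lambda>r. p1 r * y2 t + y1 s * p2 r - ?p r))"
          by simp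
        also have "\<dots> \<le> e * integral {s..t} n"
        proof (rule norm_integral_le_mult)
          show "(\<lambda>r. p1 r * y2 t + y1 s * p2 r - ?p r) integrable_on {s..t}"
            by (rule integrable_diff[OF integrable_add[OF i1 i2] ip])
          show "n integrable_on {s..t}" using n st x by (intro integrable_on_subinterval_real[of a b n]) auto
          fix r assume r: "r \<in> {s..t}"
          have "norm (p1 r * y2 t + y1 s * p2 r - ?p r) = norm (p1 r * (y2 t - y2 r) + (y1 s - y1 r) * p2 r)"
            by (simp add: algebra_simps)
          also have "\<dots> \<le> norm (p1 r) * norm (y2 t - y2 r) + norm (y1 s - y1 r) * norm (p2 r)"
            by (meson add_mono norm_mult_ineq norm_triangle_le)
          also have "\<dots> \<le> norm (p1 r) * e + e * norm (p2 r)"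
          proof (intro add_mono mult_left_mono mult_right_mono)
            show "norm (y2 t - y2 r) \<le> e"
              using d2(2)[of r t] r st x by (auto simp: dist_norm)
            show "norm (y1 s - y1 r) \<le> e"
              using d1(2)[of r s] r st x by (auto simp: dist_norm)
          qed auto
          finally show "norm (p1 r * y2 t + y1 s * p2 r - ?p r) \<le> e * n r"
            by (simp add: n_def algebra_simps)
        qed
        also have "integral {s..t} n = integral {a..t} n - integral {a..s} n"
          using is_primitive_diff[OF N, of s t] st x by simp
        finally show "norm (H t - H s) \<le> e * (integral {a..t} n - integral {a..s} n)" .
      qed
    qed
    then show ?thesis by (simp add: H_def algebra_simps)
  qed
qed

text \<open>The freezing argument of the product rule again; here \<open>G'\<close> is frozen at one
  time \<open>r\<close> between \<open>s\<close> and \<open>t\<close>.\<close>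

lemma is_primitive_compose:
  fixes y :: "real \<Rightarrow> real"
  assumes 1: "is_primitive a b p y"
    and G: "\<And>x. (G has_real_derivative G' x) (at x)" and G': "continuous_on UNIV G'"
  shows "is_primitive a b (\<lambda>t. G' (y t) * p t) (\<lambda>t. G (y t))"
proof (rule is_primitiveI)
  let ?p = "\<lambda>t. G' (y t) * p t"
  have c1: "continuous_on {a..b} y" using 1 is_primitive_continuous by blast
  have a1: "p absolutely_integrable_on {a..b}" using 1 by (auto simp: is_primitive_def)
  have cG: "continuous_on {a..b} (\<lambda>t. G' (y t))"
    using continuous_on_compose2[OF G' c1] by simp
  show ab: "?p absolutely_integrable_on {a..b}" using absint_continuous_mult(1)[OF a1 cG] .
  define n where "n t = norm (p t)" for t
  have n: "n absolutely_integrable_on {a..b}" unfolding n_def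
    using a1 by (intro absolutely_integrable_norm[unfolded o_def])
  show "G (y x) = G (y a) + integral {a..x} ?p" if x: "a \<le> x" "x \<le> b" for x
  proof -
    define H where "H t = G (y t) - integral {a..t} ?p" for t
    have "H x = H a"
    proof (rule eq_if_locally_small_increments[OF x(1)])
      fix e :: real assume "0 < e"
      obtain d where d: "d > 0" "\<And>s t. s \<in> {a..b} \<Longrightarrow> t \<in> {a..b} \<Longrightarrow> dist t s < d \<Longrightarrow> dist (G' (y t)) (G' (y s)) < e"
        using compact_uniformly_continuous[OF cG compact_Icc] \<open>0 < e\<close>
        unfolding uniformly_continuous_on_def by meson
      show "\<exists>d>0. \<forall>s t. a \<le> s \<and> s \<le> t \<and> t \<le> x \<and> t - s < d \<longrightarrow>
          norm (H t - H s) \<le> e * (integral {a..t} n - integral {a..s} n)"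
      proof (intro exI[of _ d] conjI allI impI)
        show "0 < d" using d by simp
        fix s t assume st: "a \<le> s \<and> s \<le> t \<and> t \<le> x \<and> t - s < d"
        have P: "is_primitive a b ?p (\<lambda>t. 0 + integral {a..t} ?p)"
          and N: "is_primitive a b n (\<lambda>t. 0 + integral {a..t} n)"
          by (rule is_primitive_integral[OF ab], rule is_primitive_integral[OF n])
        \<comment> \<open>The mean value theorem gives a point between \<open>y s\<close> and
          \<open>y t\<close>. By the intermediate value theorem it has the form \<open>y r\<close>
          with \<open>r\<close> in \<open>{s..t}\<close>, so that uniform continuity in time
          applies.\<close>
        have "\<exists>r. s \<le> r \<and> r \<le> t \<and> G (y t) - G (y s) = (y t - y s) * G' (y r)"
        proof -
          have ivt: "\<exists>r. s \<le> r \<and> r \<le> t \<and> y r = z" if "min (y s) (y t) \<le> z" "z \<le> max (y s) (y t)" for z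
          proof -
            have "continuous_on {s..t} y" using c1 by (rule continuous_on_subset) (use st x in auto)
            then show ?thesis using that st IVT'[of y s z t] IVT2'[of y t z s]
              by (cases "y s \<le> y t") auto
          qed
          show ?thesis
          proof (cases "y s" "y t" rule: linorder_cases)
            case less
            then obtain z where "y s < z" "z < y t" "G (y t) - G (y s) = (y t - y s) * G' z"
              using MVT2[OF less, of G G'] G by auto
            then show ?thesis using ivt[of z] by auto
          next
            case equal then show ?thesis using st by auto
          next
            case greater
            then obtain z where "y t < z" "z < y s" "G (y s) - G (y t) = (y s - y t) * G' z"
              using MVT2[OF greater, of G G'] G by auto
            then show ?thesis using ivt[of z] by (auto simp: algebra_simps)
          qed
        qed
        then obtain r where r: "s \<le> r" "r \<le> t" "G (y t) - G (y s) = (y t - y s) * G' (y r)" by blast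
        have pst: "p integrable_on {s..t}"
          using a1 st x by (intro integrable_on_subinterval_real[of a b p]) auto
        have e1: "G (y t) - G (y s) = integral {s..t} (\<lambda>\<tau>. G' (y r) * p \<tau>)"
          using is_primitive_diff[OF 1, of s t] st x r(3) by (simp add: mult.commute)
        have ip: "?p integrable_on {s..t}"
          using ab st x by (intro integrable_on_subinterval_real[of a b ?p]) auto
        have i1: "(\<lambda>\<tau>. G' (y r) * p \<tau>) integrable_on {s..t}" using pst by (rule integrable_on_mult_right)
        have "H t - H s = (G (y t) - G (y s)) - integral {s..t} ?p"
          using is_primitive_diff[OF P, of s t] st x by (simp add: H_def algebra_simps)
        also have "\<dots> = integral {s..t} (\<lambda>\<tau>. G' (y r) * p \<tau> - ?p \<tau>)"
          unfolding e1 using i1 ip by (simp add: Henstock_Kurzweil_Integration.integral_diff)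
        finally have "norm (H t - H s) = norm (integral {s..t} (\<lambda>\<tau>. G' (y r) * p \<tau> - ?p \<tau>))" by simp
        also have "\<dots> \<le> e * integral {s..t} n"
        proof (rule norm_integral_le_mult)
          show "(\<lambda>\<tau>. G' (y r) * p \<tau> - ?p \<tau>) integrable_on {s..t}" using i1 ip by (intro integrable_diff)
          show "n integrable_on {s..t}" using n st x by (intro integrable_on_subinterval_real[of a b n]) auto
          fix \<tau> assume tau: "\<tau> \<in> {s..t}"
          have "dist (G' (y r)) (G' (y \<tau>)) < e" using tau r st x by (intro d(2)) (auto simp: dist_norm)
          then have "\<bar>G' (y r) - G' (y \<tau>)\<bar> * \<bar>p \<tau>\<bar> \<le> e * \<bar>p \<tau>\<bar>"
            by (intro mult_right_mono) (auto simp: dist_real_def)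
          then show "norm (G' (y r) * p \<tau> - ?p \<tau>) \<le> e * n \<tau>"
            by (simp add: n_def abs_mult[symmetric] left_diff_distrib)
        qed
        also have "integral {s..t} n = integral {a..t} n - integral {a..s} n"
          using is_primitive_diff[OF N, of s t] st x by simp
        finally show "norm (H t - H s) \<le> e * (integral {a..t} n - integral {a..s} n)" .
      qed
    qed
    then show ?thesis by (simp add: H_def algebra_simps)
  qed
qed

section \<open>Gronwall's inequality and the Caratheodory existence theorem\<close>

lemma exp_integral_primitive:
  fixes L :: "real \<Rightarrow> real"
  assumes "L absolutely_integrable_on {a..b}"
  shows "is_primitive a b (\<lambda>t. exp (c * integral {a..t} L) * (c * L t)) (\<lambda>t. exp (c * integral {a..t} L))"
proof -
  have "is_primitive a b (\<lambda>t. c * L t) (\<lambda>t. c * (0 + integral {a..t} L))"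
    by (rule is_primitive_linear[OF is_primitive_integral[OF assms] bounded_linear_mult_right])
  then show ?thesis
    using is_primitive_compose[of a b "\<lambda>t. c * L t" "\<lambda>t. c * (0 + integral {a..t} L)" exp exp]
    by (simp add: DERIV_exp continuous_on_exp)
qed

lemma variation_of_constants:
  fixes d k r :: "real \<Rightarrow> real"
  assumes d: "is_primitive a b (\<lambda>t. k t * d t + r t) d" and k: "k absolutely_integrable_on {a..b}"
  shows "is_primitive a b (\<lambda>t. exp (- integral {a..t} k) * r t) (\<lambda>t. exp (- integral {a..t} k) * d t)"
  using is_primitive_mult[OF exp_integral_primitive[OF k, of "-1"] d]
  by (rule is_primitive_cong) (auto simp: algebra_simps)

text \<open>After multiplication by the integrating factor \<open>exp (- integral {a..t} k)\<close>
  the function \<open>d\<close> has a nonnegative density and cannot fall below \<open>d a\<close>.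
  Gronwall's inequality and the comparison of Pruefer angles both rest on this.\<close>

lemma linear_ode_lower_bound:
  fixes d k r :: "real \<Rightarrow> real"
  assumes d: "is_primitive a b (\<lambda>t. k t * d t + r t) d" and k: "k absolutely_integrable_on {a..b}"
    and r: "\<And>t. t \<in> {a..b} \<Longrightarrow> 0 \<le> r t" and x: "a \<le> x" "x \<le> b"
  shows "exp (integral {a..x} k) * d a \<le> d x"
proof -
  let ?E = "exp (- integral {a..x} k)"
  have "?E * d x = d a + integral {a..x} (\<lambda>t. exp (- integral {a..t} k) * r t)"
    using is_primitive_eq[OF variation_of_constants[OF d k] x] by simp
  moreover have "0 \<le> integral {a..x} (\<lambda>t. exp (- integral {a..t} k) * r t)"
    using r x by (intro Henstock_Kurzweil_Integration.integral_nonneg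
        integrable_on_subinterval_real[OF is_primitive_absint[OF variation_of_constants[OF d k]]]) auto
  ultimately have "d a \<le> ?E * d x" by simp
  then have "exp (integral {a..x} k) * d a \<le> exp (integral {a..x} k) * (?E * d x)"
    by (intro mult_left_mono) auto
  then show ?thesis by (simp flip: mult.assoc exp_add)
qed

text \<open>The right-hand side \<open>V\<close> satisfies V' = L u with u at most V, so
  \<open>linear_ode_lower_bound\<close> applies to \<open>- V\<close> with remainder
  \<open>L * (V - u)\<close>. Of \<open>u\<close> only the integrability of \<open>L * u\<close>
  enters, which matters for the discontinuous function in \<open>angle_shift_nonneg\<close>.\<close>

lemma gronwall:
  fixes u L :: "real \<Rightarrow> real"
  assumes L: "L absolutely_integrable_on {a..b}" "\<And>t. t \<in> {a..b} \<Longrightarrow> 0 \<le> L t"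
    and Lu: "(\<lambda>t. L t * u t) absolutely_integrable_on {a..b}"
    and le: "\<And>t. t \<in> {a..b} \<Longrightarrow> u t \<le> A + integral {a..t} (\<lambda>t. L t * u t)"
    and x: "x \<in> {a..b}"
  shows "u x \<le> A * exp (integral {a..x} L)"
proof -
  define V where "V t = A + integral {a..t} (\<lambda>t. L t * u t)" for t
  have V: "is_primitive a b (\<lambda>t. L t * u t) V" unfolding V_def by (rule is_primitive_integral[OF Lu])
  have W: "is_primitive a b (\<lambda>t. - (L t * u t)) (\<lambda>t. - V t)"
    using is_primitive_linear[OF V bounded_linear_minus[OF bounded_linear_ident]] by simp
  have "exp (integral {a..x} L) * - V a \<le> - V x"
  proof (rule linear_ode_lower_bound[where k = L and d = "\<lambda>t. - V t" and r = "\<lambda>t. L t * (V t - u t)"])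
    show "is_primitive a b (\<lambda>t. L t * - V t + L t * (V t - u t)) (\<lambda>t. - V t)"
      using W by (rule is_primitive_cong) (auto simp: algebra_simps)
  qed (use L le x in \<open>auto simp: V_def\<close>)
  then have "V x \<le> A * exp (integral {a..x} L)" by (simp add: V_def mult.commute)
  then show ?thesis using le[OF x] by (simp add: V_def)
qed

text \<open>Picard iteration in a weighted supremum norm: the unknown is \<open>v\<close> with y = E
  v, and the weight makes the iteration a contraction on the whole interval at once, however large
  the integral of \<open>L\<close>.\<close>

lemma caratheodory_existence:
  fixes g :: "real \<Rightarrow> 'e::euclidean_space \<Rightarrow> 'e"
  assumes ab: "a \<le> b"
    and L: "L absolutely_integrable_on {a..b}" "\<And>t. t \<in> {a..b} \<Longrightarrow> 0 \<le> L t"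
    and g: "\<And>y. continuous_on {a..b} y \<Longrightarrow> (\<lambda>t. g t (y t)) absolutely_integrable_on {a..b}"
    and lip: "\<And>t u v. t \<in> {a..b} \<Longrightarrow> norm (g t u - g t v) \<le> L t * norm (u - v)"
  shows "\<exists>y. y a = y0 \<and> is_primitive a b (\<lambda>t. g t (y t)) y"
proof -
  \<comment> \<open>The factor 2 in the exponent yields the contraction constant 1/2: the integral
    of \<open>E t * (2 * L t)\<close> up to x is \<open>E x - 1\<close>.\<close>
  define E where "E t = exp (2 * integral {a..t} L)" for t
  have E: "is_primitive a b (\<lambda>t. E t * (2 * L t)) E"
    unfolding E_def by (rule exp_integral_primitive[OF L(1)])
  have Epos: "E t > 0" for t by (simp add: E_def)
  have Econt: "continuous_on {a..b} E" by (rule is_primitive_continuous[OF E])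
  have Ea: "E a = 1" by (simp add: E_def)
  \<comment> \<open>Clamping to \<open>{a..b}\<close> lets the iteration act on bounded continuous
    functions on the whole line, a complete type as \<open>banach_fix_type\<close> requires.\<close>
  define c where "c x = max a (min b x)" for x
  have c: "c x \<in> {a..b}" for x using ab by (auto simp: c_def)
  have c_id: "c x = x" if "x \<in> {a..b}" for x using that by (auto simp: c_def)
  have c_cont: "continuous_on UNIV c" unfolding c_def by (intro continuous_intros)
  define S where "S v x = (y0 + integral {a..c x} (\<lambda>t. g t (E t *\<^sub>R v t))) /\<^sub>R E (c x)"
    for v :: "real \<Rightarrow> 'e" and x
  have gv: "(\<lambda>t. g t (E t *\<^sub>R v t)) absolutely_integrable_on {a..b}" if "continuous_on {a..b} v" for v
    by (intro g continuous_intros Econt that)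
  have S_bcont: "S v \<in> bcontfun" if v: "continuous_on {a..b} v" for v
  proof -
    have cont: "continuous_on {a..b} (\<lambda>x. (y0 + integral {a..x} (\<lambda>t. g t (E t *\<^sub>R v t))) /\<^sub>R E x)"
      using gv[OF v] Epos
      by (intro continuous_intros Econt indefinite_integral_continuous_1)
         (auto simp: absolutely_integrable_on_def less_le)
    have "continuous_on UNIV (S v)"
      unfolding S_def by (rule continuous_on_compose2[OF cont c_cont]) (use c in blast)
    moreover have "range (S v) \<subseteq> (\<lambda>x. (y0 + integral {a..x} (\<lambda>t. g t (E t *\<^sub>R v t))) /\<^sub>R E x) ` {a..b}"
      using c by (auto simp: S_def)
    then have "bounded (range (S v))"
      using compact_imp_bounded[OF compact_continuous_image[OF cont compact_Icc]] bounded_subset by blast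
    ultimately show ?thesis by (simp add: bcontfun_def)
  qed
  define T where "T v = Bcontfun (S (apply_bcontfun v))" for v :: "real \<Rightarrow>\<^sub>C 'e"
  have T: "apply_bcontfun (T v) = S (apply_bcontfun v)" for v
    unfolding T_def by (rule Bcontfun_inverse[OF S_bcont]) simp
  have "\<exists>!v. T v = v"
  proof (rule banach_fix_type[of "1/2"])
    show "\<forall>v w. dist (T v) (T w) \<le> 1/2 * dist v w"
    proof (intro allI dist_bound)
      fix v w :: "real \<Rightarrow>\<^sub>C 'e" and x
      define x' where "x' = c x"
      have x': "a \<le> x'" "x' \<le> b" using c[of x] by (auto simp: x'_def)
      let ?gv = "\<lambda>t. g t (E t *\<^sub>R v t)" and ?gw = "\<lambda>t. g t (E t *\<^sub>R w t)"
      have iv: "?gv integrable_on {a..x'}" and iw: "?gw integrable_on {a..x'}"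
        using x' by (auto intro!: integrable_on_subinterval_real[OF gv])
      have iE: "(\<lambda>t. E t * (2 * L t)) integrable_on {a..x'}"
        using x' by (auto intro!: integrable_on_subinterval_real[OF is_primitive_absint[OF E]])
      have "norm (integral {a..x'} (\<lambda>t. ?gv t - ?gw t))
          \<le> (dist v w / 2) * integral {a..x'} (\<lambda>t. E t * (2 * L t))"
      proof (rule norm_integral_le_mult)
        fix t assume t: "t \<in> {a..x'}"
        have "norm (?gv t - ?gw t) \<le> L t * norm (E t *\<^sub>R v t - E t *\<^sub>R w t)"
          using t x' by (intro lip) auto
        also have "norm (E t *\<^sub>R v t - E t *\<^sub>R w t) = E t * dist (v t) (w t)"
          using Epos[of t] by (simp add: dist_norm flip: scaleR_diff_right)
        also have "L t * \<dots> \<le> L t * (E t * dist v w)"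
          using L(2)[of t] t x' Epos[of t] by (intro mult_left_mono dist_bounded) auto
        finally show "norm (?gv t - ?gw t) \<le> dist v w / 2 * (E t * (2 * L t))"
          by (simp add: algebra_simps)
      qed (use iE in \<open>auto intro!: integrable_diff[OF iv iw]\<close>)
      also have "integral {a..x'} (\<lambda>t. E t * (2 * L t)) = E x' - 1"
        using is_primitive_eq[OF E x'] Ea by simp
      also have "dist v w / 2 * (E x' - 1) \<le> E x' * (1/2 * dist v w)"
        by (simp add: algebra_simps)
      finally have *: "norm (integral {a..x'} (\<lambda>t. ?gv t - ?gw t)) \<le> E x' * (1/2 * dist v w)" .
      have "dist (T v x) (T w x) = norm (integral {a..x'} (\<lambda>t. ?gv t - ?gw t)) / E x'"
        unfolding T S_def x'_def[symmetric] dist_norm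
        using Epos[of x'] Henstock_Kurzweil_Integration.integral_diff[OF iv iw]
        by (simp add: divide_inverse mult.commute flip: scaleR_diff_right)
      also have "\<dots> \<le> 1/2 * dist v w"
        using * Epos[of x'] by (simp add: divide_le_eq mult.commute)
      finally show "dist (T v x) (T w x) \<le> 1/2 * dist v w" .
    qed
  qed auto
  then obtain v where "T v = v" by blast
  then have v: "v x = S v x" for x using T by metis
  define y where "y t = E t *\<^sub>R v t" for t
  have y: "y x = y0 + integral {a..x} (\<lambda>t. g t (y t))" if "x \<in> {a..b}" for x
    using Epos[of x] unfolding y_def by (subst v) (simp add: S_def c_id[OF that])
  have "y a = y0" using y[of a] ab by simp
  moreover have "is_primitive a b (\<lambda>t. g t (y t)) y"
  proof (rule is_primitiveI)
    show "(\<lambda>t. g t (y t)) absolutely_integrable_on {a..b}"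
      unfolding y_def by (rule gv) simp
    show "y x = y a + integral {a..x} (\<lambda>t. g t (y t))" if "a \<le> x" "x \<le> b" for x
      using y[of x] \<open>y a = y0\<close> that by simp
  qed
  ultimately show ?thesis by blast
qed

section \<open>The Jordan decomposition\<close>

lemma borel_unit_iff: "A \<in> borel_unit \<longleftrightarrow> A \<in> sets borel \<and> A \<subseteq> unit_ivl"
  by (subst sets_restrict_space_iff) auto

lemma sigma_algebra_borel_unit: "sigma_algebra unit_ivl borel_unit"
  using sets.sigma_algebra_axioms[of "restrict_space borel unit_ivl"] by (simp add: space_restrict_space)

lemma finite_signed_measure_Un:
  assumes "finite_signed_measure \<mu>" "A \<in> borel_unit" "B \<in> borel_unit" "A \<inter> B = {}"
  shows "\<mu> (A \<union> B) = \<mu> A + \<mu> B"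
proof -
  have e: "\<mu> {} = 0" using assms by (simp add: finite_signed_measure_def)
  have "disjoint_family (binaryset A B)"
    using assms(4) by (simp add: disjoint_family_on_def binaryset_def) blast
  moreover have "range (binaryset A B) \<subseteq> borel_unit"
    using assms by (simp add: range_binaryset_eq)
  ultimately have "(\<lambda>n. \<mu> (binaryset A B n)) sums \<mu> (\<Union>n. binaryset A B n)"
    using assms(1) unfolding finite_signed_measure_def by blast
  moreover have "(\<lambda>n. \<mu> (binaryset A B n)) sums (\<mu> A + \<mu> B)"
    using binaryset_sums[of \<mu> A B, OF e] .
  ultimately show ?thesis using sums_unique2 by (fastforce simp: UN_binaryset_eq)
qed

lemma finite_signed_measure_Diff:
  assumes "finite_signed_measure \<mu>" "A \<in> borel_unit" "B \<in> borel_unit" "B \<subseteq> A"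
  shows "\<mu> (A - B) = \<mu> A - \<mu> B"
proof -
  have "(A - B) \<inter> B = {}" "A - B \<union> B = A" using assms(4) by auto
  then show ?thesis
    using finite_signed_measure_Un[OF assms(1), of "A - B" B] assms by simp
qed

lemma finite_signed_measure_uminus:
  "finite_signed_measure \<mu> \<Longrightarrow> finite_signed_measure (\<lambda>A. - \<mu> A)"
  unfolding finite_signed_measure_def by (auto intro: sums_minus)

lemma finite_signed_measure_dx_plus:
  assumes "finite_signed_measure \<nu>"
  shows "finite_signed_measure (dx_plus \<nu>)"
  unfolding finite_signed_measure_def
proof (intro conjI allI impI)
  show "dx_plus \<nu> {} = 0" using assms by (simp add: dx_plus_def finite_signed_measure_def)
  fix A :: "nat \<Rightarrow> real set" assume A: "range A \<subseteq> borel_unit \<and> disjoint_family A"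
  have fin: "emeasure lborel (\<Union>n. A n) \<noteq> \<infinity>"
  proof -
    have "(\<Union>n. A n) \<subseteq> unit_ivl" using A borel_unit_iff by blast
    then have "emeasure lborel (\<Union>n. A n) \<le> emeasure lborel unit_ivl"
      by (intro emeasure_mono) auto
    then show ?thesis by (auto simp: top_unique)
  qed
  have "(\<lambda>n. measure lborel (A n)) sums measure lborel (\<Union>n. A n)"
    using A fin by (intro measure_UNION) (auto simp: borel_unit_iff)
  then show "(\<lambda>n. dx_plus \<nu> (A n)) sums dx_plus \<nu> (\<Union>n. A n)"
    unfolding dx_plus_def using assms A unfolding finite_signed_measure_def by (intro sums_add) auto
qed


text \<open>The set function behind \<open>pos_variation\<close>; \<open>emeasure\<close> can be
  identified with it only after its countable additivity is known.\<close>

definition pos_var :: "(real set \<Rightarrow> real) \<Rightarrow> real set \<Rightarrow> ennreal" where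
  "pos_var \<mu> A = (SUP B \<in> {B \<in> borel_unit. B \<subseteq> A}. ennreal (\<mu> B))"

lemma pos_var_upper: "B \<in> borel_unit \<Longrightarrow> B \<subseteq> A \<Longrightarrow> ennreal (\<mu> B) \<le> pos_var \<mu> A"
  unfolding pos_var_def by (rule SUP_upper) auto

lemma pos_var_least: "(\<And>B. B \<in> borel_unit \<Longrightarrow> B \<subseteq> A \<Longrightarrow> ennreal (\<mu> B) \<le> c) \<Longrightarrow> pos_var \<mu> A \<le> c"
  unfolding pos_var_def by (rule SUP_least) auto

lemma pos_var_mono: "A \<subseteq> B \<Longrightarrow> pos_var \<mu> A \<le> pos_var \<mu> B"
  by (rule pos_var_least) (auto intro: pos_var_upper)

text \<open>A subset of \<open>A\<close> and a subset of \<open>A'\<close> can be chosen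
  independently, and their union competes in the supremum for \<open>A \<union> A'\<close>.\<close>

lemma pos_var_superadditive:
  assumes \<mu>: "finite_signed_measure \<mu>" and A: "A \<inter> A' = {}"
  shows "pos_var \<mu> A + pos_var \<mu> A' \<le> pos_var \<mu> (A \<union> A')"
proof -
  let ?I = "\<lambda>A. {B \<in> borel_unit. B \<subseteq> A}"
  have ne: "?I A \<noteq> {}" for A by auto
  have 2: "ennreal (\<mu> B) + ennreal (\<mu> C) \<le> pos_var \<mu> (A \<union> A')" if "B \<in> ?I A" "C \<in> ?I A'" for B C
  proof -
    \<comment> \<open>Negative values count as 0 in \<open>ennreal\<close>, hence the separate
      comparisons with \<open>B\<close>, \<open>C\<close> and \<open>B \<union> C\<close>.\<close>
    have *: "ennreal (\<mu> B) \<le> pos_var \<mu> (A \<union> A')" "ennreal (\<mu> C) \<le> pos_var \<mu> (A \<union> A')"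
      "ennreal (\<mu> (B \<union> C)) \<le> pos_var \<mu> (A \<union> A')"
      using that by (auto intro!: pos_var_upper)
    have "\<mu> (B \<union> C) = \<mu> B + \<mu> C"
      using that A by (intro finite_signed_measure_Un[OF \<mu>]) auto
    then show ?thesis
      using * by (cases "0 \<le> \<mu> B"; cases "0 \<le> \<mu> C") (auto simp: ennreal_neg)
  qed
  have "ennreal (\<mu> B) + pos_var \<mu> A' \<le> pos_var \<mu> (A \<union> A')" if "B \<in> ?I A" for B
  proof -
    have "(SUP C\<in>?I A'. ennreal (\<mu> C) + ennreal (\<mu> B)) = pos_var \<mu> A' + ennreal (\<mu> B)"
      unfolding pos_var_def by (rule ennreal_SUP_add_left[OF ne])
    moreover have "(SUP C\<in>?I A'. ennreal (\<mu> C) + ennreal (\<mu> B)) \<le> pos_var \<mu> (A \<union> A')"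
      using 2[OF that] by (intro SUP_least) (simp add: add.commute)
    ultimately show ?thesis by (simp add: add.commute)
  qed
  then have "(SUP B\<in>?I A. ennreal (\<mu> B) + pos_var \<mu> A') \<le> pos_var \<mu> (A \<union> A')"
    by (intro SUP_least)
  moreover have "(SUP B\<in>?I A. ennreal (\<mu> B) + pos_var \<mu> A') = pos_var \<mu> A + pos_var \<mu> A'"
    unfolding pos_var_def by (rule ennreal_SUP_add_left[OF ne])
  ultimately show ?thesis by simp
qed

text \<open>One inequality is superadditivity on finite unions. For the other a competitor
  \<open>B\<close> is cut into the pieces \<open>B \<inter> A i\<close>, whose measures sum to
  \<open>\<mu> B\<close> and are each at most the variation of \<open>A i\<close>.\<close>

lemma pos_var_suminf:
  assumes \<mu>: "finite_signed_measure \<mu>" and A: "range A \<subseteq> borel_unit" "disjoint_family A"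
  shows "(\<Sum>i. pos_var \<mu> (A i)) = pos_var \<mu> (\<Union>i. A i)"
proof (rule antisym)
  have "(\<Sum>i<n. pos_var \<mu> (A i)) \<le> pos_var \<mu> (\<Union>i<n. A i)" for n
  proof (induction n)
    case (Suc n)
    have dj: "A i \<inter> A n = {}" if "i < n" for i
      using that by (intro disjoint_family_onD[OF A(2)]) auto
    have "(\<Union>i<n. A i) \<inter> A n = {}"
    proof (rule equals0I)
      fix x assume "x \<in> (\<Union>i<n. A i) \<inter> A n"
      then obtain i where "i < n" "x \<in> A i" "x \<in> A n" by blast
      then show False using dj[of i] by blast
    qed
    then have "pos_var \<mu> (\<Union>i<n. A i) + pos_var \<mu> (A n) \<le> pos_var \<mu> ((\<Union>i<n. A i) \<union> A n)"
      by (rule pos_var_superadditive[OF \<mu>])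
    moreover have "(\<Union>i<n. A i) \<union> A n = (\<Union>i<Suc n. A i)" by (auto simp: lessThan_Suc)
    ultimately show ?case using order_trans[OF add_right_mono[OF Suc.IH, of "pos_var \<mu> (A n)"]] by simp
  qed simp
  then have "(\<Sum>i<n. pos_var \<mu> (A i)) \<le> pos_var \<mu> (\<Union>i. A i)" for n
    by (rule order_trans) (auto intro: pos_var_mono)
  then show "(\<Sum>i. pos_var \<mu> (A i)) \<le> pos_var \<mu> (\<Union>i. A i)"
    by (intro suminf_le_const) auto
next
  show "pos_var \<mu> (\<Union>i. A i) \<le> (\<Sum>i. pos_var \<mu> (A i))"
  proof (rule pos_var_least)
    fix B assume B: "B \<in> borel_unit" "B \<subseteq> (\<Union>i. A i)"
    have "range (\<lambda>i. B \<inter> A i) \<subseteq> borel_unit \<and> disjoint_family (\<lambda>i. B \<inter> A i)"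
      using A B(1) by (auto simp: disjoint_family_on_def)
    then have "(\<lambda>i. \<mu> (B \<inter> A i)) sums \<mu> (\<Union>i. B \<inter> A i)"
      using \<mu> unfolding finite_signed_measure_def by blast
    moreover have "(\<Union>i. B \<inter> A i) = B" using B by auto
    ultimately have "(\<lambda>n. \<Sum>i<n. \<mu> (B \<inter> A i)) \<longlonglongrightarrow> \<mu> B" by (simp add: sums_def)
    then have lim: "(\<lambda>n. ennreal (\<Sum>i<n. \<mu> (B \<inter> A i))) \<longlonglongrightarrow> ennreal (\<mu> B)"
      by (rule tendsto_ennrealI)
    show "ennreal (\<mu> B) \<le> (\<Sum>i. pos_var \<mu> (A i))"
    proof (rule LIMSEQ_le_const2[OF lim], intro exI allI impI)
      fix n
      have "ennreal (\<Sum>i<n. \<mu> (B \<inter> A i)) \<le> ennreal (\<Sum>i<n. max 0 (\<mu> (B \<inter> A i)))"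
        by (intro ennreal_leI sum_mono) auto
      also have "\<dots> = (\<Sum>i<n. ennreal (max 0 (\<mu> (B \<inter> A i))))" by (simp add: sum_ennreal)
      also have "\<dots> \<le> (\<Sum>i<n. pos_var \<mu> (A i))"
      proof (rule sum_mono)
        fix i
        have "ennreal (max 0 (\<mu> (B \<inter> A i))) = ennreal (\<mu> (B \<inter> A i))"
          by (auto simp: max_def ennreal_neg)
        also have "\<dots> \<le> pos_var \<mu> (A i)" using A B by (intro pos_var_upper) auto
        finally show "ennreal (max 0 (\<mu> (B \<inter> A i))) \<le> pos_var \<mu> (A i)" .
      qed
      also have "\<dots> \<le> (\<Sum>i. pos_var \<mu> (A i))" by (intro sum_le_suminf) auto
      finally show "ennreal (\<Sum>i<n. \<mu> (B \<inter> A i)) \<le> (\<Sum>i. pos_var \<mu> (A i))" .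
    qed
  qed
qed

text \<open>If the positive variation of \<open>A\<close> is infinite, \<open>A\<close> splits into two parts of large measure,
  one of which has infinite positive variation; iterating this contradicts the convergence of the
  measures of a decreasing sequence of sets.\<close>

lemma pos_var_finite:
  assumes \<mu>: "finite_signed_measure \<mu>"
  shows "pos_var \<mu> unit_ivl < \<infinity>"
proof (rule ccontr)
  assume "\<not> ?thesis"
  then have top: "pos_var \<mu> unit_ivl = \<infinity>" by (simp flip: less_top)
  have \<mu>0: "\<mu> {} = 0" using \<mu> by (simp add: finite_signed_measure_def)
  have split: "\<exists>B. (B \<in> borel_unit \<and> pos_var \<mu> B = \<infinity>) \<and> B \<subseteq> A \<and> c \<le> \<bar>\<mu> B\<bar>"
    if A: "A \<in> borel_unit \<and> pos_var \<mu> A = \<infinity>" for A and c :: real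
  proof -
    \<comment> \<open>A subset \<open>C\<close> whose measure exceeds
      \<open>\<bar>\<mu> A\<bar> + \<bar>c\<bar>\<close> leaves a rest \<open>A - C\<close> of
      measure below \<open>- \<bar>c\<bar>\<close>, so both parts are large in absolute
      value.\<close>
    have "\<exists>C\<in>borel_unit. C \<subseteq> A \<and> \<bar>\<mu> A\<bar> + \<bar>c\<bar> < \<mu> C"
    proof (rule ccontr)
      assume "\<not> ?thesis"
      then have "pos_var \<mu> A \<le> ennreal (\<bar>\<mu> A\<bar> + \<bar>c\<bar>)"
        by (intro pos_var_least ennreal_leI) (auto simp: not_less)
      then show False using A by (simp add: top_unique)
    qed
    then obtain C where C: "C \<in> borel_unit" "C \<subseteq> A" "\<bar>\<mu> A\<bar> + \<bar>c\<bar> < \<mu> C" by blast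
    have D: "A - C \<in> borel_unit" using A C by auto
    have "\<mu> (A - C) = \<mu> A - \<mu> C" using finite_signed_measure_Diff[OF \<mu>] A C by blast
    then have big: "c \<le> \<bar>\<mu> (A - C)\<bar>" "c \<le> \<bar>\<mu> C\<bar>" using C by auto
    have r: "range (binaryset C (A - C)) \<subseteq> borel_unit" "disjoint_family (binaryset C (A - C))"
      using C D by (auto simp: range_binaryset_eq disjoint_family_on_def binaryset_def)
    have "pos_var \<mu> {} = 0" using \<mu>0 by (auto intro!: antisym pos_var_least)
    then have "(\<Sum>i. pos_var \<mu> (binaryset C (A - C) i)) = pos_var \<mu> C + pos_var \<mu> (A - C)"
      by (rule suminf_binaryset_eq)
    then have "pos_var \<mu> A = pos_var \<mu> C + pos_var \<mu> (A - C)"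
      using pos_var_suminf[OF \<mu> r] C by (simp add: UN_binaryset_eq Un_absorb1)
    then have "pos_var \<mu> C = \<infinity> \<or> pos_var \<mu> (A - C) = \<infinity>"
      using A by (metis ennreal_add_eq_top infinity_ennreal_def)
    then show ?thesis using C D big by blast
  qed
  have "\<exists>B. \<forall>n. (B n \<in> borel_unit \<and> pos_var \<mu> (B n) = \<infinity>) \<and> (B (Suc n) \<subseteq> B n \<and> real n \<le> \<bar>\<mu> (B (Suc n))\<bar>)"
  proof (rule dependent_nat_choice)
    show "\<exists>B. B \<in> borel_unit \<and> pos_var \<mu> B = \<infinity>"
      using top by (intro exI[of _ unit_ivl]) (auto simp: borel_unit_iff)
  qed (use split in blast)
  then obtain B where B: "\<And>n. B n \<in> borel_unit" "\<And>n. B (Suc n) \<subseteq> B n" "\<And>n. real n \<le> \<bar>\<mu> (B (Suc n))\<bar>"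
    by blast
  have dec: "B m \<subseteq> B n" if "n \<le> m" for n m
    by (rule lift_Suc_antimono_le[of B, OF B(2) that])
  have dj: "disjoint_family (\<lambda>i. B i - B (Suc i))"
  proof -
    have "(B i - B (Suc i)) \<inter> (B j - B (Suc j)) = {}" if "i < j" for i j
      using dec[of "Suc i" j] that by auto
    then show ?thesis
      unfolding disjoint_family_on_def
    proof (intro ballI impI)
      fix i j :: nat assume "i \<noteq> j"
      then consider "i < j" | "j < i" by linarith
      then show "(B i - B (Suc i)) \<inter> (B j - B (Suc j)) = {}"
        by cases (use \<open>\<And>i j. i < j \<Longrightarrow> (B i - B (Suc i)) \<inter> (B j - B (Suc j)) = {}\<close> in blast)+
    qed
  qed
  have "range (\<lambda>i. B i - B (Suc i)) \<subseteq> borel_unit" using B(1) by (auto intro: sets.Diff)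
  \<comment> \<open>The differences are disjoint, so their measures are summable; the partial sums
    telescope to \<open>\<mu> (B 0) - \<mu> (B n)\<close>, and \<open>\<mu> (B n)\<close> would have
    to stay bounded.\<close>
  with dj have "(\<lambda>i. \<mu> (B i - B (Suc i))) sums \<mu> (\<Union>i. B i - B (Suc i))"
    using \<mu> unfolding finite_signed_measure_def by (auto dest!: spec[of _ "\<lambda>i. B i - B (Suc i)"])
  moreover have "\<mu> (B i - B (Suc i)) = \<mu> (B i) - \<mu> (B (Suc i))" for i
    using finite_signed_measure_Diff[OF \<mu>] B by blast
  ultimately have "(\<lambda>n. \<Sum>i<n. \<mu> (B i) - \<mu> (B (Suc i))) \<longlonglongrightarrow> \<mu> (\<Union>i. B i - B (Suc i))"
    by (simp add: sums_def)
  then have "(\<lambda>n. \<mu> (B 0) - \<mu> (B n)) \<longlonglongrightarrow> \<mu> (\<Union>i. B i - B (Suc i))"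
    using sum_lessThan_telescope'[of "\<lambda>n. \<mu> (B n)"] by simp
  from tendsto_diff[OF tendsto_const[of "\<mu> (B 0)"] this]
  have "convergent (\<lambda>n. \<mu> (B n))" by (auto simp: convergent_def)
  then have "Bseq (\<lambda>n. \<mu> (B n))" by (rule convergent_imp_Bseq)
  then obtain K where K: "\<And>n. norm (\<mu> (B n)) \<le> K" by (auto simp: Bseq_def)
  obtain n :: nat where "K < real n" using reals_Archimedean2 by blast
  then show False using B(3)[of n] K[of "Suc n"] by simp
qed

lemma
  shows space_pos_variation [simp]: "space (pos_variation \<mu>) = unit_ivl"
    and sets_pos_variation [simp, measurable_cong]: "sets (pos_variation \<mu>) = borel_unit"
proof -
  have sub: "borel_unit \<subseteq> Pow unit_ivl" using borel_unit_iff by blast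
  then show "space (pos_variation \<mu>) = unit_ivl"
    unfolding pos_variation_def by (rule space_measure_of)
  show "sets (pos_variation \<mu>) = borel_unit"
    unfolding pos_variation_def sets_measure_of[OF sub]
    by (rule sigma_algebra.sigma_sets_eq[OF sigma_algebra_borel_unit])
qed

lemma
  shows space_neg_variation [simp]: "space (neg_variation \<mu>) = unit_ivl"
    and sets_neg_variation [simp, measurable_cong]: "sets (neg_variation \<mu>) = borel_unit"
  by (simp_all add: neg_variation_def)

lemma emeasure_pos_variation:
  assumes \<mu>: "finite_signed_measure \<mu>" and A: "A \<in> borel_unit"
  shows "emeasure (pos_variation \<mu>) A = pos_var \<mu> A"
proof (rule emeasure_measure_of)
  show "pos_variation \<mu> = measure_of unit_ivl borel_unit (pos_var \<mu>)"
    unfolding pos_variation_def pos_var_def ..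
  show "borel_unit \<subseteq> Pow unit_ivl" using borel_unit_iff by blast
  show "positive (sets (pos_variation \<mu>)) (pos_var \<mu>)"
    using \<mu> by (auto simp: positive_def finite_signed_measure_def intro!: antisym pos_var_least)
  show "countably_additive (sets (pos_variation \<mu>)) (pos_var \<mu>)"
    using pos_var_suminf[OF \<mu>] by (auto simp: countably_additive_def)
qed (use A in simp)

lemma finite_measure_pos_variation:
  "finite_signed_measure \<mu> \<Longrightarrow> finite_measure (pos_variation \<mu>)"
  using emeasure_pos_variation[of \<mu> unit_ivl] pos_var_finite[of \<mu>]
  by (intro finite_measureI) (auto simp: borel_unit_iff)

lemma finite_measure_neg_variation:
  "finite_signed_measure \<mu> \<Longrightarrow> finite_measure (neg_variation \<mu>)"
  unfolding neg_variation_def by (intro finite_measure_pos_variation finite_signed_measure_uminus)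

text \<open>Replacing a competitor \<open>B\<close> by \<open>A - B\<close> turns the bound of
  \<open>- \<mu>\<close> by the negative variation into one inequality; the reverse is the same
  inequality for \<open>- \<mu>\<close>.\<close>

lemma jordan_decomposition:
  assumes \<mu>: "finite_signed_measure \<mu>" and A: "A \<in> borel_unit"
  shows "\<mu> A = measure (pos_variation \<mu>) A - measure (neg_variation \<mu>) A"
proof -
  have ineq: "measure (pos_variation \<mu>) A \<le> \<mu> A + measure (neg_variation \<mu>) A"
    if \<mu>: "finite_signed_measure \<mu>" for \<mu>
  proof -
    interpret p: finite_measure "pos_variation \<mu>" by (rule finite_measure_pos_variation[OF that])
    interpret n: finite_measure "neg_variation \<mu>" by (rule finite_measure_neg_variation[OF that])
    have neg: "- \<mu> B \<le> measure (neg_variation \<mu>) A" if "B \<in> borel_unit" "B \<subseteq> A" for B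
    proof -
      have "ennreal (- \<mu> B) \<le> emeasure (neg_variation \<mu>) A"
        unfolding neg_variation_def emeasure_pos_variation[OF finite_signed_measure_uminus[OF \<mu>] A]
        using pos_var_upper[OF that, of "\<lambda>A. - \<mu> A"] .
      then show ?thesis by (simp add: n.emeasure_eq_measure)
    qed
    have "pos_var \<mu> A \<le> ennreal (\<mu> A + measure (neg_variation \<mu>) A)"
    proof (intro pos_var_least ennreal_leI)
      fix B assume B: "B \<in> borel_unit" "B \<subseteq> A"
      have "\<mu> (A - B) = \<mu> A - \<mu> B" using finite_signed_measure_Diff[OF \<mu>] A B by blast
      then show "\<mu> B \<le> \<mu> A + measure (neg_variation \<mu>) A"
        using neg[of "A - B"] A B by auto
    qed
    moreover have "0 \<le> \<mu> A + measure (neg_variation \<mu>) A"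
      using neg[OF A] by simp
    ultimately show ?thesis
      using emeasure_pos_variation[OF \<mu> A] unfolding p.emeasure_eq_measure
      by (metis ennreal_le_iff)
  qed
  have "neg_variation (\<lambda>A. - \<mu> A) = pos_variation \<mu>" by (simp add: neg_variation_def)
  then show ?thesis
    using ineq[OF \<mu>] ineq[OF finite_signed_measure_uminus[OF \<mu>]] by (simp add: neg_variation_def)
qed

section \<open>Integration by parts against a signed measure\<close>

text \<open>Fubini for \<open>h' s\<close> on the triangle a \<le> t < s \<le> b: the inner integral
  over \<open>s\<close> is \<open>h b - h t\<close>, the inner integral over \<open>t\<close> is the
  measure of \<open>{a..<s}\<close> times \<open>h' s\<close>. The half-open interval is dictated by
  the convention df [a,b) = f b - f a.\<close>

lemma fubini_half_open:
  fixes h h' :: "real \<Rightarrow> 'a::euclidean_space"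
  assumes M: "finite_measure M" "sets M = borel_unit"
    and h: "is_primitive a b h' h"
  shows "integrable M (\<lambda>t. indicator {a..<b} t *\<^sub>R h t)"
    and "integral\<^sup>L M (\<lambda>t. indicator {a..<b} t *\<^sub>R h t) =
      measure M ({a..<b} \<inter> unit_ivl) *\<^sub>R h b - integral {a..b} (\<lambda>s. measure M ({a..<s} \<inter> unit_ivl) *\<^sub>R h' s)"
    and "(\<lambda>s. measure M ({a..<s} \<inter> unit_ivl) *\<^sub>R h' s) integrable_on {a..b}"
proof -
  let ?L = "lebesgue_on {a..b}"
  interpret M: finite_measure M by fact
  have L: "finite_measure ?L"
    by (simp add: finite_measure_lebesgue_on)
  interpret L: finite_measure ?L by fact
  interpret pair_sigma_finite M ?L ..
  have spM: "space M = unit_ivl" using sets_eq_imp_space_eq[OF M(2)] by (simp add: space_restrict_space)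
  have h'i: "integrable ?L h'"
    using is_primitive_absint[OF h] by (simp add: absolutely_integrable_measurable integrable_norm_iff set_integrable_def integrable_restrict_space)
  have [measurable]: "h' \<in> borel_measurable ?L" using h'i by simp
  have idM [measurable]: "(\<lambda>t. t) \<in> borel_measurable M"
    by (subst measurable_cong_sets[OF M(2) refl]) (auto intro: measurable_restrict_space1)
  have idL [measurable]: "(\<lambda>t. t) \<in> borel_measurable ?L"
    by (intro measurable_restrict_space1 measurable_completion) simp
  define f where "f t s = (if a \<le> t \<and> t < s then h' s else 0)" for t s :: real
  have fm: "case_prod f \<in> borel_measurable (M \<Otimes>\<^sub>M ?L)"
    unfolding f_def case_prod_beta by measurable
  have hi: "integral {t..b} h' = h b - h t" if "a \<le> t" "t \<le> b" for t
    using is_primitive_diff[OF h, of t b] that by simp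
  have fi: "integrable ?L (\<lambda>s. f t s)" for t
    by (rule Bochner_Integration.integrable_bound[OF h'i]) (auto simp: f_def)
  have fL: "(\<integral>s. f t s \<partial>?L) = (if a \<le> t \<and> t < b then h b - h t else 0)" for t
  proof (cases "a \<le> t \<and> t < b")
    case True
    have "(\<integral>s. f t s \<partial>?L) = integral {a..b} (f t)"
      by (rule lebesgue_integral_eq_integral[OF fi]) simp
    also have "\<dots> = integral {a..b} (\<lambda>s. if s \<in> {t..b} then h' s else 0)"
      by (rule integral_spike[of "{t}"]) (use True in \<open>auto simp: f_def\<close>)
    also have "\<dots> = integral {t..b} h'"
      using True by (subst integral_restrict_Int) auto
    finally show ?thesis using hi True by simp
  next
    case False
    then have "(\<integral>s. f t s \<partial>?L) = (\<integral>s. 0 \<partial>?L)"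
      by (intro Bochner_Integration.integral_cong) (auto simp: f_def)
    then show ?thesis using False by auto
  qed
  have fint: "integrable (M \<Otimes>\<^sub>M ?L) (case_prod f)"
  proof (rule Fubini_integrable[OF fm])
    have "(\<lambda>t. \<integral>s. norm (case (t, s) of (t, s) \<Rightarrow> f t s) \<partial>?L) \<in> borel_measurable M"
      using fm by measurable
    moreover have "norm (\<integral>s. norm (case (t, s) of (t, s) \<Rightarrow> f t s) \<partial>?L) \<le> (\<integral>s. norm (h' s) \<partial>?L)" for t
    proof -
      have "(\<integral>s. norm (f t s) \<partial>?L) \<le> (\<integral>s. norm (h' s) \<partial>?L)"
        by (intro integral_mono integrable_norm fi h'i) (auto simp: f_def)
      moreover have "0 \<le> (\<integral>s. norm (f t s) \<partial>?L)" by simp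
      ultimately show ?thesis by simp
    qed
    ultimately show "integrable M (\<lambda>t. \<integral>s. norm (case (t, s) of (t, s) \<Rightarrow> f t s) \<partial>?L)"
      by (intro M.integrable_const_bound) auto
  qed (use fi in auto)
  have fM: "(\<integral>t. f t s \<partial>M) = measure M ({a..<s} \<inter> unit_ivl) *\<^sub>R h' s" if "s \<in> {a..b}" for s
  proof -
    have "(\<integral>t. f t s \<partial>M) = (\<integral>t. indicator ({a..<s} \<inter> unit_ivl) t *\<^sub>R h' s \<partial>M)"
      by (intro Bochner_Integration.integral_cong) (auto simp: f_def spM indicator_def)
    also have "\<dots> = measure M ({a..<s} \<inter> unit_ivl) *\<^sub>R h' s"
      by (subst has_bochner_integral_integral_eq[OF has_bochner_integral_indicator])
        (auto simp: M(2) borel_unit_iff M.emeasure_eq_measure)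
    finally show ?thesis .
  qed
  have fub: "(\<integral>s. (\<integral>t. f t s \<partial>M) \<partial>?L) = (\<integral>t. (\<integral>s. f t s \<partial>?L) \<partial>M)"
    by (rule Fubini_integral[OF fint])
  have iM: "integrable ?L (\<lambda>s. \<integral>t. f t s \<partial>M)"
    using integrable_snd[OF fint] by simp
  have iM': "integrable ?L (\<lambda>s. measure M ({a..<s} \<inter> unit_ivl) *\<^sub>R h' s)"
    using iM by (rule Bochner_Integration.integrable_cong[THEN iffD1, OF refl, rotated]) (simp add: fM)
  show "(\<lambda>s. measure M ({a..<s} \<inter> unit_ivl) *\<^sub>R h' s) integrable_on {a..b}"
    by (rule integrable_on_lebesgue_on[OF iM']) simp
  have 1: "(\<integral>s. (\<integral>t. f t s \<partial>M) \<partial>?L) = integral {a..b} (\<lambda>s. measure M ({a..<s} \<inter> unit_ivl) *\<^sub>R h' s)"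
  proof -
    have "(\<integral>s. (\<integral>t. f t s \<partial>M) \<partial>?L) = (\<integral>s. measure M ({a..<s} \<inter> unit_ivl) *\<^sub>R h' s \<partial>?L)"
      by (intro Bochner_Integration.integral_cong) (auto simp: fM)
    also have "\<dots> = integral {a..b} (\<lambda>s. measure M ({a..<s} \<inter> unit_ivl) *\<^sub>R h' s)"
      by (rule lebesgue_integral_eq_integral[OF iM']) simp
    finally show ?thesis .
  qed
  have iL: "integrable M (\<lambda>t. \<integral>s. f t s \<partial>?L)"
    using integrable_fst[OF fint] by simp
  have ic: "integrable M (\<lambda>t. indicator ({a..<b} \<inter> unit_ivl) t *\<^sub>R h b)"
    by (intro integrable_scaleR_left integrable_real_indicator) (auto simp: M(2) borel_unit_iff M.emeasure_eq_measure)
  have eq: "indicator {a..<b} t *\<^sub>R h t = indicator ({a..<b} \<inter> unit_ivl) t *\<^sub>R h b - (\<integral>s. f t s \<partial>?L)"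
    if "t \<in> space M" for t
    using that unfolding fL by (auto simp: spM indicator_def)
  show "integrable M (\<lambda>t. indicator {a..<b} t *\<^sub>R h t)"
    using Bochner_Integration.integrable_diff[OF ic iL]
    by (rule Bochner_Integration.integrable_cong[THEN iffD1, OF refl, rotated]) (simp add: eq)
  have "integral\<^sup>L M (\<lambda>t. indicator {a..<b} t *\<^sub>R h t)
      = (\<integral>t. indicator ({a..<b} \<inter> unit_ivl) t *\<^sub>R h b - (\<integral>s. f t s \<partial>?L) \<partial>M)"
    by (rule Bochner_Integration.integral_cong[OF refl eq])
  also have "\<dots> = (\<integral>t. indicator ({a..<b} \<inter> unit_ivl) t *\<^sub>R h b \<partial>M) - (\<integral>t. (\<integral>s. f t s \<partial>?L) \<partial>M)"
    by (rule Bochner_Integration.integral_diff[OF ic iL])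
  also have "(\<integral>t. indicator ({a..<b} \<inter> unit_ivl) t *\<^sub>R h b \<partial>M) = measure M ({a..<b} \<inter> unit_ivl) *\<^sub>R h b"
    by (subst has_bochner_integral_integral_eq[OF has_bochner_integral_indicator])
      (auto simp: M(2) borel_unit_iff M.emeasure_eq_measure)
  finally show "integral\<^sup>L M (\<lambda>t. indicator {a..<b} t *\<^sub>R h t) =
      measure M ({a..<b} \<inter> unit_ivl) *\<^sub>R h b - integral {a..b} (\<lambda>s. measure M ({a..<s} \<inter> unit_ivl) *\<^sub>R h' s)"
    using fub 1 by simp
qed

text \<open>The interval is open at \<open>x\<close>, so the function is left-continuous like the
  representatives of f, its increments are the measures of the intervals \<open>{a..<s}\<close>, and
  its value at 1 is the total mass.\<close>

definition dist_fun :: "(real set \<Rightarrow> real) \<Rightarrow> real \<Rightarrow> real" where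
  "dist_fun \<mu> x = \<mu> {0<..<x}"

lemma dist_fun_0 [simp]: "finite_signed_measure \<mu> \<Longrightarrow> dist_fun \<mu> 0 = 0"
  by (simp add: dist_fun_def finite_signed_measure_def)

lemma dist_fun_diff:
  assumes "finite_signed_measure \<mu>" "0 \<le> a" "a \<le> s" "s \<le> 1"
  shows "\<mu> ({a..<s} \<inter> unit_ivl) = dist_fun \<mu> s - dist_fun \<mu> a"
proof -
  have "{0<..<s} - {0<..<a} = {a..<s} \<inter> unit_ivl" using assms by auto
  moreover have "{0<..<s} \<in> borel_unit" "{0<..<a} \<in> borel_unit" "{0<..<a} \<subseteq> {0<..<s}"
    unfolding borel_unit_iff using assms by auto
  ultimately show ?thesis
    using finite_signed_measure_Diff[OF assms(1), of "{0<..<s}" "{0<..<a}"] by (simp add: dist_fun_def)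
qed

text \<open>Difference of the Fubini formulas for the two variations. Their measures of
  \<open>{a..<s}\<close> combine to \<open>dist_fun \<mu> s - dist_fun \<mu> a\<close>, and the
  constant \<open>dist_fun \<mu> a\<close> integrates to the boundary term at \<open>a\<close>. For
  a quasi-derivative h of f the formula says that f - F h is a primitive of - F h'.\<close>

lemma signed_integration_by_parts:
  fixes h h' :: "real \<Rightarrow> 'a::euclidean_space"
  assumes \<mu>: "finite_signed_measure \<mu>"
    and h: "is_primitive a b h' h" and ab: "0 \<le> a" "a \<le> b" "b \<le> 1"
  shows "(\<lambda>s. dist_fun \<mu> s *\<^sub>R h' s) integrable_on {a..b}"
    and "signed_integral \<mu> (\<lambda>t. indicator {a..<b} t *\<^sub>R h t) =
      dist_fun \<mu> b *\<^sub>R h b - dist_fun \<mu> a *\<^sub>R h a - integral {a..b} (\<lambda>s. dist_fun \<mu> s *\<^sub>R h' s)"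
    and "integrable (pos_variation \<mu>) (\<lambda>t. indicator {a..<b} t *\<^sub>R h t)"
    and "integrable (neg_variation \<mu>) (\<lambda>t. indicator {a..<b} t *\<^sub>R h t)"
proof -
  note P = fubini_half_open[OF finite_measure_pos_variation[OF \<mu>] sets_pos_variation h]
  note N = fubini_half_open[OF finite_measure_neg_variation[OF \<mu>] sets_neg_variation h]
  let ?p = "\<lambda>s. measure (pos_variation \<mu>) ({a..<s} \<inter> unit_ivl)"
  let ?n = "\<lambda>s. measure (neg_variation \<mu>) ({a..<s} \<inter> unit_ivl)"
  show "integrable (pos_variation \<mu>) (\<lambda>t. indicator {a..<b} t *\<^sub>R h t)"
    "integrable (neg_variation \<mu>) (\<lambda>t. indicator {a..<b} t *\<^sub>R h t)"
    by (rule P(1), rule N(1))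
  have pn: "?p s - ?n s = dist_fun \<mu> s - dist_fun \<mu> a" if "s \<in> {a..b}" for s
    using dist_fun_diff[OF \<mu>, of a s] jordan_decomposition[OF \<mu>, of "{a..<s} \<inter> unit_ivl"] that ab
    by (auto simp: borel_unit_iff)
  have h'i: "h' integrable_on {a..b}"
    using is_primitive_absint[OF h] by (simp add: absolutely_integrable_on_def)
  have i1: "(\<lambda>s. ?p s *\<^sub>R h' s - ?n s *\<^sub>R h' s + dist_fun \<mu> a *\<^sub>R h' s) integrable_on {a..b}"
    using P(3) N(3) h'i by (intro integrable_add integrable_diff integrable_cmul)
  have e: "?p s *\<^sub>R h' s - ?n s *\<^sub>R h' s + dist_fun \<mu> a *\<^sub>R h' s = dist_fun \<mu> s *\<^sub>R h' s" if "s \<in> {a..b}" for s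
    using pn[OF that] by (simp flip: scaleR_diff_left scaleR_add_left)
  show "(\<lambda>s. dist_fun \<mu> s *\<^sub>R h' s) integrable_on {a..b}"
    using i1 e by (rule integrable_eq)
  have "integral {a..b} (\<lambda>s. dist_fun \<mu> s *\<^sub>R h' s)
      = integral {a..b} (\<lambda>s. ?p s *\<^sub>R h' s - ?n s *\<^sub>R h' s + dist_fun \<mu> a *\<^sub>R h' s)"
    by (intro Henstock_Kurzweil_Integration.integral_cong) (simp add: e)
  also have "\<dots> = integral {a..b} (\<lambda>s. ?p s *\<^sub>R h' s) - integral {a..b} (\<lambda>s. ?n s *\<^sub>R h' s)
      + integral {a..b} (\<lambda>s. dist_fun \<mu> a *\<^sub>R h' s)"
    using P(3) N(3) h'i
    by (simp add: Henstock_Kurzweil_Integration.integral_add Henstock_Kurzweil_Integration.integral_diff integrable_diff integrable_cmul)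
  also have "integral {a..b} (\<lambda>s. dist_fun \<mu> a *\<^sub>R h' s) = dist_fun \<mu> a *\<^sub>R (h b - h a)"
    using is_primitive_diff[OF h, of a b] ab by simp
  finally have I: "integral {a..b} (\<lambda>s. dist_fun \<mu> s *\<^sub>R h' s) =
    integral {a..b} (\<lambda>s. ?p s *\<^sub>R h' s) - integral {a..b} (\<lambda>s. ?n s *\<^sub>R h' s) + dist_fun \<mu> a *\<^sub>R (h b - h a)" .
  have "signed_integral \<mu> (\<lambda>t. indicator {a..<b} t *\<^sub>R h t) =
     (?p b - ?n b) *\<^sub>R h b - (integral {a..b} (\<lambda>s. ?p s *\<^sub>R h' s) - integral {a..b} (\<lambda>s. ?n s *\<^sub>R h' s))"
    unfolding signed_integral_def P(2) N(2) by (simp add: algebra_simps)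
  also have "?p b - ?n b = dist_fun \<mu> b - dist_fun \<mu> a" using ab by (intro pn) auto
  finally show "signed_integral \<mu> (\<lambda>t. indicator {a..<b} t *\<^sub>R h t) =
      dist_fun \<mu> b *\<^sub>R h b - dist_fun \<mu> a *\<^sub>R h a - integral {a..b} (\<lambda>s. dist_fun \<mu> s *\<^sub>R h' s)"
    unfolding I by (simp add: algebra_simps)
qed

section \<open>Bounded measurable functions on [0,1] as multipliers of integrable functions\<close>

definition bounded_measurable :: "(real \<Rightarrow> 'a::euclidean_space) \<Rightarrow> bool" where
  "bounded_measurable f \<longleftrightarrow> f \<in> borel_measurable (lebesgue_on {0..1}) \<and> bounded (f ` {0..1})"

lemma bounded_measurableD: "bounded_measurable f \<Longrightarrow> f \<in> borel_measurable (lebesgue_on {0..1})"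
  by (simp add: bounded_measurable_def)

lemma bounded_measurable_continuous: "continuous_on {0..1} f \<Longrightarrow> bounded_measurable f"
  unfolding bounded_measurable_def
  by (auto intro!: continuous_imp_measurable_on_sets_lebesgue compact_imp_bounded compact_continuous_image)

lemma bounded_measurable_bound:
  assumes "bounded_measurable f"
  obtains B where "B > 0" "\<And>x. x \<in> {0..1} \<Longrightarrow> norm (f x) \<le> B"
  using assms unfolding bounded_measurable_def bounded_pos by auto

lemma bounded_measurableI:
  assumes "f \<in> borel_measurable (lebesgue_on {0..1})" "\<And>x. x \<in> {0..1} \<Longrightarrow> norm (f x) \<le> B"
  shows "bounded_measurable f"
  unfolding bounded_measurable_def using assms(1) by (auto intro!: boundedI[where B = B] assms(2))

lemma bounded_measurable_cong:
  assumes "bounded_measurable f" "\<And>x. x \<in> {0..1} \<Longrightarrow> f x = g x"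
  shows "bounded_measurable g"
proof -
  obtain B where B: "\<And>x. x \<in> {0..1} \<Longrightarrow> norm (f x) \<le> B"
    using bounded_measurable_bound[OF assms(1)] by blast
  have "g \<in> borel_measurable (lebesgue_on {0..1})"
    using bounded_measurableD[OF assms(1)] assms(2) by (subst measurable_cong[of _ _ f]) auto
  then show ?thesis by (rule bounded_measurableI[of _ B]) (use B assms(2) in auto)
qed

lemma bounded_measurable_mult:
  fixes f g :: "real \<Rightarrow> 'a::{real_normed_algebra,euclidean_space}"
  assumes "bounded_measurable f" "bounded_measurable g"
  shows "bounded_measurable (\<lambda>x. f x * g x)"
proof -
  obtain B where B: "B > 0" "\<And>x. x \<in> {0..1} \<Longrightarrow> norm (f x) \<le> B"
    using bounded_measurable_bound[OF assms(1)] by blast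
  obtain C where C: "C > 0" "\<And>x. x \<in> {0..1} \<Longrightarrow> norm (g x) \<le> C"
    using bounded_measurable_bound[OF assms(2)] by blast
  have "norm (f x * g x) \<le> B * C" if "x \<in> {0..1}" for x
    by (rule order_trans[OF norm_mult_ineq mult_mono[OF B(2) C(2)]]) (use that B(1) in auto)
  then show ?thesis
    using assms by (intro bounded_measurableI) (auto dest: bounded_measurableD intro: borel_measurable_times)
qed

lemma bounded_measurable_add:
  assumes "bounded_measurable f" "bounded_measurable g"
  shows "bounded_measurable (\<lambda>x. f x + g x)"
proof -
  obtain B where B: "B > 0" "\<And>x. x \<in> {0..1} \<Longrightarrow> norm (f x) \<le> B"
    using bounded_measurable_bound[OF assms(1)] by blast
  obtain C where C: "C > 0" "\<And>x. x \<in> {0..1} \<Longrightarrow> norm (g x) \<le> C"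
    using bounded_measurable_bound[OF assms(2)] by blast
  have "norm (f x + g x) \<le> B + C" if "x \<in> {0..1}" for x
    by (rule norm_triangle_mono[OF B(2) C(2)]) (use that in auto)
  then show ?thesis
    using assms by (intro bounded_measurableI) (auto dest: bounded_measurableD intro: borel_measurable_add)
qed

lemma bounded_measurable_compose:
  assumes "bounded_measurable f" "continuous_on UNIV g"
  shows "bounded_measurable (\<lambda>x. g (f x))"
proof -
  obtain B where B: "B > 0" "\<And>x. x \<in> {0..1} \<Longrightarrow> norm (f x) \<le> B"
    using bounded_measurable_bound[OF assms(1)] by blast
  have "compact (g ` cball 0 B)"
    using assms(2) by (intro compact_continuous_image) (auto intro: continuous_on_subset)
  moreover have "(\<lambda>x. g (f x)) ` {0..1} \<subseteq> g ` cball 0 B" using B by auto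
  ultimately have "bounded ((\<lambda>x. g (f x)) ` {0..1})" using bounded_subset compact_imp_bounded by blast
  moreover have "g \<in> borel_measurable borel" using assms(2) by (rule borel_measurable_continuous_onI)
  ultimately show ?thesis
    using assms(1) unfolding bounded_measurable_def by (auto intro: measurable_compose)
qed

lemma bounded_measurable_of_real:
  "bounded_measurable f \<Longrightarrow> bounded_measurable (\<lambda>x. complex_of_real (f x))"
  by (rule bounded_measurable_compose) (auto intro: continuous_intros)

lemma bounded_measurable_uminus:
  "bounded_measurable f \<Longrightarrow> bounded_measurable (\<lambda>x. - f x)"
  by (rule bounded_measurable_compose) (auto intro: continuous_intros)

lemma bounded_measurable_const: "bounded_measurable (\<lambda>x. c)"
  by (rule bounded_measurable_continuous) simp

lemma absint_bounded_measurable_mult: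
  fixes p u :: "real \<Rightarrow> 'a::{real_normed_algebra,euclidean_space}"
  assumes "bounded_measurable u" "p absolutely_integrable_on {0..1}"
  shows "(\<lambda>x. u x * p x) absolutely_integrable_on {0..1}"
    "(\<lambda>x. p x * u x) absolutely_integrable_on {0..1}"
proof -
  have bl: "bilinear ((*) :: 'a \<Rightarrow> 'a \<Rightarrow> 'a)" "bilinear (\<lambda>x y :: 'a. y * x)"
    unfolding bilinear_def
    by (auto intro!: bounded_linear.linear bounded_linear_mult_left bounded_linear_mult_right)
  show "(\<lambda>x. u x * p x) absolutely_integrable_on {0..1}"
    "(\<lambda>x. p x * u x) absolutely_integrable_on {0..1}"
    using absolutely_integrable_bounded_measurable_product[OF bl(1), of u "{0..1}" p]
      absolutely_integrable_bounded_measurable_product[OF bl(2), of u "{0..1}" p] assms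
    unfolding bounded_measurable_def by auto
qed

lemma bounded_measurable_absint: "bounded_measurable f \<Longrightarrow> f absolutely_integrable_on {0..1}"
proof -
  assume f: "bounded_measurable f"
  obtain B where B: "B > 0" "\<And>x. x \<in> {0..1} \<Longrightarrow> norm (f x) \<le> B"
    using bounded_measurable_bound[OF f] by blast
  have "integrable (lebesgue_on {0..1}) (norm \<circ> f)"
  proof (rule Bochner_Integration.integrable_bound[of _ "\<lambda>x. B"])
    show "norm \<circ> f \<in> borel_measurable (lebesgue_on {0..1})"
      using bounded_measurableD[OF f] by simp
  qed (use B in \<open>auto intro!: AE_I2\<close>)
  then show ?thesis using f by (simp add: absolutely_integrable_measurable bounded_measurable_def)
qed

lemma measurable_lebesgue_on_if_borel:
  assumes "f \<in> borel_measurable (restrict_space borel S)"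
  shows "f \<in> borel_measurable (lebesgue_on S)"
proof -
  have "(\<lambda>x. x) \<in> measurable (lebesgue_on S) (restrict_space borel S)"
    by (rule measurable_restrict_space3) (auto intro: measurable_completion)
  then show ?thesis using assms by (rule measurable_compose)
qed


section \<open>One-sided limits, boundedness and variation of distribution functions\<close>

lemma measure_initial_interval_left_continuous:
  assumes M: "finite_measure M" "sets M = borel_unit" and x: "0 < x" "x \<le> 1"
  shows "((\<lambda>s. measure M {0<..<s}) \<longlongrightarrow> measure M {0<..<x}) (at_left x)"
proof (rule tendsto_at_left_sequentially[OF x(1)])
  interpret finite_measure M by fact
  fix S :: "nat \<Rightarrow> real" assume S: "\<And>n. S n < x" "\<And>n. 0 < S n" "incseq S" "S \<longlonglongrightarrow> x"
  have "(\<Union>n. {0<..<S n}) = {0<..<x}"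
  proof (intro antisym subsetI)
    fix t assume t: "t \<in> {0<..<x}"
    then have "\<forall>\<^sub>F n in sequentially. t < S n" using S(4) by (intro order_tendstoD) auto
    then show "t \<in> (\<Union>n. {0<..<S n})" using t by (auto simp: eventually_sequentially)
  qed (use S(1) in \<open>auto intro: less_trans\<close>)
  moreover have "range (\<lambda>n. {0<..<S n}) \<subseteq> sets M"
  proof -
    have "{0<..<S n} \<subseteq> unit_ivl" for n using S(1)[of n] x by auto
    then show ?thesis unfolding M(2) by (auto simp: borel_unit_iff)
  qed
  moreover have "incseq (\<lambda>n. {0<..<S n})"
    using S(3) by (fastforce simp: incseq_def)
  ultimately show "(\<lambda>n. measure M {0<..<S n}) \<longlonglongrightarrow> measure M {0<..<x}"
    using finite_Lim_measure_incseq by metis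
qed

lemma measure_initial_interval_at_0:
  assumes M: "finite_measure M" "sets M = borel_unit"
  shows "((\<lambda>s. measure M {0<..<s}) \<longlongrightarrow> 0) (at_right 0)"
proof (rule tendsto_at_right_sequentially[of 0 1])
  interpret finite_measure M by fact
  fix S :: "nat \<Rightarrow> real" assume S: "\<And>n. 0 < S n" "\<And>n. S n < 1" "decseq S" "S \<longlonglongrightarrow> 0"
  have "(\<Inter>n. {0<..<S n}) = {}"
  proof (rule equals0I)
    fix t assume t: "t \<in> (\<Inter>n. {0<..<S n})"
    then have "0 < t" by auto
    then have "\<forall>\<^sub>F n in sequentially. S n < t" using S(4) by (intro order_tendstoD) auto
    then obtain n where "S n < t" by (auto simp: eventually_sequentially)
    moreover have "t < S n" using t by auto
    ultimately show False by simp
  qed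
  moreover have "range (\<lambda>n. {0<..<S n}) \<subseteq> sets M"
  proof -
    have "{0<..<S n} \<subseteq> unit_ivl" for n using S(2)[of n] by auto
    then show ?thesis unfolding M(2) by (auto simp: borel_unit_iff)
  qed
  moreover have "decseq (\<lambda>n. {0<..<S n})"
    using S(3) by (fastforce simp: decseq_def)
  ultimately show "(\<lambda>n. measure M {0<..<S n}) \<longlonglongrightarrow> 0"
    using finite_Lim_measure_decseq by (metis measure_empty)
qed simp

text \<open>Measurability, boundedness, one-sided limits and bounded variation of the distribution
  function are all inherited from these two monotone functions.\<close>

lemma dist_fun_jordan:
  assumes \<mu>: "finite_signed_measure \<mu>"
  obtains p n where "mono_on {0..1} p" "mono_on {0..1} n"
    "\<And>x. x \<in> {0..1} \<Longrightarrow> dist_fun \<mu> x = p x - n x"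
    "\<And>x. x \<in> {0<..1} \<Longrightarrow> (p \<longlongrightarrow> p x) (at_left x)" "\<And>x. x \<in> {0<..1} \<Longrightarrow> (n \<longlongrightarrow> n x) (at_left x)"
    "(p \<longlongrightarrow> 0) (at_right 0)" "(n \<longlongrightarrow> 0) (at_right 0)"
proof
  let ?p = "\<lambda>x. measure (pos_variation \<mu>) {0<..<x}" and ?n = "\<lambda>x. measure (neg_variation \<mu>) {0<..<x}"
  have mono: "mono_on {0..1} (\<lambda>x. measure M {0<..<x})" if "finite_measure M" "sets M = borel_unit" for M
  proof (rule mono_onI)
    interpret finite_measure M by fact
    fix r s :: real assume "r \<in> {0..1}" "s \<in> {0..1}" "r \<le> s"
    then show "measure M {0<..<r} \<le> measure M {0<..<s}"
      by (intro finite_measure_mono) (auto simp: that(2) borel_unit_iff)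
  qed
  show "mono_on {0..1} ?p" by (rule mono[OF finite_measure_pos_variation[OF \<mu>] sets_pos_variation])
  show "mono_on {0..1} ?n" by (rule mono[OF finite_measure_neg_variation[OF \<mu>] sets_neg_variation])
  show "dist_fun \<mu> x = ?p x - ?n x" if "x \<in> {0..1}" for x
    unfolding dist_fun_def using that by (intro jordan_decomposition[OF \<mu>]) (auto simp: borel_unit_iff)
  show "(?p \<longlongrightarrow> ?p x) (at_left x)" if "x \<in> {0<..1}" for x
    using that by (intro measure_initial_interval_left_continuous[OF finite_measure_pos_variation[OF \<mu>]]) auto
  show "(?n \<longlongrightarrow> ?n x) (at_left x)" if "x \<in> {0<..1}" for x
    using that by (intro measure_initial_interval_left_continuous[OF finite_measure_neg_variation[OF \<mu>]]) auto
  show "(?p \<longlongrightarrow> 0) (at_right 0)"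
    by (intro measure_initial_interval_at_0[OF finite_measure_pos_variation[OF \<mu>]]) auto
  show "(?n \<longlongrightarrow> 0) (at_right 0)"
    by (intro measure_initial_interval_at_0[OF finite_measure_neg_variation[OF \<mu>]]) auto
qed

lemma dist_fun_left_continuous:
  assumes "finite_signed_measure \<mu>" "0 < x" "x \<le> 1"
  shows "(dist_fun \<mu> \<longlongrightarrow> dist_fun \<mu> x) (at_left x)"
proof -
  obtain p n where pn: "\<And>x. x \<in> {0..1} \<Longrightarrow> dist_fun \<mu> x = p x - n x"
    "\<And>x. x \<in> {0<..1} \<Longrightarrow> (p \<longlongrightarrow> p x) (at_left x)" "\<And>x. x \<in> {0<..1} \<Longrightarrow> (n \<longlongrightarrow> n x) (at_left x)"
    by (rule dist_fun_jordan[OF assms(1)]) blast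
  have "((\<lambda>x. p x - n x) \<longlongrightarrow> p x - n x) (at_left x)"
    using assms by (intro tendsto_diff pn) auto
  moreover have "\<forall>\<^sub>F y in at_left x. p y - n y = dist_fun \<mu> y"
    unfolding eventually_at_left_field using assms pn by (intro exI[of _ 0]) auto
  ultimately show ?thesis using pn(1)[of x] assms by (auto intro: Lim_transform_eventually)
qed

lemma dist_fun_at_0:
  assumes "finite_signed_measure \<mu>"
  shows "(dist_fun \<mu> \<longlongrightarrow> 0) (at_right 0)"
proof -
  obtain p n where pn: "\<And>x. x \<in> {0..1} \<Longrightarrow> dist_fun \<mu> x = p x - n x"
    "(p \<longlongrightarrow> 0) (at_right 0)" "(n \<longlongrightarrow> 0) (at_right 0)"
    by (rule dist_fun_jordan[OF assms(1)]) blast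
  have "((\<lambda>x. p x - n x) \<longlongrightarrow> 0 - 0) (at_right 0)"
    using assms by (intro tendsto_diff pn)
  moreover have "\<forall>\<^sub>F y in at_right 0. p y - n y = dist_fun \<mu> y"
    unfolding eventually_at_right_field using pn by (intro exI[of _ 1]) auto
  ultimately show ?thesis by (auto intro: Lim_transform_eventually)
qed

lemma bounded_measurable_mono_on:
  fixes p :: "real \<Rightarrow> real"
  assumes "mono_on {0..1} p"
  shows "bounded_measurable p"
proof (rule bounded_measurableI)
  show "p \<in> borel_measurable (lebesgue_on {0..1})"
    by (intro measurable_lebesgue_on_if_borel borel_measurable_mono_on_fnc assms)
  show "norm (p x) \<le> max \<bar>p 0\<bar> \<bar>p 1\<bar>" if "x \<in> {0..1}" for x
    using mono_onD[OF assms, of 0 x] mono_onD[OF assms, of x 1] that by auto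
qed

lemma dist_fun_bounded_measurable:
  assumes "finite_signed_measure \<mu>"
  shows "bounded_measurable (dist_fun \<mu>)"
proof -
  obtain p n where pn: "mono_on {0..1} p" "mono_on {0..1} n" "\<And>x. x \<in> {0..1} \<Longrightarrow> dist_fun \<mu> x = p x - n x"
    by (rule dist_fun_jordan[OF assms(1)]) blast
  have "bounded_measurable (\<lambda>x. p x + - n x)"
    by (intro bounded_measurable_add bounded_measurable_uminus bounded_measurable_mono_on pn)
  then show ?thesis by (rule bounded_measurable_cong) (simp add: pn(3))
qed

lemma dist_fun_variation:
  assumes "finite_signed_measure \<mu>"
  obtains V where "\<And>x y. 0 \<le> x \<Longrightarrow> x \<le> y \<Longrightarrow> y \<le> 1 \<Longrightarrow> \<bar>dist_fun \<mu> y - dist_fun \<mu> x\<bar> \<le> V y - V x"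
proof -
  obtain p n where pn: "mono_on {0..1} p" "mono_on {0..1} n" "\<And>x. x \<in> {0..1} \<Longrightarrow> dist_fun \<mu> x = p x - n x"
    by (rule dist_fun_jordan[OF assms(1)]) blast
  show thesis
  proof (rule that[of "\<lambda>x. p x + n x"])
    fix x y :: real assume xy: "0 \<le> x" "x \<le> y" "y \<le> 1"
    then show "\<bar>dist_fun \<mu> y - dist_fun \<mu> x\<bar> \<le> p y + n y - (p x + n x)"
      using mono_onD[OF pn(1), of x y] mono_onD[OF pn(2), of x y] pn(3)[of x] pn(3)[of y] by auto
  qed
qed

lemma bounded_variation_onI:
  assumes "\<And>x y. a \<le> x \<Longrightarrow> x \<le> y \<Longrightarrow> y \<le> b \<Longrightarrow> norm (f y - f x) \<le> V y - V x"
  shows "bounded_variation_on a b f"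
  unfolding bounded_variation_on_def
proof (intro exI allI impI)
  fix n :: nat and t :: "nat \<Rightarrow> real" assume t: "mono t \<and> range t \<subseteq> {a..b}"
  then have tab: "a \<le> t i" "t i \<le> b" for i by (auto simp: image_subset_iff)
  have V: "V x \<le> V y" if "a \<le> x" "x \<le> y" "y \<le> b" for x y
    using assms[OF that] norm_ge_zero[of "f y - f x"] by linarith
  have "(\<Sum>i<n. norm (f (t (Suc i)) - f (t i))) \<le> (\<Sum>i<n. V (t (Suc i)) - V (t i))"
    using t tab by (intro sum_mono assms) (auto simp: mono_iff_le_Suc)
  also have "\<dots> = V (t n) - V (t 0)" using sum_lessThan_telescope[of "\<lambda>i. V (t i)"] .
  also have "\<dots> \<le> V b - V a"
    using V[OF tab(1,2) order_refl, of n] V[OF order_refl tab(1) tab(2), of 0] by auto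
  finally show "(\<Sum>i<n. norm (f (t (Suc i)) - f (t i))) \<le> V b - V a" .
qed

lemma bounded_variation_on_bounded:
  assumes "bounded_variation_on a b f"
  obtains B where "\<And>x. x \<in> {a..b} \<Longrightarrow> norm (f x) \<le> B"
proof -
  obtain C where C: "\<And>(n :: nat) t. mono t \<Longrightarrow> range t \<subseteq> {a..b} \<Longrightarrow>
        (\<Sum>i<n. norm (f (t (Suc i)) - f (t i))) \<le> C"
    using assms unfolding bounded_variation_on_def by blast
  show thesis
  proof (rule that[of "C + norm (f a)"])
    fix x assume x: "x \<in> {a..b}"
    have "norm (f x - f a) \<le> C"
    proof -
      \<comment> \<open>The partition sequence a, x, x, ... isolates the single increment
        \<open>f x - f a\<close>.\<close>
      have "mono (\<lambda>i :: nat. if i = 0 then a else x)" "range (\<lambda>i :: nat. if i = 0 then a else x) \<subseteq> {a..b}"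
        using x by (auto simp: mono_def)
      from C[OF this, of 1] show ?thesis by simp
    qed
    then show "norm (f x) \<le> C + norm (f a)" using norm_triangle_sub[of "f x" "f a"] by linarith
  qed
qed

section \<open>The Dirichlet operator as a regular first order system\<close>

lemma absint_iff_integrable:
  fixes f :: "real \<Rightarrow> 'a::euclidean_space"
  assumes "S \<in> sets lebesgue"
  shows "f absolutely_integrable_on S \<longleftrightarrow> integrable (lebesgue_on S) f"
  using assms by (simp add: set_integrable_def integrable_restrict_space)

text \<open>Bridge between the almost everywhere statements in the operator and the negligible sets
  in the spike lemmas of the gauge integral.\<close>

lemma AE_unit_ivl_iff:
  "(AE x in lebesgue_on unit_ivl. P x) \<longleftrightarrow> (\<exists>N. negligible N \<and> (\<forall>x\<in>unit_ivl - N. P x))"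
proof -
  have "(AE x in lebesgue_on unit_ivl. P x) \<longleftrightarrow> (AE x in lebesgue. x \<in> unit_ivl \<longrightarrow> P x)"
    by (rule AE_restrict_space_iff) simp
  also have "\<dots> \<longleftrightarrow> (\<exists>N\<in>null_sets lebesgue. {x. \<not> (x \<in> unit_ivl \<longrightarrow> P x)} \<subseteq> N)"
    by (simp add: eventually_ae_filter)
  also have "\<dots> \<longleftrightarrow> (\<exists>N. negligible N \<and> (\<forall>x\<in>unit_ivl - N. P x))"
    unfolding negligible_iff_null_sets by blast
  finally show ?thesis .
qed

lemma is_primitive_spike:
  assumes y: "is_primitive a b p y" and N: "negligible N" "\<And>x. x \<in> {a..b} - N \<Longrightarrow> p' x = p x"
  shows "is_primitive a b p' y"
proof (rule is_primitiveI)
  show "p' absolutely_integrable_on {a..b}"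
    using is_primitive_absint[OF y] N by (rule absolutely_integrable_spike)
  show "y x = y a + integral {a..x} p'" if "a \<le> x" "x \<le> b" for x
    using is_primitive_eq[OF y that] integral_spike[OF N(1), of "{a..x}" p' p] N(2) that by auto
qed

lemma L2_space_absint:
  assumes "g \<in> L2_space"
  shows "g absolutely_integrable_on {0..1}"
proof -
  have g: "g \<in> borel_measurable (lebesgue_on unit_ivl)" "integrable (lebesgue_on unit_ivl) (\<lambda>x. (norm (g x))\<^sup>2)"
    using assms by (auto simp: L2_space_def)
  interpret finite_measure "lebesgue_on unit_ivl"
    by (intro finite_measure_lebesgue_on bounded_set_imp_lmeasurable) auto
  have "integrable (lebesgue_on unit_ivl) g"
  proof (rule Bochner_Integration.integrable_bound)
    show "integrable (lebesgue_on unit_ivl) (\<lambda>x. 1 + (norm (g x))\<^sup>2)"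
      using g by (intro Bochner_Integration.integrable_add) auto
    have "norm (g x) \<le> norm (1 + (norm (g x))\<^sup>2)" for x
    proof -
      have "0 \<le> (norm (g x) - 1)\<^sup>2" by simp
      then have "2 * norm (g x) \<le> 1 + (norm (g x))\<^sup>2" by (simp add: power2_eq_square algebra_simps)
      then have "norm (g x) \<le> 1 + (norm (g x))\<^sup>2" using norm_ge_zero[of "g x"] by linarith
      then show ?thesis by simp
    qed
    then show "AE x in lebesgue_on unit_ivl. norm (g x) \<le> norm (1 + (norm (g x))\<^sup>2)" by simp
  qed (rule g)
  then show ?thesis
    by (simp add: absolutely_integrable_on_Icc_iff_Ioo absint_iff_integrable)
qed

lemma L2_space_add:
  assumes "f \<in> L2_space" "g \<in> L2_space"
  shows "(\<lambda>x. f x + g x) \<in> L2_space"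
proof -
  have [measurable]: "f \<in> borel_measurable (lebesgue_on unit_ivl)" "g \<in> borel_measurable (lebesgue_on unit_ivl)"
    and i: "integrable (lebesgue_on unit_ivl) (\<lambda>x. (norm (f x))\<^sup>2)" "integrable (lebesgue_on unit_ivl) (\<lambda>x. (norm (g x))\<^sup>2)"
    using assms by (auto simp: L2_space_def)
  have "integrable (lebesgue_on unit_ivl) (\<lambda>x. (norm (f x + g x))\<^sup>2)"
  proof (rule Bochner_Integration.integrable_bound)
    show "integrable (lebesgue_on unit_ivl) (\<lambda>x. 2 * (norm (f x))\<^sup>2 + 2 * (norm (g x))\<^sup>2)"
      using i by (intro Bochner_Integration.integrable_add integrable_mult_right)
    have "(norm (f x + g x))\<^sup>2 \<le> 2 * (norm (f x))\<^sup>2 + 2 * (norm (g x))\<^sup>2" for x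
    proof -
      have "(norm (f x + g x))\<^sup>2 \<le> (norm (f x) + norm (g x))\<^sup>2"
        by (intro power_mono norm_triangle_ineq) auto
      moreover have "0 \<le> (norm (f x) - norm (g x))\<^sup>2" by simp
      ultimately show ?thesis by (simp add: power2_eq_square algebra_simps)
    qed
    then show "AE x in lebesgue_on unit_ivl. norm ((norm (f x + g x))\<^sup>2) \<le> norm (2 * (norm (f x))\<^sup>2 + 2 * (norm (g x))\<^sup>2)"
      by (intro AE_I2) (simp add: order_trans[OF _ abs_ge_self])
  qed measurable
  then show ?thesis unfolding L2_space_def by simp
qed

lemma L2_space_cmult: "f \<in> L2_space \<Longrightarrow> (\<lambda>x. c * f x) \<in> L2_space"
  unfolding L2_space_def by (auto simp: norm_mult power_mult_distrib)

lemma bounded_measurable_unit_ivl: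
  "bounded_measurable f \<Longrightarrow> f \<in> borel_measurable (lebesgue_on unit_ivl)"
  by (auto dest!: bounded_measurableD intro: measurable_restrict_mono)

lemma bounded_measurable_L2:
  assumes "bounded_measurable f"
  shows "f \<in> L2_space"
proof -
  have [measurable]: "f \<in> borel_measurable (lebesgue_on unit_ivl)"
    using assms by (rule bounded_measurable_unit_ivl)
  have "bounded_measurable (\<lambda>x. (norm (f x))\<^sup>2)"
    using assms by (rule bounded_measurable_compose) (intro continuous_intros)
  then have "integrable (lebesgue_on unit_ivl) (\<lambda>x. (norm (f x))\<^sup>2)"
    using bounded_measurable_absint by (simp add: absolutely_integrable_on_Icc_iff_Ioo absint_iff_integrable)
  then show ?thesis unfolding L2_space_def by simp
qed


text \<open>With f = w + F h this is h' solved from - h' + q f = g + z f, the equation (T - z) f = g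
  for the Dirichlet operator T.\<close>

definition sturm_rhs ::
  "(real \<Rightarrow> real) \<Rightarrow> complex \<Rightarrow> (real \<Rightarrow> real) \<Rightarrow> (real \<Rightarrow> complex) \<Rightarrow> (real \<Rightarrow> complex) \<Rightarrow> (real \<Rightarrow> complex) \<Rightarrow> real \<Rightarrow> complex"
  where "sturm_rhs q z F g w h t = (complex_of_real (q t) - z) * (w t + complex_of_real (F t) * h t) - g t"

definition sturm_system ::
  "(real \<Rightarrow> real) \<Rightarrow> complex \<Rightarrow> (real \<Rightarrow> real) \<Rightarrow> (real \<Rightarrow> complex) \<Rightarrow> (real \<Rightarrow> complex) \<Rightarrow> (real \<Rightarrow> complex) \<Rightarrow> bool"
  where "sturm_system q z F g w h \<longleftrightarrow>
    is_primitive 0 1 (sturm_rhs q z F g w h) h \<and>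
    is_primitive 0 1 (\<lambda>t. - complex_of_real (F t) * sturm_rhs q z F g w h t) w"

text \<open>The graph gives only local information on the open interval. The boundary limits make
  \<open>f0\<close> bounded, hence the density of \<open>h\<close> integrable up to the end points;
  \<open>h\<close> then extends to \<open>{0..1}\<close>, and the boundary limits become conditions
  on the system at 0 and 1.\<close>

lemma dirichlet_imp_sturm_system:
  assumes P: "finite_signed_measure P" and q: "q absolutely_integrable_on {0..1}" and g: "g \<in> L2_space"
    and fT: "(f, \<lambda>x. g x + z * f x) \<in> dirichlet q P"
  obtains w h where "sturm_system q z (dist_fun P) g w h" "w 0 = 0" "w 1 + complex_of_real (dist_fun P 1) * h 1 = 0"
    "AE x in lebesgue_on unit_ivl. f x = w x + complex_of_real (dist_fun P x) * h x"
proof -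
  let ?F = "\<lambda>x. complex_of_real (dist_fun P x)"
  obtain f0 h h' where f2: "f \<in> L2_space"
    and ff0: "AE x in lebesgue_on unit_ivl. f x = f0 x"
    and f0: "loc_abs_cont_wrt P f0 h" and h: "loc_abs_cont_lebesgue h h'"
    and eq: "AE x in lebesgue_on unit_ivl. g x + z * f x = - h' x + complex_of_real (q x) * f0 x"
    and lim0: "(f0 \<longlongrightarrow> 0) (at_right 0)" and lim1: "(f0 \<longlongrightarrow> 0) (at_left 1)"
    using fT unfolding dirichlet_def by blast
  \<comment> \<open>Values of \<open>f0\<close> outside the open interval are arbitrary, so they are
    set to 0.\<close>
  define f1 where "f1 x = (if x \<in> unit_ivl then f0 x else 0)" for x
  have "\<exists>B. \<forall>x\<in>unit_ivl. norm (f0 x) \<le> B"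
  proof -
    have "\<forall>\<^sub>F x in at_right 0. dist (f0 x) 0 < 1" "\<forall>\<^sub>F x in at_left 1. dist (f0 x) 0 < 1"
      using tendstoD[OF lim0, of 1] tendstoD[OF lim1, of 1] by simp_all
    then obtain a b where ab: "0 < a" "\<And>x. 0 < x \<Longrightarrow> x < a \<Longrightarrow> norm (f0 x) < 1"
      "b < 1" "\<And>x. b < x \<Longrightarrow> x < 1 \<Longrightarrow> norm (f0 x) < 1"
      by (auto simp: eventually_at_right_field eventually_at_left_field)
    \<comment> \<open>Near the end points the limits bound \<open>f0\<close>; on the compact rest
      \<open>{c..d}\<close> bounded variation does. The value 1/2 merely ensures
      \<open>c \<le> d\<close>.\<close>
    define c d where "c = min a (1/2)" and "d = max b (1/2)"
    have cd: "0 < c" "c \<le> d" "d < 1" "c \<le> a" "b \<le> d" using ab by (auto simp: c_def d_def)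
    then have "bounded_variation_on c d f0" using f0 by (auto simp: loc_abs_cont_wrt_def)
    then obtain B where B: "\<And>x. x \<in> {c..d} \<Longrightarrow> norm (f0 x) \<le> B"
      using bounded_variation_on_bounded by blast
    have "norm (f0 x) \<le> max B 1" if "x \<in> unit_ivl" for x
      using that cd B[of x] ab(2)[of x] ab(4)[of x]
      by (cases "x < c"; cases "d < x") (auto simp: max_def)
    then show ?thesis by blast
  qed
  then obtain B where B: "\<And>x. x \<in> unit_ivl \<Longrightarrow> norm (f0 x) \<le> B" by blast
  have f1bm: "bounded_measurable f1"
  proof (rule bounded_measurableI[of _ "max B 0"])
    \<comment> \<open>Measurability is imported from \<open>f\<close>, which lies in
      \<open>L2_space\<close> and agrees with \<open>f0\<close> almost everywhere.\<close>
    have "(\<lambda>x. if x \<in> unit_ivl then f x else 0) \<in> borel_measurable lebesgue"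
      using f2 by (subst borel_measurable_if) (auto simp: L2_space_def)
    moreover have "AE x in lebesgue. (if x \<in> unit_ivl then f x else 0) = f1 x"
    proof -
      have "AE x in lebesgue. x \<in> unit_ivl \<longrightarrow> f x = f0 x"
        using ff0 by (subst AE_restrict_space_iff[symmetric]) auto
      then show ?thesis by eventually_elim (auto simp: f1_def)
    qed
    ultimately have "f1 \<in> borel_measurable lebesgue" by (rule borel_measurable_AE)
    then show "f1 \<in> borel_measurable (lebesgue_on {0..1})" by (rule measurable_restrict_space1)
    show "norm (f1 x) \<le> max B 0" for x using B[of x] by (auto simp: f1_def)
  qed
  define k where "k t = (complex_of_real (q t) - z) * f1 t - g t" for t
  have qz: "(\<lambda>t. complex_of_real (q t) - z) absolutely_integrable_on {0..1}"
    using absolutely_integrable_linear[OF q bounded_linear_of_real]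
    by (intro set_integral_diff) (auto simp: o_def)
  have ka: "k absolutely_integrable_on {0..1}"
    unfolding k_def
    by (intro set_integral_diff absint_bounded_measurable_mult(2)[OF f1bm qz] L2_space_absint g)
  have Fbm: "bounded_measurable ?F" by (intro bounded_measurable_of_real dist_fun_bounded_measurable P)
  have Fka: "(\<lambda>t. - ?F t * k t) absolutely_integrable_on {0..1}"
    by (intro absint_bounded_measurable_mult(1) bounded_measurable_uminus Fbm ka)
  obtain N where N: "negligible N" "\<And>x. x \<in> unit_ivl - N \<Longrightarrow> h' x = k x"
  proof -
    have "AE x in lebesgue_on unit_ivl. x \<in> unit_ivl \<longrightarrow> h' x = k x"
      using ff0 eq by eventually_elim (auto simp: k_def f1_def algebra_simps)
    then show thesis using that unfolding AE_unit_ivl_iff by blast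
  qed
  have hk: "h b - h a = integral {a..b} k" if "0 < a" "a \<le> b" "b < 1" for a b
  proof -
    have "h b - h a = integral\<^sup>L (lebesgue_on {a..b}) h'" "integrable (lebesgue_on {a..b}) h'"
      using h that unfolding loc_abs_cont_lebesgue_def by auto
    then have "h b - h a = integral {a..b} h'" by (simp add: lebesgue_integral_eq_integral)
    also have "\<dots> = integral {a..b} k"
      by (rule integral_spike[OF N(1)]) (use N(2) that in auto)
    finally show ?thesis .
  qed
  \<comment> \<open>\<open>H\<close> is the continuous extension of \<open>h\<close> to
    \<open>{0..1}\<close>, normalised at the interior point 1/2 because \<open>h\<close> is
    unspecified at the end points.\<close>
  define H where "H x = (h (1/2) - integral {0..1/2} k) + integral {0..x} k" for x
  have Hprim: "is_primitive 0 1 k H" unfolding H_def by (rule is_primitive_integral[OF ka])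
  have H_half: "H (1/2) = h (1/2)" by (simp add: H_def)
  have Hh: "h x = H x" if "x \<in> unit_ivl" for x
  proof (cases "x \<le> 1/2")
    case True
    have "h (1/2) - h x = H (1/2) - H x"
      using hk[of x "1/2"] is_primitive_diff[OF Hprim, of x "1/2"] that True by simp
    then show ?thesis by (simp add: H_half)
  next
    case False
    have "h x - h (1/2) = H x - H (1/2)"
      using hk[of "1/2" x] is_primitive_diff[OF Hprim, of "1/2" x] that False by simp
    then show ?thesis by (simp add: H_half)
  qed
  define W where "W x = 0 + integral {0..x} (\<lambda>t. - ?F t * k t)" for x
  have Wprim: "is_primitive 0 1 (\<lambda>t. - ?F t * k t) W" unfolding W_def by (rule is_primitive_integral[OF Fka])
  \<comment> \<open>Integration by parts makes \<open>R\<close> constant on the open interval; its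
    limit at 0 is 0 because \<open>f0\<close>, F and \<open>W\<close> tend to 0 there.\<close>
  define R where "R x = f0 x - ?F x * H x - W x" for x
  have Rconst: "R b = R a" if ab: "0 < a" "a \<le> b" "b < 1" for a b
  proof -
    have "f0 b - f0 a = signed_integral P (\<lambda>x. indicator {a..<b} x *\<^sub>R h x)"
      using f0 ab unfolding loc_abs_cont_wrt_def by blast
    also have "(\<lambda>x. indicator {a..<b} x *\<^sub>R h x) = (\<lambda>x. indicator {a..<b} x *\<^sub>R H x)"
    proof
      show "indicator {a..<b} x *\<^sub>R h x = indicator {a..<b} x *\<^sub>R H x" for x
        using Hh[of x] ab by (cases "x \<in> {a..<b}") auto
    qed
    also have "signed_integral P \<dots> = dist_fun P b *\<^sub>R H b - dist_fun P a *\<^sub>R H a - integral {a..b} (\<lambda>s. dist_fun P s *\<^sub>R k s)"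
      using ab by (intro signed_integration_by_parts(2)[OF P is_primitive_subinterval[OF Hprim]]) auto
    also have "integral {a..b} (\<lambda>s. dist_fun P s *\<^sub>R k s) = - integral {a..b} (\<lambda>t. - ?F t * k t)"
      by (simp add: scaleR_conv_of_real)
    also have "integral {a..b} (\<lambda>t. - ?F t * k t) = W b - W a"
      using ab by (intro is_primitive_diff[OF Wprim, symmetric]) auto
    finally show ?thesis by (simp add: R_def scaleR_conv_of_real algebra_simps)
  qed
  have Hc: "continuous_on {0..1} H" and Wc: "continuous_on {0..1} W"
    using is_primitive_continuous Hprim Wprim by blast+
  have right: "(u \<longlongrightarrow> u 0) (at_right 0)" and left: "(u \<longlongrightarrow> u 1) (at_left 1)"
    if "continuous_on {0..1} u" for u :: "real \<Rightarrow> complex"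
    using that by (auto simp: continuous_on_Icc_at_rightD continuous_on_Icc_at_leftD)
  have "(R \<longlongrightarrow> 0 - of_real 0 * H 0 - W 0) (at_right 0)"
    unfolding R_def by (intro tendsto_intros lim0 right Hc Wc dist_fun_at_0[OF P])
  then have R0: "(R \<longlongrightarrow> 0) (at_right 0)" by (simp add: W_def)
  have Rz: "R b = 0" if "b \<in> unit_ivl" for b
  proof -
    have "R a = R b" if "0 < a" "a < b" for a
      by (rule Rconst[symmetric]) (use that \<open>b \<in> unit_ivl\<close> in auto)
    then have "\<forall>\<^sub>F a in at_right 0. R a = R b"
      unfolding eventually_at_right_field using that by (intro exI[of _ b]) auto
    then have "(R \<longlongrightarrow> R b) (at_right 0)" by (rule tendsto_eventually)
    then show ?thesis using R0 tendsto_unique[of "at_right (0::real)"] by auto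
  qed
  \<comment> \<open>F is left-continuous at 1, so the limit of \<open>R\<close> at 1 is the right
    boundary condition expressed in \<open>W\<close> and \<open>H\<close>.\<close>
  have "(R \<longlongrightarrow> 0 - ?F 1 * H 1 - W 1) (at_left 1)"
    unfolding R_def
    by (intro tendsto_intros lim1 left Hc Wc dist_fun_left_continuous[OF P]) auto
  moreover have "\<forall>\<^sub>F b in at_left 1. R b = 0"
    unfolding eventually_at_left_field using Rz by (intro exI[of _ 0]) auto
  then have "(R \<longlongrightarrow> 0) (at_left 1)" by (rule tendsto_eventually)
  ultimately have R1: "0 - ?F 1 * H 1 - W 1 = 0"
    by (rule tendsto_unique[rotated]) simp
  have k_eq: "sturm_rhs q z (dist_fun P) g W H x = k x" if "x \<in> {0..1} - {0, 1}" for x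
    using Rz[of x] that by (simp add: sturm_rhs_def k_def f1_def R_def algebra_simps)
  show thesis
  proof (rule that[of W H])
    show "sturm_system q z (dist_fun P) g W H"
      unfolding sturm_system_def
      using is_primitive_spike[OF Hprim, of "{0,1}" "sturm_rhs q z (dist_fun P) g W H"]
        is_primitive_spike[OF Wprim, of "{0,1}" "\<lambda>t. - ?F t * sturm_rhs q z (dist_fun P) g W H t"] k_eq
      by auto
    show "W 0 = 0" by (simp add: W_def)
    have "W 1 + ?F 1 * H 1 = - (0 - ?F 1 * H 1 - W 1)" by simp
    then show "W 1 + ?F 1 * H 1 = 0" unfolding R1 by simp
    have "AE x in lebesgue_on unit_ivl. x \<in> unit_ivl" by (rule AE_I2) simp
    with ff0 show "AE x in lebesgue_on unit_ivl. f x = W x + ?F x * H x"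
      by eventually_elim (use Rz in \<open>auto simp: R_def algebra_simps\<close>)
  qed
qed

lemma sturm_system_continuous:
  assumes "sturm_system q z F g w h"
  shows "continuous_on {0..1} h" "continuous_on {0..1} w"
  using assms is_primitive_continuous unfolding sturm_system_def by blast+

lemma sturm_system_bounded_measurable:
  assumes "sturm_system q z F g w h" "bounded_measurable F"
  shows "bounded_measurable (\<lambda>x. w x + complex_of_real (F x) * h x)"
  using bounded_measurable_add[OF bounded_measurable_continuous[OF sturm_system_continuous(2)[OF assms(1)]]
      bounded_measurable_mult[OF bounded_measurable_of_real[OF assms(2)]
        bounded_measurable_continuous[OF sturm_system_continuous(1)[OF assms(1)]]]] .

text \<open>Here w + F h is itself the left-continuous representative, as F is left-continuous and
  \<open>w\<close> and \<open>h\<close> are continuous. The formula for df is integration by parts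
  read backwards.\<close>

lemma sturm_system_imp_dirichlet:
  assumes P: "finite_signed_measure P" and g: "g \<in> L2_space"
    and sys: "sturm_system q z (dist_fun P) g w h" and w0: "w 0 = 0"
    and w1: "w 1 + complex_of_real (dist_fun P 1) * h 1 = 0"
  defines "f \<equiv> \<lambda>x. w x + complex_of_real (dist_fun P x) * h x"
  shows "(f, \<lambda>x. g x + z * f x) \<in> dirichlet q P"
proof -
  let ?F = "\<lambda>x. complex_of_real (dist_fun P x)"
  let ?k = "sturm_rhs q z (dist_fun P) g w h"
  have h: "is_primitive 0 1 ?k h" and w: "is_primitive 0 1 (\<lambda>t. - ?F t * ?k t) w"
    using sys by (auto simp: sturm_system_def)
  note hc = sturm_system_continuous(1)[OF sys] and wc = sturm_system_continuous(2)[OF sys]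
  have Fb: "bounded_measurable (dist_fun P)" by (rule dist_fun_bounded_measurable[OF P])
  have "bounded_measurable f"
    unfolding f_def by (rule sturm_system_bounded_measurable[OF sys Fb])
  then have f2: "f \<in> L2_space" by (rule bounded_measurable_L2)
  have lac: "loc_abs_cont_wrt P f h"
    unfolding loc_abs_cont_wrt_def
  proof (intro conjI ballI allI impI)
    fix x :: real assume x: "x \<in> unit_ivl"
    have cont: "(u \<longlongrightarrow> u x) (at_left x)" if "continuous_on {0..1} u" for u :: "real \<Rightarrow> complex"
    proof -
      have "continuous_on {0..x} u" using that by (rule continuous_on_subset) (use x in auto)
      then show ?thesis using x by (intro continuous_on_Icc_at_leftD) auto
    qed
    show "continuous (at_left x) f"
      unfolding continuous_within f_def using x
      by (intro tendsto_intros cont hc wc dist_fun_left_continuous[OF P]) auto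
  next
    fix a b :: real assume ab: "0 < a \<and> a \<le> b \<and> b < 1"
    obtain V where V: "\<And>x y. 0 \<le> x \<Longrightarrow> x \<le> y \<Longrightarrow> y \<le> 1 \<Longrightarrow> \<bar>dist_fun P y - dist_fun P x\<bar> \<le> V y - V x"
      using dist_fun_variation[OF P] by blast
    obtain BF where BF: "BF > 0" "\<And>x. x \<in> {0..1} \<Longrightarrow> norm (dist_fun P x) \<le> BF"
      using bounded_measurable_bound[OF Fb] by blast
    obtain Bh where Bh: "Bh > 0" "\<And>x. x \<in> {0..1} \<Longrightarrow> norm (h x) \<le> Bh"
      using bounded_measurable_bound[OF bounded_measurable_continuous[OF hc]] by blast
    have nk: "(\<lambda>t. norm (?k t)) absolutely_integrable_on {0..1}"
      using absolutely_integrable_norm[OF is_primitive_absint[OF h]] by (simp add: o_def)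
    define K where "K x = 0 + integral {0..x} (\<lambda>t. norm (?k t))" for x
    have K: "is_primitive 0 1 (\<lambda>t. norm (?k t)) K" unfolding K_def by (rule is_primitive_integral[OF nk])
    show "bounded_variation_on a b f"
    \<comment> \<open>One \<open>BF * K\<close> bounds the increment of \<open>w\<close>, whose
      density is - F h', the other bounds F times the increment of \<open>h\<close>;
      \<open>Bh * V\<close> bounds \<open>h\<close> times the increment of F.\<close>
    proof (rule bounded_variation_onI[where V = "\<lambda>x. 2 * BF * K x + Bh * V x"])
      fix x y assume xy: "a \<le> x" "x \<le> y" "y \<le> b"
      then have xy': "0 \<le> x" "x \<le> y" "y \<le> 1" using ab by auto
      have i: "(\<lambda>t. norm (?k t)) integrable_on {x..y}"
        by (rule integrable_on_subinterval_real[OF nk xy'(1,3)])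
      have ik: "?k integrable_on {x..y}"
        by (rule integrable_on_subinterval_real[OF is_primitive_absint[OF h] xy'(1,3)])
      have iw: "(\<lambda>t. - ?F t * ?k t) integrable_on {x..y}"
        by (rule integrable_on_subinterval_real[OF is_primitive_absint[OF w] xy'(1,3)])
      have dh: "norm (h y - h x) \<le> K y - K x"
        using norm_integral_le_mult[OF ik i, of 1] is_primitive_diff[OF h xy'] is_primitive_diff[OF K xy'] by simp
      have dw: "norm (w y - w x) \<le> BF * (K y - K x)"
        unfolding is_primitive_diff[OF w xy'] is_primitive_diff[OF K xy']
        by (rule norm_integral_le_mult[OF iw i]) (use BF xy' in \<open>auto simp: norm_mult intro!: mult_right_mono\<close>)
      have "f y - f x = (w y - w x) + (?F y * (h y - h x) + (?F y - ?F x) * h x)"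
        by (simp add: f_def algebra_simps)
      also have "norm \<dots> \<le> norm (w y - w x) + (norm (?F y) * norm (h y - h x) + norm (?F y - ?F x) * norm (h x))"
        by (intro norm_triangle_mono order_refl) (auto simp: norm_mult)
      also have "\<dots> \<le> BF * (K y - K x) + (BF * (K y - K x) + (V y - V x) * Bh)"
      proof (intro add_mono dw mult_mono dh)
        show "norm (?F y - ?F x) \<le> V y - V x" using V[OF xy'] by (simp flip: of_real_diff)
        then show "0 \<le> V y - V x" using norm_ge_zero order_trans by blast
        show "norm (h x) \<le> Bh" using Bh xy' by auto
        show "norm (?F y) \<le> BF" using BF xy' by auto
      qed (use BF in auto)
      finally show "norm (f y - f x) \<le> 2 * BF * K y + Bh * V y - (2 * BF * K x + Bh * V x)"
        by (simp add: algebra_simps)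
    qed
  next
    show "loc_integrable_wrt P h"
      unfolding loc_integrable_wrt_def
    proof (intro allI impI)
      fix a b :: real assume ab: "0 < a \<and> a \<le> b \<and> b < 1"
      have "set_integrable M {a..b} h" if M: "sets M = borel_unit"
        and i: "integrable M (\<lambda>t. indicator {0..<1} t *\<^sub>R h t)" for M :: "real measure"
      proof -
        have "set_integrable M {0..<1} h" using i by (simp add: set_integrable_def)
        moreover have "{a..b} \<in> sets M" using ab unfolding M by (auto simp: borel_unit_iff)
        ultimately show ?thesis by (rule set_integrable_subset) (use ab in auto)
      qed
      then show "set_integrable (pos_variation P) {a..b} h \<and> set_integrable (neg_variation P) {a..b} h"
        using signed_integration_by_parts(3,4)[OF P h] sets_pos_variation sets_neg_variation by simp
    qed
  next
    fix a b :: real assume ab: "0 < a \<and> a \<le> b \<and> b < 1"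
    have "signed_integral P (\<lambda>x. indicator {a..<b} x *\<^sub>R h x) =
        dist_fun P b *\<^sub>R h b - dist_fun P a *\<^sub>R h a - integral {a..b} (\<lambda>s. dist_fun P s *\<^sub>R ?k s)"
      using ab by (intro signed_integration_by_parts(2)[OF P is_primitive_subinterval[OF h]]) auto
    also have "integral {a..b} (\<lambda>s. dist_fun P s *\<^sub>R ?k s) = - integral {a..b} (\<lambda>t. - ?F t * ?k t)"
      by (simp add: scaleR_conv_of_real)
    also have "integral {a..b} (\<lambda>t. - ?F t * ?k t) = w b - w a"
      using ab by (intro is_primitive_diff[OF w, symmetric]) auto
    finally show "f b - f a = signed_integral P (\<lambda>x. indicator {a..<b} x *\<^sub>R h x)"
      by (simp add: f_def scaleR_conv_of_real algebra_simps)
  qed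
  have lal: "loc_abs_cont_lebesgue h ?k"
    unfolding loc_abs_cont_lebesgue_def
  proof (intro allI impI)
    fix a b :: real assume ab: "0 < a \<and> a \<le> b \<and> b < 1"
    have "?k absolutely_integrable_on {a..b}"
      using absolutely_integrable_on_subinterval_real[OF is_primitive_absint[OF h]] ab by auto
    then have i: "integrable (lebesgue_on {a..b}) ?k" by (simp add: absint_iff_integrable)
    then show "integrable (lebesgue_on {a..b}) ?k \<and> h b - h a = integral\<^sup>L (lebesgue_on {a..b}) ?k"
      using is_primitive_diff[OF h, of a b] ab by (simp add: lebesgue_integral_eq_integral)
  qed
  have right: "(u \<longlongrightarrow> u 0) (at_right 0)" and left: "(u \<longlongrightarrow> u 1) (at_left 1)"
    if "continuous_on {0..1} u" for u :: "real \<Rightarrow> complex"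
    using that by (auto simp: continuous_on_Icc_at_rightD continuous_on_Icc_at_leftD)
  have "(f \<longlongrightarrow> w 0 + of_real 0 * h 0) (at_right 0)"
    unfolding f_def by (intro tendsto_intros right hc wc dist_fun_at_0[OF P])
  then have l0: "(f \<longlongrightarrow> 0) (at_right 0)" by (simp add: w0)
  have "(f \<longlongrightarrow> w 1 + ?F 1 * h 1) (at_left 1)"
    unfolding f_def by (intro tendsto_intros left hc wc dist_fun_left_continuous[OF P]) auto
  then have l1: "(f \<longlongrightarrow> 0) (at_left 1)" by (simp add: w1)
  have "AE x in lebesgue_on unit_ivl. g x + z * f x = - ?k x + complex_of_real (q x) * f x"
    by (rule AE_I2) (simp add: sturm_rhs_def f_def algebra_simps)
  then show ?thesis
    unfolding dirichlet_def using f2 L2_space_add[OF g L2_space_cmult[OF f2]] lac lal l0 l1 by auto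
qed

section \<open>Weak-star convergence and distribution functions\<close>

text \<open>Baire category: the closed sets \<open>A m\<close> cover the space, so one of them
  contains a ball, and linearity transports the bound on this ball to all vectors.\<close>

theorem uniform_boundedness:
  fixes T :: "nat \<Rightarrow> 'a::{real_normed_vector,complete_space} \<Rightarrow> 'b::real_normed_vector"
  assumes lin: "\<And>k. bounded_linear (T k)" and bdd: "\<And>x. \<exists>B. \<forall>k. norm (T k x) \<le> B"
  obtains C where "\<And>k x. norm (T k x) \<le> C * norm x"
proof -
  define A where "A m = {x. \<forall>k. norm (T k x) \<le> real m}" for m
  have closed: "closed (A m)" for m
  proof -
    have "A m = (\<Inter>k. {x. norm (T k x) \<le> real m})" by (auto simp: A_def)
    moreover have "closed {x. norm (T k x) \<le> real m}" for k
      by (intro closed_Collect_le continuous_intros bounded_linear.continuous_on[OF lin])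
    ultimately show ?thesis by auto
  qed
  have cover: "\<Union>(range A) = UNIV"
  proof -
    have "\<exists>m. x \<in> A m" for x
    proof -
      obtain B where B: "\<And>k. norm (T k x) \<le> B" using bdd by blast
      obtain m :: nat where "B \<le> real m" using real_arch_simple by blast
      then have "x \<in> A m" using B order_trans unfolding A_def by blast
      then show ?thesis ..
    qed
    then show ?thesis by blast
  qed
  have "\<exists>m. interior (A m) \<noteq> {}"
  proof (rule ccontr)
    assume "\<not> ?thesis"
    then have e: "interior (A m) = {}" for m by blast
    have "Met_TC.mtopology interior_of \<Union>(range A) = {}"
    proof (rule Met_TC.metric_Baire_category_alt)
      show "Met_TC.mcomplete TYPE('a)" by (simp add: complete_UNIV)
      show "countable (range A)" by simp
      show "closedin Met_TC.mtopology S \<and> Met_TC.mtopology interior_of S = {}" if "S \<in> range A" for S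
        using that closed e by auto
    qed
    then show False unfolding cover by simp
  qed
  then obtain m x0 where "x0 \<in> interior (A m)" by blast
  then obtain r where r: "r > 0" "ball x0 r \<subseteq> A m" unfolding mem_interior by blast
  have "norm (T k x) \<le> (4 * real m / r) * norm x" for k x
  proof (cases "x = 0")
    case True then show ?thesis using linear_0[OF bounded_linear.linear[OF lin]] by simp
  next
    case False
    interpret bounded_linear "T k" by (rule lin)
    \<comment> \<open>The vector \<open>c *\<^sub>R x\<close> has half the radius as its norm. The
      images of two vectors in \<open>A m\<close> differ by at most 2 m, whence the constant 4 m /
      r.\<close>
    define c where "c = r / (2 * norm x)"
    have c: "c > 0" "c * norm x < r" using False r by (auto simp: c_def)
    have "x0 \<in> ball x0 r" "x0 + c *\<^sub>R x \<in> ball x0 r" using r c by (auto simp: dist_norm)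
    then have "x0 \<in> A m" "x0 + c *\<^sub>R x \<in> A m" using r(2) by blast+
    then have "norm (T k x0) \<le> m" "norm (T k (x0 + c *\<^sub>R x)) \<le> m" by (auto simp: A_def)
    moreover have "c *\<^sub>R T k x = T k (x0 + c *\<^sub>R x) - T k x0" by (simp add: add scaleR)
    ultimately have "norm (c *\<^sub>R T k x) \<le> 2 * m"
      using norm_triangle_ineq4[of "T k (x0 + c *\<^sub>R x)" "T k x0"] by simp
    then have "c * norm (T k x) \<le> 2 * m" using c by simp
    then show ?thesis using False r c by (simp add: c_def field_simps)
  qed
  then show thesis by (rule that)
qed

lemma continuous_on_borel_unit:
  assumes "continuous_on {0..1} f" "sets M = borel_unit"
  shows "f \<in> borel_measurable M"
proof -
  have "f \<in> borel_measurable (restrict_space borel unit_ivl)"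
    by (intro borel_measurable_continuous_on_restrict continuous_on_subset[OF assms(1)]) auto
  then show ?thesis using measurable_cong_sets[OF assms(2) refl] by blast
qed

lemma integrable_continuous_unit_ivl:
  fixes f :: "real \<Rightarrow> real"
  assumes M: "finite_measure M" "sets M = borel_unit" and f: "continuous_on {0..1} f"
  shows "integrable M f"
    and "(\<And>x. x \<in> {0..1} \<Longrightarrow> \<bar>f x\<bar> \<le> B) \<Longrightarrow> \<bar>integral\<^sup>L M f\<bar> \<le> measure M unit_ivl * B"
proof -
  interpret finite_measure M by fact
  have sp: "space M = unit_ivl" using sets_eq_imp_space_eq[OF M(2)] by (simp add: space_restrict_space)
  have i: "integrable M f" if "\<And>x. x \<in> {0..1} \<Longrightarrow> \<bar>f x\<bar> \<le> B" for B
    by (rule integrable_const_bound[where B = B])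
      (use that sp in \<open>auto intro!: AE_I2 continuous_on_borel_unit[OF f M(2)]\<close>)
  show I: "integrable M f"
  proof -
    have "bounded (f ` {0..1})" using f by (intro compact_imp_bounded compact_continuous_image) auto
    then obtain B where "\<forall>x\<in>{0..1}. \<bar>f x\<bar> \<le> B" by (auto simp: bounded_iff)
    then show ?thesis by (intro i[of B]) auto
  qed
  assume B: "\<And>x. x \<in> {0..1} \<Longrightarrow> \<bar>f x\<bar> \<le> B"
  have "\<bar>integral\<^sup>L M f\<bar> \<le> (\<integral>x. \<bar>f x\<bar> \<partial>M)" using integral_norm_bound[of M f] by simp
  also have "\<dots> \<le> (\<integral>x. B \<partial>M)" using B sp by (intro integral_mono integrable_abs I) auto
  also have "\<dots> = measure M unit_ivl * B" by (simp add: sp)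
  finally show "\<bar>integral\<^sup>L M f\<bar> \<le> measure M unit_ivl * B" .
qed

lemma signed_integral_bound:
  fixes f :: "real \<Rightarrow> real"
  assumes \<mu>: "finite_signed_measure \<mu>" and f: "continuous_on {0..1} f" "\<And>x. x \<in> {0..1} \<Longrightarrow> \<bar>f x\<bar> \<le> B"
  shows "\<bar>signed_integral \<mu> f\<bar> \<le> (measure (pos_variation \<mu>) unit_ivl + measure (neg_variation \<mu>) unit_ivl) * B"
  using integrable_continuous_unit_ivl(2)[OF finite_measure_pos_variation[OF \<mu>] sets_pos_variation f]
    integrable_continuous_unit_ivl(2)[OF finite_measure_neg_variation[OF \<mu>] sets_neg_variation f]
  unfolding signed_integral_def by (simp add: algebra_simps)

lemma signed_integral_add:
  fixes f g :: "real \<Rightarrow> real"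
  assumes \<mu>: "finite_signed_measure \<mu>" and f: "continuous_on {0..1} f" "continuous_on {0..1} g"
  shows "signed_integral \<mu> (\<lambda>x. f x + g x) = signed_integral \<mu> f + signed_integral \<mu> g"
  using integrable_continuous_unit_ivl(1)[OF finite_measure_pos_variation[OF \<mu>] sets_pos_variation f(1)]
    integrable_continuous_unit_ivl(1)[OF finite_measure_neg_variation[OF \<mu>] sets_neg_variation f(1)]
   integrable_continuous_unit_ivl(1)[OF finite_measure_pos_variation[OF \<mu>] sets_pos_variation f(2)]
    integrable_continuous_unit_ivl(1)[OF finite_measure_neg_variation[OF \<mu>] sets_neg_variation f(2)]
  unfolding signed_integral_def by simp

lemma signed_integral_cmult:
  fixes f :: "real \<Rightarrow> real"
  shows "signed_integral \<mu> (\<lambda>x. c * f x) = c * signed_integral \<mu> f"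
  unfolding signed_integral_def by (simp add: algebra_simps)

lemma signed_integral_cong:
  fixes f g :: "real \<Rightarrow> real"
  assumes "\<And>x. x \<in> unit_ivl \<Longrightarrow> f x = g x"
  shows "signed_integral \<mu> f = signed_integral \<mu> g"
  unfolding signed_integral_def using assms
  by (intro arg_cong2[of _ _ _ _ "(-)"] Bochner_Integration.integral_cong) auto

text \<open>Convergence for each test function makes the functionals pointwise bounded, and uniform
  boundedness on the Banach space of bounded continuous functions does the rest. \<open>C\<close>
  takes the place of a common bound of the total variations.\<close>

lemma weak_star_uniformly_bounded:
  assumes \<nu>: "\<And>k. finite_signed_measure (\<nu>s k)" and w: "weak_star_tendsto \<nu>s \<nu>"
  obtains C where "C \<ge> 0" "\<And>k f B. continuous_on {0..1} f \<Longrightarrow> (\<And>x. x \<in> {0..1} \<Longrightarrow> \<bar>f x\<bar> \<le> B) \<Longrightarrow>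
      \<bar>signed_integral (\<nu>s k) f\<bar> \<le> C * (B::real)"
proof -
  define T where "T k v = signed_integral (\<nu>s k) (apply_bcontfun v)" for k and v :: "real \<Rightarrow>\<^sub>C real"
  have lin: "bounded_linear (T k)" for k
  proof (rule bounded_linear_intro)
    show "T k (v + w) = T k v + T k w" for v w
      unfolding T_def plus_bcontfun.rep_eq by (rule signed_integral_add[OF \<nu>]) auto
    show "T k (c *\<^sub>R v) = c *\<^sub>R T k v" for c v
      unfolding T_def scaleR_bcontfun.rep_eq by (simp add: signed_integral_cmult)
    show "norm (T k v) \<le> norm v * (measure (pos_variation (\<nu>s k)) unit_ivl + measure (neg_variation (\<nu>s k)) unit_ivl)" for v
      using signed_integral_bound[OF \<nu>[of k], of "apply_bcontfun v" "norm v"] norm_bounded[of v]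
      by (auto simp: T_def mult.commute)
  qed
  have "\<exists>B. \<forall>k. norm (T k v) \<le> B" for v
  proof -
    have "(\<lambda>k. T k v) \<longlonglongrightarrow> signed_integral \<nu> (apply_bcontfun v)"
      using w unfolding weak_star_tendsto_def T_def by simp
    then have "Bseq (\<lambda>k. T k v)" by (intro convergent_imp_Bseq) (auto simp: convergent_def)
    then show ?thesis by (auto simp: Bseq_def)
  qed
  then obtain C where C: "\<And>k v. norm (T k v) \<le> C * norm v"
    using uniform_boundedness[of T] lin by blast
  show thesis
  proof (rule that[of "\<bar>C\<bar>"])
    fix k and f :: "real \<Rightarrow> real" and B :: real
    assume f: "continuous_on {0..1} f" and B: "\<And>x. x \<in> {0..1} \<Longrightarrow> \<bar>f x\<bar> \<le> B"
    \<comment> \<open>Functions on \<open>{0..1}\<close> are extended to the line by clamping, with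
      the same bound and the same integral.\<close>
    define g where "g x = f (max 0 (min 1 x))" for x
    have gc: "continuous_on UNIV g"
      unfolding g_def by (rule continuous_on_compose2[OF f]) (auto intro!: continuous_intros)
    have gB: "\<bar>g x\<bar> \<le> B" for x unfolding g_def by (rule B) auto
    then have "g \<in> bcontfun" using gc by (auto simp: bcontfun_def intro!: boundedI[where B = B])
    then obtain v where v: "apply_bcontfun v = g" by (metis bcontfunE)
    have "norm v \<le> B" by (rule norm_bound) (simp add: v gB)
    have "signed_integral (\<nu>s k) f = T k v"
      unfolding T_def v by (rule signed_integral_cong) (auto simp: g_def)
    also have "\<bar>\<dots>\<bar> \<le> C * norm v" using C[of k v] by simp
    also have "\<dots> \<le> \<bar>C\<bar> * norm v" by (intro mult_right_mono) auto
    also have "\<dots> \<le> \<bar>C\<bar> * B" using \<open>norm v \<le> B\<close> by (intro mult_left_mono) auto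
    finally show "\<bar>signed_integral (\<nu>s k) f\<bar> \<le> \<bar>C\<bar> * B" .
  qed simp
qed

lemma signed_integral_const:
  assumes "finite_signed_measure \<mu>"
  shows "signed_integral \<mu> (\<lambda>x. 1 :: real) = dist_fun \<mu> 1"
  using jordan_decomposition[OF assms, of unit_ivl]
  by (auto simp: signed_integral_def dist_fun_def borel_unit_iff)

text \<open>\<open>f 1 = 0\<close> and \<open>dist_fun \<mu> 0 = 0\<close> remove both boundary
  terms. Integrals of test functions thus become pairings of the distribution function with
  integrable densities.\<close>

lemma signed_integral_primitive:
  fixes f s :: "real \<Rightarrow> real"
  assumes \<mu>: "finite_signed_measure \<mu>" and f: "is_primitive 0 1 s f" "f 1 = 0"
  shows "signed_integral \<mu> f = - integral {0..1} (\<lambda>t. dist_fun \<mu> t * s t)"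
proof -
  have "signed_integral \<mu> f = signed_integral \<mu> (\<lambda>t. indicator {0..<1} t *\<^sub>R f t)"
    by (rule signed_integral_cong) auto
  also have "\<dots> = - integral {0..1} (\<lambda>t. dist_fun \<mu> t * s t)"
    using signed_integration_by_parts(2)[OF \<mu> f(1)] f(2) \<mu> by simp
  finally show ?thesis .
qed

text \<open>A point value of the distribution function is not the integral of a continuous function,
  but its integral over \<open>{y..x}\<close> is one up to sign: the primitive of the indicator that
  vanishes at 1 is bounded by \<open>x - y\<close>. So the averages are bounded by \<open>C\<close>,
  and left continuity carries the bound to \<open>x\<close>.\<close>

lemma weak_star_dist_fun_bounded:
  fixes C :: real
  assumes \<mu>: "finite_signed_measure \<mu>"
    and C: "\<And>f B. continuous_on {0..1} f \<Longrightarrow> (\<And>x. x \<in> {0..1} \<Longrightarrow> \<bar>f x\<bar> \<le> B) \<Longrightarrow>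
      \<bar>signed_integral \<mu> f\<bar> \<le> C * (B::real)"
    and x: "x \<in> {0..1}"
  shows "\<bar>dist_fun \<mu> x\<bar> \<le> C"
proof (cases "x = 0")
  case True
  \<comment> \<open>Only \<open>0 \<le> C\<close> is at stake here, and the bound 1 for the zero
    function provides it.\<close>
  then show ?thesis using C[of "\<lambda>x. 0" 0] C[of "\<lambda>x. 0" 1] \<mu> by (simp add: signed_integral_def)
next
  case False
  let ?F = "dist_fun \<mu>"
  have avg: "\<bar>integral {y..x} ?F\<bar> \<le> C * (x - y)" if y: "0 \<le> y" "y \<le> x" for y
  proof -
    define s :: "real \<Rightarrow> real" where "s t = indicator {y..x} t" for t
    have s: "s absolutely_integrable_on {0..1}"
    proof -
      have "s \<in> borel_measurable lebesgue"
        unfolding s_def by (rule borel_measurable_indicator) simp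
      then have "bounded_measurable s"
        by (intro bounded_measurableI[of _ 1] measurable_restrict_space1) (auto simp: s_def)
      then show ?thesis by (rule bounded_measurable_absint)
    qed
    define f where "f t = - integral {0..1} s + integral {0..t} s" for t
    have f: "is_primitive 0 1 s f" unfolding f_def by (rule is_primitive_integral[OF s])
    have f1: "f 1 = 0" by (simp add: f_def)
    have si: "integral {a..b} s \<le> x - y" "0 \<le> integral {a..b} s" if "0 \<le> a" "b \<le> 1" for a b
    proof -
      have "integral {a..b} s \<le> integral {0..1} s"
        using that s by (intro integral_subset_le integrable_on_subinterval_real[OF s]) (auto simp: s_def)
      also have "integral {0..1} s = integral {0..1} (\<lambda>t. if t \<in> {y..x} then 1 else 0)"
        by (rule Henstock_Kurzweil_Integration.integral_cong) (simp add: s_def indicator_def)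
      also have "\<dots> = integral ({y..x} \<inter> {0..1}) (\<lambda>t. 1)"
        by (rule Henstock_Kurzweil_Integration.integral_restrict_Int)
      also have "{y..x} \<inter> {0..1} = {y..x}" using x y by auto
      finally show "integral {a..b} s \<le> x - y" using y by simp
      show "0 \<le> integral {a..b} s"
        using that by (intro Henstock_Kurzweil_Integration.integral_nonneg integrable_on_subinterval_real[OF s]) (auto simp: s_def)
    qed
    have "\<bar>f t\<bar> \<le> x - y" if "t \<in> {0..1}" for t
      using is_primitive_diff[OF f, of t 1] that f1 si[of t 1] by simp
    then have "\<bar>signed_integral \<mu> f\<bar> \<le> C * (x - y)"
      by (intro C is_primitive_continuous[OF f])
    moreover have "integral {0..1} (\<lambda>t. ?F t * s t) = integral {y..x} ?F"
    proof -
      have "integral {0..1} (\<lambda>t. ?F t * s t) = integral {0..1} (\<lambda>t. if t \<in> {y..x} then ?F t else 0)"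
        by (rule Henstock_Kurzweil_Integration.integral_cong) (simp add: s_def indicator_def)
      also have "\<dots> = integral ({y..x} \<inter> {0..1}) ?F" by (rule Henstock_Kurzweil_Integration.integral_restrict_Int)
      also have "{y..x} \<inter> {0..1} = {y..x}" using x y by auto
      finally show ?thesis .
    qed
    ultimately show ?thesis using signed_integral_primitive[OF \<mu> f f1] by simp
  qed
  have Fi: "?F integrable_on {y..x}" if "0 \<le> y" for y
    using integrable_on_subinterval_real[OF bounded_measurable_absint[OF dist_fun_bounded_measurable[OF \<mu>]] that] x by auto
  have lim: "(?F \<longlongrightarrow> ?F x) (at_left x)"
    using x False by (intro dist_fun_left_continuous[OF \<mu>]) auto
  show ?thesis
  proof (rule ccontr)
    assume "\<not> ?thesis"
    then have "C < \<bar>?F x\<bar>" by simp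
    define c where "c = (C + \<bar>?F x\<bar>) / 2"
    have c: "C < c" "c < \<bar>?F x\<bar>" using \<open>C < \<bar>?F x\<bar>\<close> by (auto simp: c_def)
    \<comment> \<open>Multiplication by the sign treats positive and negative values at
      once.\<close>
    define \<sigma> where "\<sigma> = sgn (?F x)"
    have "((\<lambda>t. \<sigma> * ?F t) \<longlongrightarrow> \<sigma> * ?F x) (at_left x)" by (intro tendsto_intros lim)
    moreover have "c < \<sigma> * ?F x" using c by (simp add: \<sigma>_def abs_sgn mult.commute)
    ultimately have "\<forall>\<^sub>F t in at_left x. c < \<sigma> * ?F t" by (rule order_tendstoD)
    then obtain b where b: "b < x" "\<And>t. b < t \<Longrightarrow> t < x \<Longrightarrow> c < \<sigma> * ?F t"
      by (auto simp: eventually_at_left_field)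
    define y where "y = max 0 ((b + x) / 2)"
    have y: "0 \<le> y" "y < x" "b < y" using b x False by (auto simp: y_def less_max_iff_disj)
    have "integral {y..x} (\<lambda>t. c) \<le> integral {y..x} (\<lambda>t. \<sigma> * ?F t)"
    proof (rule integral_le)
      show "c \<le> \<sigma> * ?F t" if "t \<in> {y..x}" for t
        using b(2)[of t] that y \<open>c < \<sigma> * ?F x\<close> by (cases "t = x") auto
    qed (use Fi y in \<open>auto intro!: integrable_on_mult_right\<close>)
    then have "c * (x - y) \<le> \<sigma> * integral {y..x} ?F" using y by (simp add: mult.commute)
    also have "\<dots> \<le> \<bar>integral {y..x} ?F\<bar>"
      using abs_ge_self[of "\<sigma> * integral {y..x} ?F"] by (auto simp: \<sigma>_def abs_mult sgn_real_def split: if_splits)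
    also have "\<dots> \<le> C * (x - y)" using y by (intro avg) auto
    finally show False using c y by simp
  qed
qed

text \<open>The primitives of \<open>sgn (N\<^sub>k - N)\<close> are 1-Lipschitz, so by the Arzela-Ascoli theorem weak-star
  convergence is uniform on them.\<close>

lemma weak_star_dist_fun_L1:
  assumes \<nu>s: "\<And>k. finite_signed_measure (\<nu>s k)" and \<nu>: "finite_signed_measure \<nu>"
    and w: "weak_star_tendsto \<nu>s \<nu>"
  shows "(\<lambda>k. integral {0..1} (\<lambda>t. \<bar>dist_fun (\<nu>s k) t - dist_fun \<nu> t\<bar>)) \<longlonglongrightarrow> 0"
proof (rule ccontr)
  let ?I = "\<lambda>k. integral {0..1} (\<lambda>t. \<bar>dist_fun (\<nu>s k) t - dist_fun \<nu> t\<bar>)"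
  assume "\<not> ?I \<longlonglongrightarrow> 0"
  then obtain e where e: "e > 0" "\<And>n. \<exists>k\<ge>n. e \<le> \<bar>?I k\<bar>"
    unfolding LIMSEQ_iff by (auto simp: not_less)
  then have "infinite {k. e \<le> \<bar>?I k\<bar>}"
    unfolding infinite_nat_iff_unbounded_le by auto
  then obtain r :: "nat \<Rightarrow> nat" where r: "strict_mono r" "\<And>n. e \<le> \<bar>?I (r n)\<bar>"
    using infinite_enumerate[of "{k. e \<le> \<bar>?I k\<bar>}"] by blast
  obtain C where C: "C \<ge> 0" "\<And>k f B. continuous_on {0..1} f \<Longrightarrow> (\<And>x. x \<in> {0..1} \<Longrightarrow> \<bar>f x\<bar> \<le> B) \<Longrightarrow>
      \<bar>signed_integral (\<nu>s k) f\<bar> \<le> C * (B::real)"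
    using weak_star_uniformly_bounded[OF \<nu>s w] by blast
  define C' where "C' = measure (pos_variation \<nu>) unit_ivl + measure (neg_variation \<nu>) unit_ivl"
  have C': "continuous_on {0..1} f \<Longrightarrow> (\<And>x. x \<in> {0..1} \<Longrightarrow> \<bar>f x\<bar> \<le> B) \<Longrightarrow>
      \<bar>signed_integral \<nu> f\<bar> \<le> C' * (B::real)" for f B
    unfolding C'_def by (rule signed_integral_bound[OF \<nu>])
  have C'0: "C' \<ge> 0" by (simp add: C'_def)
  define D where "D k t = dist_fun (\<nu>s k) t - dist_fun \<nu> t" for k t
  define s where "s k t = sgn (D k t)" for k t
  have Dbm: "bounded_measurable (D k)" for k
    using bounded_measurable_add[OF dist_fun_bounded_measurable[OF \<nu>s] bounded_measurable_uminus[OF dist_fun_bounded_measurable[OF \<nu>]]]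
    by (simp add: D_def[abs_def])
  have sbm: "bounded_measurable (s k)" for k
  proof (rule bounded_measurableI[of _ 1])
    show "s k \<in> borel_measurable (lebesgue_on {0..1})"
      unfolding s_def using bounded_measurableD[OF Dbm[of k]]
      by (rule measurable_compose) (rule borel_measurable_sgn)
    show "norm (s k x) \<le> 1" for x by (simp add: s_def sgn_if)
  qed
  have sa: "s k absolutely_integrable_on {0..1}" for k by (rule bounded_measurable_absint[OF sbm])
  \<comment> \<open>The constant is chosen such that \<open>f k 1 = 0\<close>, as
    \<open>signed_integral_primitive\<close> requires.\<close>
  define f where "f k t = - integral {0..1} (s k) + integral {0..t} (s k)" for k t
  have f: "is_primitive 0 1 (s k) (f k)" for k unfolding f_def by (rule is_primitive_integral[OF sa])
  have f1: "f k 1 = 0" for k by (simp add: f_def)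
  have flip: "\<bar>f k y - f k x\<bar> \<le> y - x" if "0 \<le> x" "x \<le> y" "y \<le> 1" for k x y
  proof -
    have "norm (integral {x..y} (s k)) \<le> 1 * integral {x..y} (\<lambda>t. 1 :: real)"
      using that by (intro norm_integral_le_mult integrable_on_subinterval_real[OF sa]) (auto simp: s_def sgn_if)
    then show ?thesis using is_primitive_diff[OF f that, of k] that by simp
  qed
  have flip': "\<bar>f k y - f k x\<bar> \<le> \<bar>y - x\<bar>" if "x \<in> {0..1}" "y \<in> {0..1}" for k x y
    using flip[of x y k] flip[of y x k] that by (cases "x \<le> y") auto
  \<comment> \<open>As the density is the sign of the difference, the L1 distance becomes a
    difference of two integrals of one continuous function; the minus sign of integration by parts
    exchanges the two measures.\<close>
  have split: "?I k = signed_integral \<nu> (f k) - signed_integral (\<nu>s k) (f k)" for k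
  proof -
    have i: "(\<lambda>t. dist_fun \<mu> t * s k t) integrable_on {0..1}" if "finite_signed_measure \<mu>" for \<mu>
      using absint_bounded_measurable_mult(1)[OF dist_fun_bounded_measurable[OF that] sa]
      by (simp add: absolutely_integrable_on_def)
    have "?I k = integral {0..1} (\<lambda>t. dist_fun (\<nu>s k) t * s k t - dist_fun \<nu> t * s k t)"
      by (rule Henstock_Kurzweil_Integration.integral_cong)
        (simp add: s_def D_def abs_sgn left_diff_distrib)
    also have "\<dots> = integral {0..1} (\<lambda>t. dist_fun (\<nu>s k) t * s k t) - integral {0..1} (\<lambda>t. dist_fun \<nu> t * s k t)"
      by (intro Henstock_Kurzweil_Integration.integral_diff i \<nu> \<nu>s)
    finally show ?thesis
      by (simp add: signed_integral_primitive[OF \<nu> f f1] signed_integral_primitive[OF \<nu>s f f1])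
  qed
  obtain g k where g: "continuous_on {0..1} g" and k: "strict_mono (k :: nat \<Rightarrow> nat)"
    and conv: "\<And>e. 0 < e \<Longrightarrow> \<exists>N. \<forall>n x. n \<ge> N \<and> x \<in> {0..1} \<longrightarrow> norm (f (r (k n)) x - g x) < e"
  proof (rule Arzela_Ascoli[of "{0..1::real}" "\<lambda>n. f (r n)" 1])
    show "norm (f (r n) x) \<le> 1" if "x \<in> {0..1}" for n x
      using flip[of x 1 "r n"] f1[of "r n"] that by auto
    show "\<exists>d>0. \<forall>n y. y \<in> {0..1} \<and> norm (x - y) < d \<longrightarrow> norm (f (r n) x - f (r n) y) < \<epsilon>"
      if "x \<in> {0..1}" "0 < \<epsilon>" for x \<epsilon>
    proof (intro exI conjI allI impI)
      fix n y assume y: "y \<in> {0..1} \<and> norm (x - y) < \<epsilon>"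
      then have "\<bar>f (r n) x - f (r n) y\<bar> \<le> \<bar>x - y\<bar>" using that by (intro flip') auto
      then show "norm (f (r n) x - f (r n) y) < \<epsilon>" using y by simp
    qed (use that in simp)
  qed auto
  have w': "(\<lambda>n. signed_integral (\<nu>s (r (k n))) g) \<longlonglongrightarrow> signed_integral \<nu> g"
    using w g LIMSEQ_subseq_LIMSEQ[OF _ strict_mono_o[OF r(1) k]]
    unfolding weak_star_tendsto_def by (fastforce simp: o_def)
  \<comment> \<open>Replacing \<open>?f\<close> by the uniform limit \<open>g\<close> costs at most
    \<open>(C + C') * \<epsilon>\<close>, less than half of \<open>e\<close>; the summand 1 keeps
    the denominator positive.\<close>
  define \<epsilon> where "\<epsilon> = e / (2 * (C + C' + 1))"
  have eps: "\<epsilon> > 0" "(C + C') * \<epsilon> < e / 2" using e C(1) C'0 by (auto simp: \<epsilon>_def field_simps)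
  obtain N1 where N1: "\<And>n x. n \<ge> N1 \<Longrightarrow> x \<in> {0..1} \<Longrightarrow> norm (f (r (k n)) x - g x) < \<epsilon>"
    using conv[OF eps(1)] by blast
  obtain N2 where N2: "\<And>n. n \<ge> N2 \<Longrightarrow> \<bar>signed_integral (\<nu>s (r (k n))) g - signed_integral \<nu> g\<bar> < e / 2"
    using w' e(1) unfolding LIMSEQ_iff by (metis half_gt_zero real_norm_def)
  define n where "n = max N1 N2"
  let ?f = "f (r (k n))" and ?\<mu> = "\<nu>s (r (k n))"
  define d where "d x = ?f x - g x" for x
  have dc: "continuous_on {0..1} d"
    unfolding d_def by (intro continuous_intros g is_primitive_continuous[OF f])
  have d: "\<bar>d x\<bar> \<le> \<epsilon>" if "x \<in> {0..1}" for x using N1[of n x] that by (auto simp: d_def n_def)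
  have add: "signed_integral \<mu> ?f = signed_integral \<mu> g + signed_integral \<mu> d" if "finite_signed_measure \<mu>" for \<mu>
    using signed_integral_add[OF that g dc] by (simp add: d_def)
  have "?I (r (k n)) = (signed_integral \<nu> g - signed_integral ?\<mu> g) + signed_integral \<nu> d - signed_integral ?\<mu> d"
    using split[of "r (k n)"] add[OF \<nu>] add[OF \<nu>s[of "r (k n)"]] by simp
  moreover have "\<bar>signed_integral \<nu> d\<bar> \<le> C' * \<epsilon>" using dc d by (rule C')
  moreover have "\<bar>signed_integral ?\<mu> d\<bar> \<le> C * \<epsilon>" using dc d by (rule C(2))
  moreover have "\<bar>signed_integral ?\<mu> g - signed_integral \<nu> g\<bar> < e / 2" by (rule N2) (simp add: n_def)
  ultimately have "\<bar>?I (r (k n))\<bar> < e / 2 + (C + C') * \<epsilon>"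
    unfolding distrib_right by linarith
  then show False using r(2)[of "k n"] eps by simp
qed

section \<open>Estimates for the first order system\<close>

text \<open>The integral of (a - t b)^2 is a nonnegative quadratic polynomial in t; it is evaluated
  at its minimum t = I / B.\<close>

lemma cauchy_schwarz_integral:
  fixes a b :: "real \<Rightarrow> real"
  assumes a: "(\<lambda>t. (a t)\<^sup>2) integrable_on S" and b: "(\<lambda>t. (b t)\<^sup>2) integrable_on S"
    and ab: "(\<lambda>t. a t * b t) integrable_on S"
  shows "integral S (\<lambda>t. a t * b t) \<le> sqrt (integral S (\<lambda>t. (a t)\<^sup>2)) * sqrt (integral S (\<lambda>t. (b t)\<^sup>2))"
proof -
  define A B I where "A = integral S (\<lambda>t. (a t)\<^sup>2)" and "B = integral S (\<lambda>t. (b t)\<^sup>2)"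
    and "I = integral S (\<lambda>t. a t * b t)"
  have nonneg: "0 \<le> A - 2 * t * I + t\<^sup>2 * B" for t
  proof -
    have "((\<lambda>s. (a s)\<^sup>2 - 2 * t * (a s * b s) + t\<^sup>2 * (b s)\<^sup>2) has_integral A - 2 * t * I + t\<^sup>2 * B) S"
      unfolding A_def B_def I_def
      by (intro has_integral_add has_integral_diff has_integral_mult_right integrable_integral a b ab)
    moreover have "(a s)\<^sup>2 - 2 * t * (a s * b s) + t\<^sup>2 * (b s)\<^sup>2 = (a s - t * b s)\<^sup>2" for s
      by (simp add: power2_eq_square algebra_simps)
    ultimately show ?thesis by (simp add: has_integral_nonneg)
  qed
  have B0: "0 \<le> B" unfolding B_def by (rule Henstock_Kurzweil_Integration.integral_nonneg[OF b]) simp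
  have "I\<^sup>2 \<le> A * B"
  proof (cases "B = 0")
    case True
    have "I = 0"
    proof (rule ccontr)
      assume "I \<noteq> 0"
      \<comment> \<open>For \<open>B = 0\<close> the polynomial is linear, and this argument gives
        it the value -1.\<close>
      then show False using nonneg[of "(A + 1) / (2 * I)"] True by (simp add: field_simps)
    qed
    then show ?thesis using True by simp
  next
    case False
    then have "0 \<le> A - I\<^sup>2 / B" using nonneg[of "I / B"] by (simp add: power2_eq_square)
    then show ?thesis using False B0 by (simp add: field_simps)
  qed
  then have "sqrt (I\<^sup>2) \<le> sqrt (A * B)" by (rule real_sqrt_le_mono)
  then have "\<bar>I\<bar> \<le> sqrt A * sqrt B" by (simp add: real_sqrt_mult)
  then show ?thesis unfolding A_def B_def I_def by linarith
qed

lemma absint_Pair: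
  fixes f :: "real \<Rightarrow> 'a::euclidean_space" and g :: "real \<Rightarrow> 'b::euclidean_space"
  assumes "f absolutely_integrable_on S" "g absolutely_integrable_on S"
  shows "(\<lambda>x. (f x, g x)) absolutely_integrable_on S"
proof -
  have "bounded_linear (\<lambda>x :: 'a. (x, 0 :: 'b))" "bounded_linear (\<lambda>x :: 'b. (0 :: 'a, x))"
    by (intro bounded_linear_Pair bounded_linear_ident bounded_linear_zero)+
  from set_integral_add(1)[OF absolutely_integrable_linear[OF assms(1) this(1)] absolutely_integrable_linear[OF assms(2) this(2)]]
  show ?thesis by (simp add: o_def)
qed

lemma sturm_rhs_absint:
  assumes q: "q absolutely_integrable_on {0..1}" and F: "bounded_measurable F" and g: "g absolutely_integrable_on {0..1}"
    and w: "continuous_on {0..1} w" and h: "continuous_on {0..1} h"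
  shows "sturm_rhs q z F g w h absolutely_integrable_on {0..1}"
    and "(\<lambda>t. - complex_of_real (F t) * sturm_rhs q z F g w h t) absolutely_integrable_on {0..1}"
proof -
  have qz: "(\<lambda>t. complex_of_real (q t) - z) absolutely_integrable_on {0..1}"
    using absolutely_integrable_linear[OF q bounded_linear_of_real]
    by (intro set_integral_diff) (auto simp: o_def)
  have "bounded_measurable (\<lambda>t. w t + complex_of_real (F t) * h t)"
    by (intro bounded_measurable_add[OF bounded_measurable_continuous[OF w]]
        bounded_measurable_mult[OF bounded_measurable_of_real[OF F] bounded_measurable_continuous[OF h]])
  then show 1: "sturm_rhs q z F g w h absolutely_integrable_on {0..1}"
    unfolding sturm_rhs_def[abs_def]
    by (intro set_integral_diff(1) g absint_bounded_measurable_mult(2) qz)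
  then show "(\<lambda>t. - complex_of_real (F t) * sturm_rhs q z F g w h t) absolutely_integrable_on {0..1}"
    by (intro absint_bounded_measurable_mult(1) bounded_measurable_uminus bounded_measurable_of_real F)
qed

lemma sturm_system_exists:
  assumes q: "q absolutely_integrable_on {0..1}" and F: "bounded_measurable F" and g: "g absolutely_integrable_on {0..1}"
  shows "\<exists>w h. sturm_system q z F g w h \<and> w 0 = w0 \<and> h 0 = h0"
proof -
  obtain B where B: "B > 0" "\<And>x. x \<in> {0..1} \<Longrightarrow> norm (F x) \<le> B" using bounded_measurable_bound[OF F] by blast
  define k where "k t Y = (complex_of_real (q t) - z) * (fst Y + complex_of_real (F t) * snd Y) - g t"
    for t and Y :: "complex \<times> complex"
  define G where "G t Y = (- complex_of_real (F t) * k t Y, k t Y)" for t Y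
  have k: "(\<lambda>t. k t (y t)) = sturm_rhs q z F g (\<lambda>t. fst (y t)) (\<lambda>t. snd (y t))" for y
    by (auto simp: k_def sturm_rhs_def)
  \<comment> \<open>One factor \<open>1 + B\<close> bounds w + F h by the norm of the pair, the
    other bounds the pair of - F k and k by k.\<close>
  define L where "L t = (1 + B) * ((1 + B) * (\<bar>q t\<bar> + norm z))" for t
  have "\<exists>y. y 0 = (w0, h0) \<and> is_primitive 0 1 (\<lambda>t. G t (y t)) y"
  proof (rule caratheodory_existence)
    show "L absolutely_integrable_on {0..1}"
      using absolutely_integrable_norm[OF q] unfolding L_def
      by (intro set_integrable_mult_right set_integral_add(1)) (auto simp: o_def)
    show "0 \<le> L t" for t unfolding L_def using B by simp
    show "(\<lambda>t. G t (y t)) absolutely_integrable_on {0..1}" if "continuous_on {0..1} y" for y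
      unfolding G_def using that sturm_rhs_absint[OF q F g continuous_on_fst[OF that] continuous_on_snd[OF that], of z]
      unfolding k[symmetric] by (intro absint_Pair) (simp_all add: k_def)
    show "norm (G t u - G t v) \<le> L t * norm (u - v)" if t: "t \<in> {0..1}" for t u v
    proof -
      define d where "d = (complex_of_real (q t) - z) * (fst (u - v) + complex_of_real (F t) * snd (u - v))"
      have "norm (fst (u - v) + complex_of_real (F t) * snd (u - v)) \<le> norm (u - v) + B * norm (u - v)"
      proof (rule norm_triangle_mono)
        show "norm (fst (u - v)) \<le> norm (u - v)" by (metis norm_fst_le prod.collapse)
        show "norm (complex_of_real (F t) * snd (u - v)) \<le> B * norm (u - v)"
          unfolding norm_mult
        proof (rule mult_mono)
          show "norm (snd (u - v)) \<le> norm (u - v)" by (metis norm_snd_le prod.collapse)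
        qed (use B t in auto)
      qed
      then have "norm d \<le> (\<bar>q t\<bar> + norm z) * (norm (u - v) + B * norm (u - v))"
        unfolding d_def norm_mult
        by (intro mult_mono) (auto intro: order_trans[OF norm_triangle_ineq4])
      then have d: "norm d \<le> ((1 + B) * (\<bar>q t\<bar> + norm z)) * norm (u - v)" by (simp add: algebra_simps)
      have "G t u - G t v = (- complex_of_real (F t) * d, d)"
        by (simp add: G_def k_def d_def algebra_simps)
      also have "norm \<dots> \<le> norm (- complex_of_real (F t) * d) + norm d" by (rule norm_Pair_le)
      also have "\<dots> \<le> B * norm d + norm d"
        using B t by (auto simp: norm_mult intro!: mult_right_mono)
      also have "\<dots> = (1 + B) * norm d" by (simp add: algebra_simps)
      also have "\<dots> \<le> (1 + B) * (((1 + B) * (\<bar>q t\<bar> + norm z)) * norm (u - v))"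
        using B d by (intro mult_left_mono) auto
      finally show ?thesis by (simp add: L_def mult.assoc)
    qed
  qed simp
  then obtain y where y: "y 0 = (w0, h0)" "is_primitive 0 1 (\<lambda>t. G t (y t)) y" by blast
  have "sturm_system q z F g (\<lambda>t. fst (y t)) (\<lambda>t. snd (y t))"
    using is_primitive_linear[OF y(2) bounded_linear_fst] is_primitive_linear[OF y(2) bounded_linear_snd]
    unfolding sturm_system_def k[symmetric] by (simp add: G_def k_def sturm_rhs_def)
  then show ?thesis using y(1) by (intro exI[of _ "\<lambda>t. fst (y t)"] exI[of _ "\<lambda>t. snd (y t)"]) simp
qed

lemma is_primitive_diff_fun:
  assumes "is_primitive a b p y" "is_primitive a b p' y'"
  shows "is_primitive a b (\<lambda>x. p x - p' x) (\<lambda>x. y x - y' x)"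
  using is_primitive_add[OF assms(1) is_primitive_linear[OF assms(2) bounded_linear_minus[OF bounded_linear_ident]]]
  by simp

text \<open>Linearity in the one combination that occurs: subtracting a multiple of a solution
  subtracts the same multiple of its inhomogeneity.\<close>

lemma sturm_system_diff_cmult:
  assumes "sturm_system q z F g w h" "sturm_system q z F g' w' h'"
  shows "sturm_system q z F (\<lambda>t. g t - c * g' t) (\<lambda>t. w t - c * w' t) (\<lambda>t. h t - c * h' t)"
proof -
  have h: "is_primitive 0 1 (sturm_rhs q z F g w h) h"
    and w: "is_primitive 0 1 (\<lambda>t. - complex_of_real (F t) * sturm_rhs q z F g w h t) w"
    and h': "is_primitive 0 1 (sturm_rhs q z F g' w' h') h'"
    and w': "is_primitive 0 1 (\<lambda>t. - complex_of_real (F t) * sturm_rhs q z F g' w' h' t) w'"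
    using assms by (auto simp: sturm_system_def)
  note lin = is_primitive_diff_fun[OF _ is_primitive_linear[OF _ bounded_linear_mult_right[of c]]]
  have "is_primitive 0 1 (sturm_rhs q z F (\<lambda>t. g t - c * g' t) (\<lambda>t. w t - c * w' t) (\<lambda>t. h t - c * h' t)) (\<lambda>t. h t - c * h' t)"
    by (rule is_primitive_cong[OF lin[OF h h']]) (auto simp: sturm_rhs_def algebra_simps)
  moreover have "is_primitive 0 1 (\<lambda>t. - complex_of_real (F t) * sturm_rhs q z F (\<lambda>t. g t - c * g' t) (\<lambda>t. w t - c * w' t) (\<lambda>t. h t - c * h' t) t) (\<lambda>t. w t - c * w' t)"
    by (rule is_primitive_cong[OF lin[OF w w']]) (auto simp: sturm_rhs_def algebra_simps)
  ultimately show ?thesis by (simp add: sturm_system_def)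
qed

text \<open>The term \<open>r\<close> is absorbed into the initial constant, as its integral up to
  any point is at most its full integral. The same estimate serves for a priori bounds, for the
  distance of two systems and, with zero second component, for Pruefer angles.\<close>

lemma pair_gronwall:
  fixes w h :: "real \<Rightarrow> complex"
  assumes w: "is_primitive 0 1 pw w" and h: "is_primitive 0 1 ph h"
    and L: "L absolutely_integrable_on {0..1}" "\<And>t. t \<in> {0..1} \<Longrightarrow> 0 \<le> L t"
    and r: "r absolutely_integrable_on {0..1}" "\<And>t. t \<in> {0..1} \<Longrightarrow> 0 \<le> r t"
    and le: "\<And>t. t \<in> {0..1} \<Longrightarrow> norm (pw t) + norm (ph t) \<le> L t * (norm (w t) + norm (h t)) + r t"
    and x: "x \<in> {0..1}"
  shows "norm (w x) + norm (h x) \<le> (norm (w 0) + norm (h 0) + integral {0..1} r) * exp (integral {0..1} L)"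
proof -
  define u where "u t = norm (w t) + norm (h t)" for t
  have uc: "continuous_on {0..1} u"
    unfolding u_def by (intro continuous_intros is_primitive_continuous[OF w] is_primitive_continuous[OF h])
  have Lu: "(\<lambda>t. L t * u t) absolutely_integrable_on {0..1}" by (rule absint_continuous_mult(2)[OF L(1) uc])
  have R0: "0 \<le> integral {0..1} r"
    using r by (intro Henstock_Kurzweil_Integration.integral_nonneg) (auto simp: absolutely_integrable_on_def)
  have "u x \<le> (u 0 + integral {0..1} r) * exp (integral {0..x} L)"
  proof (rule gronwall[OF L Lu _ x])
    fix t :: real assume t: "t \<in> {0..1}"
    have ab: "0 \<le> t" "t \<le> 1" using t by auto
    have i: "f integrable_on {0..t}" if "f absolutely_integrable_on {0..1}" for f :: "real \<Rightarrow> real"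
      by (rule integrable_on_subinterval_real[OF that]) (use ab in auto)
    have nw: "(\<lambda>t. norm (pw t)) absolutely_integrable_on {0..1}" "(\<lambda>t. norm (ph t)) absolutely_integrable_on {0..1}"
      using absolutely_integrable_norm[OF is_primitive_absint[OF w]] absolutely_integrable_norm[OF is_primitive_absint[OF h]]
      by (simp_all add: o_def)
    have nle: "norm (y t) \<le> norm (y 0) + integral {0..t} (\<lambda>t. norm (p t))"
      if "is_primitive 0 1 p y" "(\<lambda>t. norm (p t)) absolutely_integrable_on {0..1}" for p y :: "real \<Rightarrow> complex"
    proof -
      have "norm (integral {0..t} p) \<le> 1 * integral {0..t} (\<lambda>t. norm (p t))"
        using ab by (intro norm_integral_le_mult i that(2)
            integrable_on_subinterval_real[OF is_primitive_absint[OF that(1)]]) auto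
      then show ?thesis using is_primitive_eq[OF that(1) ab] norm_triangle_ineq[of "y 0" "integral {0..t} p"] by simp
    qed
    have "u t \<le> u 0 + (integral {0..t} (\<lambda>t. norm (pw t)) + integral {0..t} (\<lambda>t. norm (ph t)))"
      using nle[OF w nw(1)] nle[OF h nw(2)] by (simp add: u_def)
    also have "integral {0..t} (\<lambda>t. norm (pw t)) + integral {0..t} (\<lambda>t. norm (ph t)) = integral {0..t} (\<lambda>t. norm (pw t) + norm (ph t))"
      by (rule Henstock_Kurzweil_Integration.integral_add[symmetric]) (intro i nw)+
    also have "\<dots> \<le> integral {0..t} (\<lambda>t. L t * u t + r t)"
    proof (rule integral_le)
      show "norm (pw s) + norm (ph s) \<le> L s * u s + r s" if "s \<in> {0..t}" for s
        using le[of s] that ab by (auto simp: u_def)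
    qed (intro integrable_add i nw Lu r)+
    also have "\<dots> = integral {0..t} (\<lambda>t. L t * u t) + integral {0..t} r"
      by (intro Henstock_Kurzweil_Integration.integral_add i Lu r)
    also have "integral {0..t} r \<le> integral {0..1} r"
      using ab r by (intro integral_subset_le i) (auto simp: absolutely_integrable_on_def)
    finally show "u t \<le> u 0 + integral {0..1} r + integral {0..t} (\<lambda>t. L t * u t)" by simp
  qed
  also have "\<dots> \<le> (u 0 + integral {0..1} r) * exp (integral {0..1} L)"
  proof (intro mult_left_mono)
    have "integral {0..x} L \<le> integral {0..1} L"
      using x L by (intro integral_subset_le integrable_on_subinterval_real[OF L(1)]) auto
    then show "exp (integral {0..x} L) \<le> exp (integral {0..1} L)" by simp
  qed (use R0 in \<open>auto simp: u_def\<close>)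
  finally show ?thesis by (simp add: u_def)
qed

section \<open>Norms in L2(0,1) through gauge integrals\<close>

lemma normL2_eq_integral:
  assumes "g \<in> L2_space"
  shows "normL2 g = sqrt (integral {0..1} (\<lambda>x. (norm (g x))\<^sup>2))"
    and "(\<lambda>x. (norm (g x))\<^sup>2) absolutely_integrable_on {0..1}"
proof -
  have i: "integrable (lebesgue_on unit_ivl) (\<lambda>x. (norm (g x))\<^sup>2)" using assms by (simp add: L2_space_def)
  then show "(\<lambda>x. (norm (g x))\<^sup>2) absolutely_integrable_on {0..1}"
    by (simp add: absolutely_integrable_on_Icc_iff_Ioo absint_iff_integrable)
  have "integral\<^sup>L (lebesgue_on unit_ivl) (\<lambda>x. (norm (g x))\<^sup>2) = integral unit_ivl (\<lambda>x. (norm (g x))\<^sup>2)"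
    by (rule lebesgue_integral_eq_integral[OF i]) simp
  also have "\<dots> = integral {0..1} (\<lambda>x. (norm (g x))\<^sup>2)" by (simp add: integral_open_interval_real)
  finally show "normL2 g = sqrt (integral {0..1} (\<lambda>x. (norm (g x))\<^sup>2))" by (simp add: normL2_def)
qed

lemma normL2_nonneg: "0 \<le> normL2 g"
  unfolding normL2_def by simp

lemma integral_mult_le_normL2:
  assumes a: "bounded_measurable a" and g: "g \<in> L2_space"
  shows "integral {0..1} (\<lambda>t. \<bar>a t\<bar> * norm (g t)) \<le> sqrt (integral {0..1} (\<lambda>t. (a t)\<^sup>2)) * normL2 g"
proof -
  have ab: "bounded_measurable (\<lambda>t. \<bar>a t\<bar>)" by (rule bounded_measurable_compose[OF a]) (intro continuous_intros)
  have a2: "bounded_measurable (\<lambda>t. \<bar>a t\<bar>\<^sup>2)" by (rule bounded_measurable_compose[OF a]) (intro continuous_intros)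
  have gn: "(\<lambda>t. norm (g t)) absolutely_integrable_on {0..1}"
    using absolutely_integrable_norm[OF L2_space_absint[OF g]] by (simp add: o_def)
  have "integral {0..1} (\<lambda>t. \<bar>a t\<bar> * norm (g t)) \<le>
      sqrt (integral {0..1} (\<lambda>t. \<bar>a t\<bar>\<^sup>2)) * sqrt (integral {0..1} (\<lambda>t. (norm (g t))\<^sup>2))"
    using bounded_measurable_absint[OF a2] normL2_eq_integral(2)[OF g] absint_bounded_measurable_mult(1)[OF ab gn]
    by (intro cauchy_schwarz_integral) (auto simp: absolutely_integrable_on_def)
  then show ?thesis by (simp add: normL2_eq_integral[OF g])
qed

lemma integral_norm_le_normL2:
  assumes "g \<in> L2_space"
  shows "integral {0..1} (\<lambda>t. norm (g t)) \<le> normL2 g"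
  using integral_mult_le_normL2[OF bounded_measurable_const[of 1] assms] by simp

lemma normL2_le:
  assumes f: "f \<in> L2_space" and m: "m integrable_on {0..1}"
    and le: "\<And>x. x \<in> unit_ivl \<Longrightarrow> (norm (f x))\<^sup>2 \<le> m x"
  shows "normL2 f \<le> sqrt (integral {0..1} m)"
proof -
  have "integral {0..1} (\<lambda>x. (norm (f x))\<^sup>2) = integral unit_ivl (\<lambda>x. (norm (f x))\<^sup>2)"
    by (simp add: integral_open_interval_real)
  also have "\<dots> \<le> integral unit_ivl m"
  proof (rule integral_le)
    show "(\<lambda>x. (norm (f x))\<^sup>2) integrable_on unit_ivl"
      using normL2_eq_integral(2)[OF f] by (auto simp: absolutely_integrable_on_def integrable_on_Icc_iff_Ioo)
    show "m integrable_on unit_ivl" using m by (simp add: integrable_on_Icc_iff_Ioo)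
  qed (rule le)
  also have "\<dots> = integral {0..1} m" by (simp add: integral_open_interval_real)
  finally show ?thesis using normL2_eq_integral(1)[OF f] by simp
qed

lemma normL2_cong_AE:
  assumes "AE x in lebesgue_on unit_ivl. f x = g x"
    "f \<in> borel_measurable (lebesgue_on unit_ivl)" "g \<in> borel_measurable (lebesgue_on unit_ivl)"
  shows "normL2 f = normL2 g"
proof -
  have "integral\<^sup>L (lebesgue_on unit_ivl) (\<lambda>x. (norm (f x))\<^sup>2) = integral\<^sup>L (lebesgue_on unit_ivl) (\<lambda>x. (norm (g x))\<^sup>2)"
    using assms by (intro integral_cong_AE) auto
  then show ?thesis by (simp add: normL2_def)
qed


section \<open>Bounds that are uniform over all distribution functions bounded by B\<close>

locale sturm_bounds =
  fixes q :: "real \<Rightarrow> real" and z :: complex and B :: real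
  assumes q: "q absolutely_integrable_on {0..1}" and B: "0 \<le> B"
begin

definition admissible :: "(real \<Rightarrow> real) \<Rightarrow> bool" where
  "admissible F \<longleftrightarrow> bounded_measurable F \<and> (\<forall>x\<in>{0..1}. \<bar>F x\<bar> \<le> B)"

definition Q :: "real \<Rightarrow> real" where "Q t = \<bar>q t\<bar> + norm z"

text \<open>Gronwall factor of the system. The additional \<open>1 + B\<close> absorbs the weight of
  the inhomogeneity, which enters both equations. F itself does not occur, so all bounds are uniform
  along a sequence.\<close>

definition K :: real where "K = (1 + B) * exp (integral {0..1} (\<lambda>t. (1 + B) * ((1 + B) * Q t)))"

lemma admissible_bm: "admissible F \<Longrightarrow> bounded_measurable F"
  and admissible_le: "admissible F \<Longrightarrow> x \<in> {0..1} \<Longrightarrow> \<bar>F x\<bar> \<le> B"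
  by (auto simp: admissible_def)

lemma Q_absint: "Q absolutely_integrable_on {0..1}"
  using absolutely_integrable_norm[OF q] unfolding Q_def[abs_def]
  by (intro set_integral_add(1)) (auto simp: o_def)

lemma Q_nonneg: "0 \<le> Q t" by (simp add: Q_def)

lemma L_absint: "(\<lambda>t. (1 + B) * ((1 + B) * Q t)) absolutely_integrable_on {0..1}"
  by (intro set_integrable_mult_right Q_absint)

lemma exp_le_K: "exp (integral {0..1} (\<lambda>t. (1 + B) * ((1 + B) * Q t))) \<le> K"
  using mult_right_mono[of 1 "1 + B" "exp (integral {0..1} (\<lambda>t. (1 + B) * ((1 + B) * Q t)))"] B
  by (simp add: K_def)

lemma K_pos: "0 < K"
  using exp_le_K exp_gt_zero by (rule less_le_trans[rotated])

lemma norm_q_le: "norm (complex_of_real (q t) - z) \<le> Q t"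
  using norm_triangle_ineq4[of "complex_of_real (q t)" z] by (simp add: Q_def)

lemma norm_comb_le:
  assumes "admissible F" "x \<in> {0..1}"
  shows "norm (a + complex_of_real (F x) * b) \<le> (1 + B) * (norm a + norm b)"
proof -
  have "norm (a + complex_of_real (F x) * b) \<le> norm a + B * norm b"
    by (rule norm_triangle_mono) (use admissible_le[OF assms] in \<open>auto simp: norm_mult intro!: mult_right_mono\<close>)
  also have "\<dots> \<le> (1 + B) * (norm a + norm b)" using B by (simp add: algebra_simps)
  finally show ?thesis .
qed

lemma sturm_rhs_le:
  assumes "admissible F" "t \<in> {0..1}"
  shows "norm (sturm_rhs q z F g w h t) \<le> (1 + B) * Q t * (norm (w t) + norm (h t)) + norm (g t)"
proof -
  have "norm ((complex_of_real (q t) - z) * (w t + complex_of_real (F t) * h t)) \<le> Q t * ((1 + B) * (norm (w t) + norm (h t)))"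
    unfolding norm_mult by (intro mult_mono norm_q_le norm_comb_le assms Q_nonneg) auto
  then show ?thesis unfolding sturm_rhs_def
    using norm_triangle_ineq4[of "(complex_of_real (q t) - z) * (w t + complex_of_real (F t) * h t)" "g t"]
    by (simp add: algebra_simps)
qed

lemma sturm_system_bound:
  assumes F: "admissible F" and sys: "sturm_system q z F g w h" and g: "g absolutely_integrable_on {0..1}"
    and x: "x \<in> {0..1}"
  shows "norm (w x) + norm (h x) \<le> K * (norm (w 0) + norm (h 0) + integral {0..1} (\<lambda>t. norm (g t)))"
proof -
  let ?k = "sturm_rhs q z F g w h"
  have gn: "(\<lambda>t. norm (g t)) absolutely_integrable_on {0..1}"
    using absolutely_integrable_norm[OF g] by (simp add: o_def)
  have "norm (w x) + norm (h x) \<le> (norm (w 0) + norm (h 0) + integral {0..1} (\<lambda>t. (1 + B) * norm (g t)))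
      * exp (integral {0..1} (\<lambda>t. (1 + B) * ((1 + B) * Q t)))"
  proof (rule pair_gronwall[where pw = "\<lambda>t. - complex_of_real (F t) * ?k t" and ph = ?k])
    show "norm (- complex_of_real (F t) * ?k t) + norm (?k t) \<le>
       (1 + B) * ((1 + B) * Q t) * (norm (w t) + norm (h t)) + (1 + B) * norm (g t)" if t: "t \<in> {0..1}" for t
    proof -
      have "norm (- complex_of_real (F t) * ?k t) \<le> B * norm (?k t)"
        using admissible_le[OF F t] by (auto simp: norm_mult intro!: mult_right_mono)
      then have "norm (- complex_of_real (F t) * ?k t) + norm (?k t) \<le> (1 + B) * norm (?k t)"
        by (simp add: algebra_simps)
      also have "\<dots> \<le> (1 + B) * ((1 + B) * Q t * (norm (w t) + norm (h t)) + norm (g t))"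
        using B by (intro mult_left_mono sturm_rhs_le[OF F t]) auto
      finally show ?thesis by (simp add: algebra_simps)
    qed
  qed (use sys B Q_nonneg x L_absint gn in \<open>auto simp: sturm_system_def\<close>)
  also have "integral {0..1} (\<lambda>t. (1 + B) * norm (g t)) = (1 + B) * integral {0..1} (\<lambda>t. norm (g t))" by simp
  also have "(norm (w 0) + norm (h 0) + (1 + B) * integral {0..1} (\<lambda>t. norm (g t)))
      \<le> (1 + B) * (norm (w 0) + norm (h 0) + integral {0..1} (\<lambda>t. norm (g t)))"
    using B by (simp add: algebra_simps)
  finally show ?thesis by (simp add: K_def algebra_simps)
qed

text \<open>The difference of the two solutions satisfies the system for \<open>F\<close> with an
  inhomogeneity carrying the factor \<open>F - F'\<close>. Since \<open>g\<close> is only square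
  integrable, its contribution is estimated by Cauchy-Schwarz; the one with \<open>Q\<close> remains
  a weighted L1 norm.\<close>

lemma sturm_system_dist:
  assumes F: "admissible F" "admissible F'"
    and sys: "sturm_system q z F g w h" "sturm_system q z F' g w' h'" and g: "g \<in> L2_space"
    and init: "w 0 = w' 0" "h 0 = h' 0" and M: "\<And>x. x \<in> {0..1} \<Longrightarrow> norm (w' x) + norm (h' x) \<le> M"
    and x: "x \<in> {0..1}"
  shows "norm (w x - w' x) + norm (h x - h' x) \<le>
    K * (2 * (1 + B) * M * integral {0..1} (\<lambda>t. \<bar>F t - F' t\<bar> * Q t) + sqrt (integral {0..1} (\<lambda>t. (F t - F' t)\<^sup>2)) * normL2 g)"
proof -
  let ?k = "sturm_rhs q z F g w h" and ?k' = "sturm_rhs q z F' g w' h'"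
  have Dbm: "bounded_measurable (\<lambda>t. F t - F' t)"
    using bounded_measurable_add[OF admissible_bm[OF F(1)] bounded_measurable_uminus[OF admissible_bm[OF F(2)]]] by simp
  have Dabs: "bounded_measurable (\<lambda>t. \<bar>F t - F' t\<bar>)" by (rule bounded_measurable_compose[OF Dbm]) (intro continuous_intros)
  have gn: "(\<lambda>t. norm (g t)) absolutely_integrable_on {0..1}"
    using absolutely_integrable_norm[OF L2_space_absint[OF g]] by (simp add: o_def)
  have Dg: "(\<lambda>t. \<bar>F t - F' t\<bar> * norm (g t)) absolutely_integrable_on {0..1}"
    by (rule absint_bounded_measurable_mult(1)[OF Dabs gn])
  have DQ: "(\<lambda>t. \<bar>F t - F' t\<bar> * Q t) absolutely_integrable_on {0..1}"
    by (rule absint_bounded_measurable_mult(1)[OF Dabs Q_absint])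
  have "norm (w' 0) + norm (h' 0) \<le> M" by (rule M) simp
  then have M0: "0 \<le> M" using norm_ge_zero[of "w' 0"] norm_ge_zero[of "h' 0"] by linarith
  \<comment> \<open>The factor 2 collects two terms: \<open>F - F'\<close> acting on
    \<open>h'\<close> inside \<open>?k\<close>, and \<open>F - F'\<close> multiplying
    \<open>?k'\<close> in the equation for \<open>w\<close>.\<close>
  define r where "r t = (2 * (1 + B) * M) * (\<bar>F t - F' t\<bar> * Q t) + \<bar>F t - F' t\<bar> * norm (g t)" for t
  have ra: "r absolutely_integrable_on {0..1}"
    unfolding r_def by (intro set_integral_add(1) set_integrable_mult_right DQ Dg)
  have r0: "0 \<le> r t" for t unfolding r_def using B M0 Q_nonneg by (intro add_nonneg_nonneg mult_nonneg_nonneg) auto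
  have "norm (w x - w' x) + norm (h x - h' x) \<le> (norm (w 0 - w' 0) + norm (h 0 - h' 0) + integral {0..1} r)
      * exp (integral {0..1} (\<lambda>t. (1 + B) * ((1 + B) * Q t)))"
  proof (rule pair_gronwall[where pw = "\<lambda>t. - complex_of_real (F t) * ?k t - (- complex_of_real (F' t) * ?k' t)" and ph = "\<lambda>t. ?k t - ?k' t"])
    show "is_primitive 0 1 (\<lambda>t. - complex_of_real (F t) * ?k t - (- complex_of_real (F' t) * ?k' t)) (\<lambda>t. w t - w' t)"
      "is_primitive 0 1 (\<lambda>t. ?k t - ?k' t) (\<lambda>t. h t - h' t)"
      using sys by (auto intro!: is_primitive_diff_fun simp only: sturm_system_def)
    fix t :: real assume t: "t \<in> {0..1}"
    let ?D = "\<bar>F t - F' t\<bar>" and ?u = "norm (w t - w' t) + norm (h t - h' t)"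
    have "?k t - ?k' t = (complex_of_real (q t) - z) * (((w t - w' t) + complex_of_real (F t) * (h t - h' t)) + complex_of_real (F t - F' t) * h' t)"
      by (simp add: sturm_rhs_def algebra_simps)
    also have "norm \<dots> \<le> Q t * ((1 + B) * ?u + ?D * M)"
      unfolding norm_mult
    proof (intro mult_mono norm_q_le norm_triangle_mono norm_comb_le[OF F(1) t])
      show "norm (complex_of_real (F t - F' t) * h' t) \<le> ?D * M"
      proof -
        have "norm (h' t) \<le> M" using M[OF t] norm_ge_zero[of "w' t"] by linarith
        then show ?thesis unfolding norm_mult norm_of_real by (intro mult_left_mono) auto
      qed
    qed (auto simp: Q_nonneg)
    finally have dk: "norm (?k t - ?k' t) \<le> Q t * ((1 + B) * ?u + ?D * M)" .
    have k': "norm (?k' t) \<le> (1 + B) * Q t * M + norm (g t)"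
    proof -
      have "(1 + B) * Q t * (norm (w' t) + norm (h' t)) \<le> (1 + B) * Q t * M"
        using B Q_nonneg by (intro mult_left_mono M t) auto
      then show ?thesis using sturm_rhs_le[OF F(2) t, of g w' h'] by simp
    qed
    have eq: "- complex_of_real (F t) * ?k t - (- complex_of_real (F' t) * ?k' t)
       = - (complex_of_real (F t) * (?k t - ?k' t) + complex_of_real (F t - F' t) * ?k' t)"
      by (simp add: algebra_simps)
    have "norm (- complex_of_real (F t) * ?k t - (- complex_of_real (F' t) * ?k' t))
       \<le> B * norm (?k t - ?k' t) + ?D * norm (?k' t)"
      unfolding eq norm_minus_cancel
      by (rule norm_triangle_mono) (use admissible_le[OF F(1) t] in \<open>auto simp: norm_mult simp flip: of_real_diff intro!: mult_right_mono\<close>)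
    then have "norm (- complex_of_real (F t) * ?k t - (- complex_of_real (F' t) * ?k' t)) + norm (?k t - ?k' t)
       \<le> (1 + B) * norm (?k t - ?k' t) + ?D * norm (?k' t)" unfolding distrib_right mult_1 by linarith
    also have "\<dots> \<le> (1 + B) * (Q t * ((1 + B) * ?u + ?D * M)) + ?D * ((1 + B) * Q t * M + norm (g t))"
      using B by (intro add_mono mult_left_mono dk k') auto
    also have "\<dots> = (1 + B) * ((1 + B) * Q t) * ?u + r t"
    proof -
      have "(1 + b) * (c * ((1 + b) * u + d * m)) + d * ((1 + b) * c * m + e)
        = (1 + b) * ((1 + b) * c) * u + ((2 * (1 + b) * m) * (d * c) + d * e)" for b c u d m e :: real
        by (simp add: algebra_simps)
      then show ?thesis unfolding r_def .
    qed
    finally show "norm (- complex_of_real (F t) * ?k t - (- complex_of_real (F' t) * ?k' t)) + norm (?k t - ?k' t)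
       \<le> (1 + B) * ((1 + B) * Q t) * ?u + r t" .
  qed (use B Q_nonneg x L_absint ra r0 in auto)
  also have "\<dots> = integral {0..1} r * exp (integral {0..1} (\<lambda>t. (1 + B) * ((1 + B) * Q t)))" using init by simp
  also have "\<dots> \<le> integral {0..1} r * K"
    using ra r0 by (intro mult_left_mono exp_le_K Henstock_Kurzweil_Integration.integral_nonneg) (auto simp: absolutely_integrable_on_def)
  also have "integral {0..1} r = 2 * (1 + B) * M * integral {0..1} (\<lambda>t. \<bar>F t - F' t\<bar> * Q t) + integral {0..1} (\<lambda>t. \<bar>F t - F' t\<bar> * norm (g t))"
    unfolding r_def using DQ Dg
    by (subst Henstock_Kurzweil_Integration.integral_add) (auto simp: absolutely_integrable_on_def intro: integrable_on_mult_right)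
  also have "\<dots> * K \<le> (2 * (1 + B) * M * integral {0..1} (\<lambda>t. \<bar>F t - F' t\<bar> * Q t) + sqrt (integral {0..1} (\<lambda>t. (F t - F' t)\<^sup>2)) * normL2 g) * K"
    using integral_mult_le_normL2[OF Dbm g] K_pos by (intro mult_right_mono add_left_mono) auto
  finally show ?thesis by (simp add: mult.commute)
qed

end

section \<open>Resolvents of the Dirichlet operator\<close>

text \<open>Solutions that satisfy only the left boundary condition, with \<open>h 0 = a\<close> as
  shooting parameter. Gronwall's inequality makes them unique on \<open>{0..1}\<close>, so the
  choice operator is harmless there.\<close>

definition sturm_sol ::
  "(real \<Rightarrow> real) \<Rightarrow> complex \<Rightarrow> (real \<Rightarrow> real) \<Rightarrow> (real \<Rightarrow> complex) \<Rightarrow> complex \<Rightarrow> (real \<Rightarrow> complex) \<times> (real \<Rightarrow> complex)" where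
  "sturm_sol q z F g a = (SOME (w, h). sturm_system q z F g w h \<and> w 0 = 0 \<and> h 0 = a)"

definition sturm_fun ::
  "(real \<Rightarrow> real) \<Rightarrow> complex \<Rightarrow> (real \<Rightarrow> real) \<Rightarrow> (real \<Rightarrow> complex) \<Rightarrow> complex \<Rightarrow> real \<Rightarrow> complex" where
  "sturm_fun q z F g a x = fst (sturm_sol q z F g a) x + complex_of_real (F x) * snd (sturm_sol q z F g a) x"

text \<open>Characteristic function of the Dirichlet problem: the value at 1 of the solution with
  w(0) = 0 and h(0) = 1, hence the denominator of the resolvent.\<close>

definition shooting :: "(real \<Rightarrow> real) \<Rightarrow> complex \<Rightarrow> (real \<Rightarrow> real) \<Rightarrow> complex" where
  "shooting q z F = sturm_fun q z F (\<lambda>x. 0) 1 1"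

lemma zero_L2_space [simp]: "(\<lambda>x. 0) \<in> L2_space"
  by (rule bounded_measurable_L2[OF bounded_measurable_const])

lemma normL2_zero [simp]: "normL2 (\<lambda>x. 0) = 0"
  by (simp add: normL2_def)

lemma integral_zero_imp_negligible:
  fixes f :: "real \<Rightarrow> real"
  assumes f: "f absolutely_integrable_on {0..1}" "\<And>x. x \<in> {0..1} \<Longrightarrow> 0 \<le> f x" and 0: "integral {0..1} f = 0"
  obtains N where "negligible N" "\<And>x. x \<in> {0..1} - N \<Longrightarrow> f x = 0"
proof -
  have i: "integrable (lebesgue_on {0..1}) f" using f(1) by (simp add: absint_iff_integrable)
  have "integral\<^sup>L (lebesgue_on {0..1}) f = 0" using 0 by (simp add: lebesgue_integral_eq_integral[OF i])
  moreover have "AE x in lebesgue_on {0..1}. 0 \<le> f x" by (rule AE_I2) (use f(2) in auto)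
  ultimately have "AE x in lebesgue_on {0..1}. f x = 0"
    using integral_nonneg_eq_0_iff_AE[OF i] by blast
  then have "AE x in lebesgue_on unit_ivl. f x = 0"
    by (subst (asm) AE_restrict_space_iff) (auto simp: AE_restrict_space_iff)
  then obtain N where N: "negligible N" "\<forall>x\<in>unit_ivl - N. f x = 0" by (auto simp: AE_unit_ivl_iff)
  show thesis
  proof (rule that)
    show "negligible (N \<union> {0, 1})" using N by (intro negligible_Un) auto
    show "f x = 0" if "x \<in> {0..1} - (N \<union> {0, 1})" for x using N(2) that by auto
  qed
qed

context sturm_bounds
begin

lemma sturm_sol:
  assumes "bounded_measurable F" "g absolutely_integrable_on {0..1}"
  shows "sturm_system q z F g (fst (sturm_sol q z F g a)) (snd (sturm_sol q z F g a))"
    and "fst (sturm_sol q z F g a) 0 = 0" and "snd (sturm_sol q z F g a) 0 = a"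
proof -
  have "\<exists>p. case p of (w, h) \<Rightarrow> sturm_system q z F g w h \<and> w 0 = 0 \<and> h 0 = a"
    using sturm_system_exists[OF q assms(1,2)] by (simp add: split_paired_Ex)
  from someI_ex[OF this]
  have "case sturm_sol q z F g a of (w, h) \<Rightarrow> sturm_system q z F g w h \<and> w 0 = 0 \<and> h 0 = a"
    by (simp only: sturm_sol_def)
  then show "sturm_system q z F g (fst (sturm_sol q z F g a)) (snd (sturm_sol q z F g a))"
    "fst (sturm_sol q z F g a) 0 = 0" "snd (sturm_sol q z F g a) 0 = a" by (auto simp: split_beta)
qed

lemma sturm_fun_bounded_measurable:
  assumes "bounded_measurable F" "g absolutely_integrable_on {0..1}"
  shows "bounded_measurable (sturm_fun q z F g a)"
  unfolding sturm_fun_def[abs_def]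
  by (rule sturm_system_bounded_measurable[OF sturm_sol(1)[OF assms] assms(1)])

text \<open>Superposition: subtracting the inhomogeneous solution with parameter 0 and
  \<open>h 0\<close> times the fundamental solution leaves zero initial data and zero inhomogeneity,
  for which the Gronwall bound is 0.\<close>

lemma sturm_system_unique:
  assumes F: "admissible F" and g: "g \<in> L2_space" and sys: "sturm_system q z F g w h" "w 0 = 0" and x: "x \<in> {0..1}"
  shows "w x + complex_of_real (F x) * h x = sturm_fun q z F g 0 x + h 0 * sturm_fun q z F (\<lambda>x. 0) 1 x"
proof -
  note ga = L2_space_absint[OF g] and Fb = admissible_bm[OF F]
  have z0: "(\<lambda>x :: real. 0 :: complex) absolutely_integrable_on {0..1}" by simp
  note S = sturm_sol[OF Fb ga, of 0] and S1 = sturm_sol[OF Fb z0, of 1]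
  let ?w = "fst (sturm_sol q z F g 0)" and ?h = "snd (sturm_sol q z F g 0)"
  let ?w1 = "fst (sturm_sol q z F (\<lambda>x. 0) 1)" and ?h1 = "snd (sturm_sol q z F (\<lambda>x. 0) 1)"
  have d1: "sturm_system q z F (\<lambda>t. g t - 1 * g t) (\<lambda>t. w t - 1 * ?w t) (\<lambda>t. h t - 1 * ?h t)"
    by (rule sturm_system_diff_cmult[OF sys(1) S(1)])
  have "sturm_system q z F (\<lambda>t. (g t - 1 * g t) - h 0 * 0) (\<lambda>t. (w t - 1 * ?w t) - h 0 * ?w1 t) (\<lambda>t. (h t - 1 * ?h t) - h 0 * ?h1 t)"
    by (rule sturm_system_diff_cmult[OF d1 S1(1)])
  then have d: "sturm_system q z F (\<lambda>t. 0) (\<lambda>t. w t - ?w t - h 0 * ?w1 t) (\<lambda>t. h t - ?h t - h 0 * ?h1 t)" by simp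
  have "norm (w x - ?w x - h 0 * ?w1 x) + norm (h x - ?h x - h 0 * ?h1 x) \<le> 0"
    using sturm_system_bound[OF F d z0 x] S S1 sys by simp
  then have "norm (w x - ?w x - h 0 * ?w1 x) = 0" "norm (h x - ?h x - h 0 * ?h1 x) = 0"
    using norm_ge_zero[of "w x - ?w x - h 0 * ?w1 x"] norm_ge_zero[of "h x - ?h x - h 0 * ?h1 x"] by linarith+
  then have "w x = ?w x + h 0 * ?w1 x" "h x = ?h x + h 0 * ?h1 x" by (simp_all add: algebra_simps)
  then show ?thesis by (simp add: sturm_fun_def algebra_simps)
qed

lemma sturm_fun_eq:
  assumes "admissible F" "g \<in> L2_space" "x \<in> {0..1}"
  shows "sturm_fun q z F g a x = sturm_fun q z F g 0 x + a * sturm_fun q z F (\<lambda>x. 0) 1 x"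
  using sturm_system_unique[OF assms(1,2) sturm_sol(1,2)[OF admissible_bm[OF assms(1)] L2_space_absint[OF assms(2)]] assms(3), of a]
    sturm_sol(3)[OF admissible_bm[OF assms(1)] L2_space_absint[OF assms(2)], of a]
  by (simp add: sturm_fun_def)

lemma sturm_sol_le:
  assumes F: "admissible F" and g: "g \<in> L2_space" and x: "x \<in> {0..1}"
  shows "norm (fst (sturm_sol q z F g a) x) + norm (snd (sturm_sol q z F g a) x) \<le> K * (norm a + normL2 g)"
proof -
  note S = sturm_sol[OF admissible_bm[OF F] L2_space_absint[OF g], of a]
  have "norm (fst (sturm_sol q z F g a) x) + norm (snd (sturm_sol q z F g a) x) \<le> K * (norm a + integral {0..1} (\<lambda>t. norm (g t)))"
    using sturm_system_bound[OF F S(1) L2_space_absint[OF g] x] S by simp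
  also have "\<dots> \<le> K * (norm a + normL2 g)"
    using K_pos integral_norm_le_normL2[OF g] by (intro mult_left_mono add_left_mono) auto
  finally show ?thesis .
qed

lemma sturm_fun_le:
  assumes F: "admissible F" and g: "g \<in> L2_space" and x: "x \<in> {0..1}"
  shows "norm (sturm_fun q z F g a x) \<le> (1 + B) * K * (norm a + normL2 g)"
proof -
  have "norm (sturm_fun q z F g a x) \<le> (1 + B) * (norm (fst (sturm_sol q z F g a) x) + norm (snd (sturm_sol q z F g a) x))"
    unfolding sturm_fun_def by (rule norm_comb_le[OF F x])
  also have "\<dots> \<le> (1 + B) * (K * (norm a + normL2 g))"
    using B by (intro mult_left_mono sturm_sol_le F g x) auto
  finally show ?thesis by (simp add: mult.assoc)
qed

text \<open>The bound of \<open>sturm_system_dist\<close> for data of norm at most 1, where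
  \<open>M\<close> can be taken as \<open>K\<close>. It controls w and h; for w + F h a pointwise
  term is added in \<open>sturm_fun_dist\<close>.\<close>

definition deviation :: "(real \<Rightarrow> real) \<Rightarrow> (real \<Rightarrow> real) \<Rightarrow> real" where
  "deviation F F' = K * (2 * (1 + B) * K * integral {0..1} (\<lambda>t. \<bar>F t - F' t\<bar> * Q t) + sqrt (integral {0..1} (\<lambda>t. (F t - F' t)\<^sup>2)))"

lemma sturm_fun_dist:
  assumes F: "admissible F" "admissible F'" and g: "g \<in> L2_space" and G: "norm a + normL2 g \<le> 1" and x: "x \<in> {0..1}"
  shows "norm (sturm_fun q z F g a x - sturm_fun q z F' g a x) \<le> (1 + B) * deviation F F' + K * \<bar>F x - F' x\<bar>"
proof -
  let ?w = "fst (sturm_sol q z F g a)" and ?h = "snd (sturm_sol q z F g a)"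
  let ?w' = "fst (sturm_sol q z F' g a)" and ?h' = "snd (sturm_sol q z F' g a)"
  note S = sturm_sol[OF admissible_bm[OF F(1)] L2_space_absint[OF g], of a]
    and S' = sturm_sol[OF admissible_bm[OF F(2)] L2_space_absint[OF g], of a]
  have M: "norm (?w' x) + norm (?h' x) \<le> K" if "x \<in> {0..1}" for x
    using order_trans[OF sturm_sol_le[OF F(2) g that, of a] mult_left_mono[OF G, of K]] K_pos by simp
  have "norm (?w x - ?w' x) + norm (?h x - ?h' x) \<le>
    K * (2 * (1 + B) * K * integral {0..1} (\<lambda>t. \<bar>F t - F' t\<bar> * Q t) + sqrt (integral {0..1} (\<lambda>t. (F t - F' t)\<^sup>2)) * normL2 g)"
    using S S' by (intro sturm_system_dist[OF F _ _ g _ _ M x]) auto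
  also have "\<dots> \<le> K * (2 * (1 + B) * K * integral {0..1} (\<lambda>t. \<bar>F t - F' t\<bar> * Q t) + sqrt (integral {0..1} (\<lambda>t. (F t - F' t)\<^sup>2)) * 1)"
  proof (intro mult_left_mono add_left_mono)
    show "normL2 g \<le> 1" using G norm_ge_zero[of a] by linarith
    have Dbm: "bounded_measurable (\<lambda>t. F t - F' t)"
      using bounded_measurable_add[OF admissible_bm[OF F(1)] bounded_measurable_uminus[OF admissible_bm[OF F(2)]]] by simp
    have "bounded_measurable (\<lambda>t. (F t - F' t)\<^sup>2)" by (rule bounded_measurable_compose[OF Dbm]) (intro continuous_intros)
    then have "(\<lambda>t. (F t - F' t)\<^sup>2) integrable_on {0..1}"
      using bounded_measurable_absint by (auto simp: absolutely_integrable_on_def)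
    then show "0 \<le> sqrt (integral {0..1} (\<lambda>t. (F t - F' t)\<^sup>2))"
      by (simp add: Henstock_Kurzweil_Integration.integral_nonneg)
  qed (use K_pos in auto)
  finally have dev: "norm (?w x - ?w' x) + norm (?h x - ?h' x) \<le> deviation F F'" by (simp add: deviation_def)
  have eq: "sturm_fun q z F g a x - sturm_fun q z F' g a x
     = ((?w x - ?w' x) + complex_of_real (F x) * (?h x - ?h' x)) + complex_of_real (F x - F' x) * ?h' x"
    by (simp add: sturm_fun_def algebra_simps)
  have "norm (sturm_fun q z F g a x - sturm_fun q z F' g a x)
      \<le> (1 + B) * (norm (?w x - ?w' x) + norm (?h x - ?h' x)) + K * \<bar>F x - F' x\<bar>"
    unfolding eq
  proof (rule norm_triangle_mono[OF norm_comb_le[OF F(1) x]])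
    have "norm (?h' x) \<le> K" using M[OF x] norm_ge_zero[of "?w' x"] by linarith
    then show "norm (complex_of_real (F x - F' x) * ?h' x) \<le> K * \<bar>F x - F' x\<bar>"
      unfolding norm_mult norm_of_real mult.commute[of K] by (intro mult_left_mono) auto
  qed
  also have "\<dots> \<le> (1 + B) * deviation F F' + K * \<bar>F x - F' x\<bar>"
    using B by (intro add_right_mono mult_left_mono dev) auto
  finally show ?thesis .
qed

text \<open>If the fundamental solution vanishes almost everywhere, then \<open>h\<close> and \<open>w\<close> are constant,
  so that \<open>F\<close> itself is the fundamental solution.\<close>

lemma sturm_fun_null_imp:
  assumes F: "admissible F" and N: "negligible N"
    and zero: "\<And>x. x \<in> {0..1} - N \<Longrightarrow> sturm_fun q z F (\<lambda>x. 0) 1 x = 0"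
  shows "integral {0..1} (\<lambda>t. \<bar>F t\<bar>) = 0"
proof -
  have z0: "(\<lambda>x :: real. 0 :: complex) absolutely_integrable_on {0..1}" by simp
  note S = sturm_sol[OF admissible_bm[OF F] z0, of 1]
  let ?w = "fst (sturm_sol q z F (\<lambda>x. 0) 1)" and ?h = "snd (sturm_sol q z F (\<lambda>x. 0) 1)"
  have k0: "sturm_rhs q z F (\<lambda>x. 0) ?w ?h t = 0" if "t \<in> {0..1} - N" for t
    using zero[OF that] by (simp add: sturm_rhs_def sturm_fun_def)
  have "is_primitive 0 1 (\<lambda>t. 0) ?h" "is_primitive 0 1 (\<lambda>t. 0) ?w"
    using S(1) unfolding sturm_system_def by (auto elim!: is_primitive_spike[OF _ N] simp: k0)
  then have "?h x = 1" "?w x = 0" if "x \<in> {0..1}" for x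
    using that S(2,3) is_primitive_eq[of 0 1 "\<lambda>t. 0" ?h x] is_primitive_eq[of 0 1 "\<lambda>t. 0" ?w x] by auto
  then have F0: "F x = 0" if "x \<in> {0..1} - N" for x
    using zero[OF that] that by (simp add: sturm_fun_def)
  have "integral {0..1} (\<lambda>t :: real. 0 :: real) = integral {0..1} (\<lambda>t. \<bar>F t\<bar>)"
    by (rule integral_spike[OF N]) (simp add: F0)
  then show ?thesis by simp
qed

text \<open>Green's identity: \<open>(w * cnj h - cnj w * h)' = (z - cnj z) * |w + F h|\<^sup>2\<close>.\<close>

lemma shooting_nonzero:
  assumes F: "admissible F" and z: "Im z \<noteq> 0" and F0: "integral {0..1} (\<lambda>t. \<bar>F t\<bar>) \<noteq> 0"
  shows "shooting q z F \<noteq> 0"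
proof
  assume sh: "shooting q z F = 0"
  have z0: "(\<lambda>x :: real. 0 :: complex) absolutely_integrable_on {0..1}" by simp
  note S = sturm_sol[OF admissible_bm[OF F] z0, of 1]
  let ?w = "fst (sturm_sol q z F (\<lambda>x. 0) 1)" and ?h = "snd (sturm_sol q z F (\<lambda>x. 0) 1)"
  let ?k = "sturm_rhs q z F (\<lambda>x. 0) ?w ?h" and ?F = "\<lambda>t. complex_of_real (F t)"
  define f where "f = sturm_fun q z F (\<lambda>x. 0) 1"
  have f: "f t = ?w t + ?F t * ?h t" for t by (simp add: f_def sturm_fun_def)
  have w: "is_primitive 0 1 (\<lambda>t. - ?F t * ?k t) ?w" and h: "is_primitive 0 1 ?k ?h"
    using S(1) by (auto simp: sturm_system_def)
  note cw = is_primitive_linear[OF w bounded_linear_cnj] and ch = is_primitive_linear[OF h bounded_linear_cnj]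
  have G: "is_primitive 0 1 (\<lambda>t. (z - cnj z) * complex_of_real ((norm (f t))\<^sup>2)) (\<lambda>t. ?w t * cnj (?h t) - cnj (?w t) * ?h t)"
  proof (rule is_primitive_cong[OF is_primitive_diff_fun[OF is_primitive_mult[OF w ch] is_primitive_mult[OF cw h]]])
    fix t
    have k: "?k t = (complex_of_real (q t) - z) * f t" by (simp add: sturm_rhs_def f)
    have "- ?F t * ?k t * cnj (?h t) + ?w t * cnj (?k t) - (cnj (- ?F t * ?k t) * ?h t + cnj (?w t) * ?k t)
        = cnj (?k t) * f t - ?k t * cnj (f t)" by (simp add: f algebra_simps)
    also have "\<dots> = (z - cnj z) * (f t * cnj (f t))" by (simp add: k algebra_simps)
    also have "f t * cnj (f t) = complex_of_real ((norm (f t))\<^sup>2)" by (metis complex_norm_square)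
    finally show "- ?F t * ?k t * cnj (?h t) + ?w t * cnj (?k t) - (cnj (- ?F t * ?k t) * ?h t + cnj (?w t) * ?k t)
       = (z - cnj z) * complex_of_real ((norm (f t))\<^sup>2)" .
  qed simp
  have fbm: "bounded_measurable f"
    unfolding f_def by (rule sturm_fun_bounded_measurable[OF admissible_bm[OF F] z0])
  have "bounded_measurable (\<lambda>t. (norm (f t))\<^sup>2)" by (rule bounded_measurable_compose[OF fbm]) (intro continuous_intros)
  then have f2: "(\<lambda>t. (norm (f t))\<^sup>2) absolutely_integrable_on {0..1}" by (rule bounded_measurable_absint)
  \<comment> \<open>As F is real, this relation makes the expression in \<open>G\<close> vanish at
    1; at 0 it vanishes because w does.\<close>
  have w1: "?w 1 = - ?F 1 * ?h 1"
    using sh by (simp add: shooting_def sturm_fun_def eq_neg_iff_add_eq_0)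
  have "0 = integral {0..1} (\<lambda>t. (z - cnj z) * complex_of_real ((norm (f t))\<^sup>2))"
    using is_primitive_eq[OF G, of 1] S(2) by (simp add: w1)
  also have "\<dots> = (z - cnj z) * integral {0..1} (\<lambda>t. complex_of_real ((norm (f t))\<^sup>2))" by simp
  also have "integral {0..1} (\<lambda>t. complex_of_real ((norm (f t))\<^sup>2)) = complex_of_real (integral {0..1} (\<lambda>t. (norm (f t))\<^sup>2))"
    using integral_linear[OF _ bounded_linear_of_real, of "\<lambda>t. (norm (f t))\<^sup>2" "{0..1}"] f2
    by (simp add: o_def absolutely_integrable_on_def)
  finally have "integral {0..1} (\<lambda>t. (norm (f t))\<^sup>2) = 0"
    using z by (simp add: complex_eq_iff)
  then obtain N where N: "negligible N" "\<And>x. x \<in> {0..1} - N \<Longrightarrow> (norm (f x))\<^sup>2 = 0"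
    using integral_zero_imp_negligible[OF f2] zero_le_power2 by blast
  then have "integral {0..1} (\<lambda>t. \<bar>F t\<bar>) = 0"
    by (intro sturm_fun_null_imp[OF F N(1)]) (simp add: f_def)
  then show False using F0 by simp
qed

text \<open>Every element of the graph comes from the shooting family, with \<open>a\<close> the
  value of the quasi-derivative at 0. The right boundary condition is one linear equation for
  \<open>a\<close>, and its coefficient decides between resolvent and eigenvalue.\<close>

lemma dirichlet_imp_sturm_fun:
  assumes P: "finite_signed_measure P" and F: "admissible (dist_fun P)" and g: "g \<in> L2_space"
    and f: "(f, \<lambda>x. g x + z * f x) \<in> dirichlet q P"
  obtains a where "AE x in lebesgue_on unit_ivl. f x = sturm_fun q z (dist_fun P) g a x"
    "sturm_fun q z (dist_fun P) g 0 1 + a * shooting q z (dist_fun P) = 0"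
proof -
  obtain w h where wh: "sturm_system q z (dist_fun P) g w h" "w 0 = 0" "w 1 + complex_of_real (dist_fun P 1) * h 1 = 0"
    "AE x in lebesgue_on unit_ivl. f x = w x + complex_of_real (dist_fun P x) * h x"
    using dirichlet_imp_sturm_system[OF P q g f] by blast
  have eq: "w x + complex_of_real (dist_fun P x) * h x = sturm_fun q z (dist_fun P) g 0 x + h 0 * sturm_fun q z (dist_fun P) (\<lambda>x. 0) 1 x"
    if "x \<in> {0..1}" for x using sturm_system_unique[OF F g wh(1,2) that] .
  have eq': "w x + complex_of_real (dist_fun P x) * h x = sturm_fun q z (dist_fun P) g (h 0) x"
    if "x \<in> {0..1}" for x using eq[OF that] sturm_fun_eq[OF F g that, of "h 0"] by simp
  show thesis
  proof (rule that[of "h 0"])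
    have "AE x in lebesgue_on unit_ivl. x \<in> unit_ivl" by (rule AE_I2) simp
    with wh(4) show "AE x in lebesgue_on unit_ivl. f x = sturm_fun q z (dist_fun P) g (h 0) x"
      by eventually_elim (simp add: eq')
    show "sturm_fun q z (dist_fun P) g 0 1 + h 0 * shooting q z (dist_fun P) = 0"
      using eq[of 1] wh(3) by (simp add: shooting_def)
  qed
qed

lemma sturm_fun_imp_dirichlet:
  assumes P: "finite_signed_measure P" and F: "admissible (dist_fun P)" and g: "g \<in> L2_space"
    and a: "sturm_fun q z (dist_fun P) g 0 1 + a * shooting q z (dist_fun P) = 0"
  shows "(sturm_fun q z (dist_fun P) g a, \<lambda>x. g x + z * sturm_fun q z (dist_fun P) g a x) \<in> dirichlet q P"
proof -
  note S = sturm_sol[OF admissible_bm[OF F] L2_space_absint[OF g], of a]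
  have "fst (sturm_sol q z (dist_fun P) g a) 1 + complex_of_real (dist_fun P 1) * snd (sturm_sol q z (dist_fun P) g a) 1 = 0"
    using a sturm_fun_eq[OF F g, of 1 a] by (simp add: shooting_def sturm_fun_def)
  from sturm_system_imp_dirichlet[OF P g S(1,2) this] show ?thesis
    by (simp add: sturm_fun_def[abs_def])
qed

end

section \<open>The resolvent by shooting\<close>

context sturm_bounds
begin

text \<open>For nonzero \<open>shooting\<close> this parameter solves the linear equation that
  expresses the right boundary condition.\<close>

definition resolvent_fun :: "(real \<Rightarrow> real) \<Rightarrow> (real \<Rightarrow> complex) \<Rightarrow> real \<Rightarrow> complex" where
  "resolvent_fun F g = sturm_fun q z F g (- sturm_fun q z F g 0 1 / shooting q z F)"

lemma resolvent_fun_eq: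
  assumes "admissible F" "g \<in> L2_space" "x \<in> {0..1}"
  shows "resolvent_fun F g x =
    sturm_fun q z F g 0 x - sturm_fun q z F g 0 1 / shooting q z F * sturm_fun q z F (\<lambda>x. 0) 1 x"
  unfolding resolvent_fun_def by (subst sturm_fun_eq[OF assms]) simp

lemma resolvent_fun_bounded_measurable:
  assumes "admissible F" "g \<in> L2_space"
  shows "bounded_measurable (resolvent_fun F g)"
  unfolding resolvent_fun_def
  by (rule sturm_fun_bounded_measurable[OF admissible_bm[OF assms(1)] L2_space_absint[OF assms(2)]])

lemma dirichlet_resolvent_AE:
  assumes P: "finite_signed_measure P" and F: "admissible (dist_fun P)" and g: "g \<in> L2_space"
    and sh: "shooting q z (dist_fun P) \<noteq> 0" and f: "(f, \<lambda>x. g x + z * f x) \<in> dirichlet q P"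
  shows "AE x in lebesgue_on unit_ivl. f x = resolvent_fun (dist_fun P) g x"
proof -
  obtain a where a: "AE x in lebesgue_on unit_ivl. f x = sturm_fun q z (dist_fun P) g a x"
    "sturm_fun q z (dist_fun P) g 0 1 + a * shooting q z (dist_fun P) = 0"
    using dirichlet_imp_sturm_fun[OF P F g f] by blast
  have "a = - sturm_fun q z (dist_fun P) g 0 1 / shooting q z (dist_fun P)"
    using a(2) sh by (simp add: field_simps add_eq_0_iff2)
  then show ?thesis using a(1) by (simp add: resolvent_fun_def)
qed

lemma resolvent_fun_in_dirichlet:
  assumes P: "finite_signed_measure P" and F: "admissible (dist_fun P)" and g: "g \<in> L2_space"
    and sh: "shooting q z (dist_fun P) \<noteq> 0"
  shows "(resolvent_fun (dist_fun P) g, \<lambda>x. g x + z * resolvent_fun (dist_fun P) g x) \<in> dirichlet q P"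
  unfolding resolvent_fun_def using sh by (intro sturm_fun_imp_dirichlet[OF P F g]) simp

lemma resolvent_fun_le:
  assumes F: "admissible F" and g: "g \<in> L2_space" and x: "x \<in> {0..1}"
  shows "norm (resolvent_fun F g x) \<le> ((1 + B) * K + (1 + B) * K / norm (shooting q z F) * ((1 + B) * K)) * normL2 g"
proof -
  have "norm (resolvent_fun F g x) \<le> norm (sturm_fun q z F g 0 x)
      + norm (sturm_fun q z F g 0 1 / shooting q z F * sturm_fun q z F (\<lambda>x. 0) 1 x)"
    unfolding resolvent_fun_eq[OF assms] by (rule norm_triangle_ineq4)
  also have "\<dots> \<le> (1 + B) * K * normL2 g + (1 + B) * K * normL2 g / norm (shooting q z F) * ((1 + B) * K)"
    unfolding norm_mult norm_divide
    using sturm_fun_le[OF F g x, of 0] sturm_fun_le[OF F g, of 1 0] sturm_fun_le[OF F zero_L2_space x, of 1] B K_pos normL2_nonneg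
    by (intro add_mono mult_mono divide_right_mono) (auto intro!: divide_nonneg_nonneg mult_nonneg_nonneg)
  finally show ?thesis by (simp add: algebra_simps)
qed

lemma normL2_le_const:
  assumes "bounded_measurable f" "\<And>x. x \<in> {0..1} \<Longrightarrow> norm (f x) \<le> c"
  shows "normL2 f \<le> c"
proof -
  have c: "0 \<le> c" using order_trans[OF norm_ge_zero assms(2)[of 0]] by simp
  have "normL2 f \<le> sqrt (integral {0..1} (\<lambda>x :: real. c\<^sup>2))"
    using assms by (intro normL2_le bounded_measurable_L2) (auto intro!: power_mono)
  then show ?thesis using c by simp
qed

text \<open>Each element of the graph agrees almost everywhere with the explicit solution for its
  own right-hand side, so the pointwise bound of \<open>resolvent_fun\<close> is the a priori
  estimate.\<close>

lemma dirichlet_in_resolvent_set: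
  assumes P: "finite_signed_measure P" and F: "admissible (dist_fun P)" and sh: "shooting q z (dist_fun P) \<noteq> 0"
  shows "in_resolvent_set (dirichlet q P) z"
  unfolding in_resolvent_set_def
proof (intro conjI ballI exI)
  let ?C = "(1 + B) * K + (1 + B) * K / norm (shooting q z (dist_fun P)) * ((1 + B) * K)"
  show "(resolvent_fun (dist_fun P) g, \<lambda>x. g x + z * resolvent_fun (dist_fun P) g x) \<in> dirichlet q P"
    if "g \<in> L2_space" for g by (rule resolvent_fun_in_dirichlet[OF P F that sh])
  fix p assume p: "p \<in> dirichlet q P"
  obtain f h where fh: "p = (f, h)" by (cases p)
  have f2: "f \<in> L2_space" and h2: "h \<in> L2_space" using p by (auto simp: fh dirichlet_def)
  define g where "g x = h x - z * f x" for x
  have g: "g \<in> L2_space" using L2_space_add[OF h2 L2_space_cmult[OF f2, of "- z"]] by (simp add: g_def[abs_def])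
  have "(f, \<lambda>x. g x + z * f x) \<in> dirichlet q P" using p by (simp add: fh g_def)
  then have "AE x in lebesgue_on unit_ivl. f x = resolvent_fun (dist_fun P) g x"
    by (rule dirichlet_resolvent_AE[OF P F g sh])
  then have "normL2 f = normL2 (resolvent_fun (dist_fun P) g)"
    using f2 bounded_measurable_unit_ivl[OF resolvent_fun_bounded_measurable[OF F g]]
    by (intro normL2_cong_AE) (auto simp: L2_space_def)
  also have "\<dots> \<le> ?C * normL2 g"
    by (rule normL2_le_const[OF resolvent_fun_bounded_measurable[OF F g] resolvent_fun_le[OF F g]])
  finally show "case p of (f, h) \<Rightarrow> normL2 f \<le> ?C * normL2 (\<lambda>x. h x - z * f x)"
    by (simp add: fh g_def[abs_def])
qed

lemma resolvent_AE:
  assumes P: "finite_signed_measure P" and F: "admissible (dist_fun P)" and sh: "shooting q z (dist_fun P) \<noteq> 0"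
    and g: "g \<in> L2_space"
  shows "AE x in lebesgue_on unit_ivl. resolvent (dirichlet q P) z g x = resolvent_fun (dist_fun P) g x"
    and "resolvent (dirichlet q P) z g \<in> L2_space"
proof -
  have "\<exists>f. (f, \<lambda>x. g x + z * f x) \<in> dirichlet q P"
    using resolvent_fun_in_dirichlet[OF P F g sh] by blast
  from someI_ex[OF this]
  have r: "(resolvent (dirichlet q P) z g, \<lambda>x. g x + z * resolvent (dirichlet q P) z g x) \<in> dirichlet q P"
    by (simp only: resolvent_def)
  then show "AE x in lebesgue_on unit_ivl. resolvent (dirichlet q P) z g x = resolvent_fun (dist_fun P) g x"
    by (rule dirichlet_resolvent_AE[OF P F g sh])
  show "resolvent (dirichlet q P) z g \<in> L2_space" using r by (auto simp: dirichlet_def)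
qed

text \<open>Perturbation of a quotient: the second condition on \<open>shooting\<close> keeps the
  inverse of the perturbed denominator below 2 / \<open>\<sigma>\<close>. The distance at
  \<open>x\<close> enters directly, the distance at 1 through the shooting parameter.\<close>

lemma resolvent_fun_dist:
  assumes F: "admissible F" "admissible F'" and g: "g \<in> L2_space" "normL2 g \<le> 1" and x: "x \<in> {0..1}"
    and sh: "shooting q z F' \<noteq> 0" "norm (shooting q z F') / 2 \<le> norm (shooting q z F)"
  defines "S \<equiv> (1 + B) * K" and "\<sigma> \<equiv> norm (shooting q z F')"
    and "D \<equiv> \<lambda>x. (1 + B) * deviation F F' + K * \<bar>F x - F' x\<bar>"
  shows "norm (resolvent_fun F g x - resolvent_fun F' g x) \<le> (1 + S / \<sigma>) * D x + (2 * S / \<sigma> + 2 * S\<^sup>2 / \<sigma>\<^sup>2) * D 1"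
proof -
  let ?s = "shooting q z F" and ?s' = "shooting q z F'"
  let ?u = "sturm_fun q z F g 0" and ?u' = "sturm_fun q z F' g 0"
  let ?v = "sturm_fun q z F (\<lambda>x. 0) 1" and ?v' = "sturm_fun q z F' (\<lambda>x. 0) 1"
  have S0: "0 \<le> S" using B K_pos by (simp add: S_def)
  have \<sigma>0: "0 < \<sigma>" using sh by (simp add: \<sigma>_def)
  have s0: "?s \<noteq> 0" using sh by auto
  have one: "1 \<in> {0..1::real}" by simp
  have du: "norm (?u y - ?u' y) \<le> D y" "norm (?v y - ?v' y) \<le> D y" if "y \<in> {0..1}" for y
    unfolding D_def using sturm_fun_dist[OF F g(1) _ that, of 0] sturm_fun_dist[OF F zero_L2_space _ that, of 1] g(2) by simp_all
  have D0: "0 \<le> D y" if "y \<in> {0..1}" for y using du(1)[OF that] norm_ge_zero order_trans by blast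
  have SS: "S * normL2 g \<le> S" using mult_left_mono[OF g(2) S0] by simp
  have uS: "norm (?u' 1) \<le> S" "norm (?v x) \<le> S"
    using sturm_fun_le[OF F(2) g(1) one, of 0] sturm_fun_le[OF F(1) zero_L2_space x, of 1] SS by (simp_all add: S_def)
  define c c' where "c = ?u 1 / ?s" and "c' = ?u' 1 / ?s'"
  have c': "norm c' \<le> S / \<sigma>" using uS \<sigma>0 by (simp add: c'_def norm_divide \<sigma>_def divide_right_mono)
  have ss: "norm (?s - ?s') \<le> D 1" unfolding shooting_def using du(2)[OF one] by simp
  have inv: "1 / norm ?s \<le> 2 / \<sigma>"
    using sh(2) \<sigma>0 s0 by (simp add: \<sigma>_def field_simps)
  \<comment> \<open>The difference of quotients is arranged so that only the denominator
    \<open>?s\<close> and the already bounded \<open>c'\<close> occur.\<close>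
  have "c - c' = (?u 1 - ?u' 1) / ?s - c' * (?s - ?s') / ?s"
    using s0 sh(1) by (simp add: c_def c'_def field_simps)
  then have "norm (c - c') \<le> norm ((?u 1 - ?u' 1) / ?s) + norm (c' * (?s - ?s') / ?s)"
    by (simp add: norm_triangle_ineq4)
  also have "\<dots> = (norm (?u 1 - ?u' 1) + norm c' * norm (?s - ?s')) * (1 / norm ?s)"
    by (simp only: norm_mult norm_divide times_divide_eq_right mult_1_right add_divide_distrib)
  also have "\<dots> \<le> (D 1 + S / \<sigma> * D 1) * (2 / \<sigma>)"
    using c' ss du(1)[OF one] inv D0[OF one] S0 \<sigma>0
    by (intro mult_mono add_mono) (auto intro!: add_nonneg_nonneg mult_nonneg_nonneg)
  finally have cc: "norm (c - c') \<le> (D 1 + S / \<sigma> * D 1) * (2 / \<sigma>)" .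
  have eq: "resolvent_fun F g x - resolvent_fun F' g x = (?u x - ?u' x) - ((c - c') * ?v x + c' * (?v x - ?v' x))"
    unfolding resolvent_fun_eq[OF F(1) g(1) x] resolvent_fun_eq[OF F(2) g(1) x] c_def[symmetric] c'_def[symmetric]
    by (simp add: algebra_simps)
  have "norm (resolvent_fun F g x - resolvent_fun F' g x) \<le> norm (?u x - ?u' x) + (norm (c - c') * norm (?v x) + norm c' * norm (?v x - ?v' x))"
    unfolding eq norm_mult[symmetric]
    by (rule order_trans[OF norm_triangle_ineq4]) (intro add_left_mono norm_triangle_ineq)
  also have "\<dots> \<le> D x + ((D 1 + S / \<sigma> * D 1) * (2 / \<sigma>) * S + S / \<sigma> * D x)"
    using c' cc uS du[OF x] D0[OF one] D0[OF x] S0 \<sigma>0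
    by (intro mult_mono add_mono) (auto intro!: add_nonneg_nonneg mult_nonneg_nonneg)
  also have "\<dots> = (1 + S / \<sigma>) * D x + (2 * S / \<sigma> + 2 * S\<^sup>2 / \<sigma>\<^sup>2) * D 1"
    using \<sigma>0 by (simp add: field_simps power2_eq_square)
  finally show ?thesis .
qed

end

section \<open>Convergence of the resolvents\<close>

text \<open>The excess of an integrable function over a high constant has small integral, by
  dominated convergence. This makes up for unbounded potentials, in weighted L1 norms and for very
  negative spectral parameters.\<close>

lemma truncated_integral_tendsto:
  fixes Q :: "real \<Rightarrow> real"
  assumes Q: "Q absolutely_integrable_on {0..1}" "\<And>x. x \<in> {0..1} \<Longrightarrow> 0 \<le> Q x"
  defines "T \<equiv> \<lambda>n t. max (Q t - real n) 0"
  shows "T n integrable_on {0..1}" "(\<lambda>n. integral {0..1} (T n)) \<longlonglongrightarrow> 0"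
proof -
  have Ta: "T n absolutely_integrable_on {0..1}" for n
    unfolding T_def by (intro absolutely_integrable_max_1 set_integral_diff(1) Q bounded_measurable_absint
        bounded_measurable_const)
  have Ti: "T n integrable_on {0..1}" for n using Ta by (simp add: absolutely_integrable_on_def)
  then show "T n integrable_on {0..1}" .
  have "(\<lambda>n. integral {0..1} (T n)) \<longlonglongrightarrow> integral {0..1} (\<lambda>t :: real. 0 :: real)"
  proof (rule dominated_convergence(2)[where h = Q])
    show "norm (T n x) \<le> Q x" if "x \<in> {0..1}" for n x using Q(2)[OF that] by (simp add: T_def)
    show "(\<lambda>n. T n x) \<longlonglongrightarrow> 0" if "x \<in> {0..1}" for x
    proof (rule tendsto_eventually)
      obtain m :: nat where "Q x \<le> real m" using real_arch_simple by blast
      then show "\<forall>\<^sub>F n in sequentially. T n x = 0"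
        unfolding eventually_sequentially T_def by (intro exI[of _ m]) (auto simp: max_def)
    qed
  qed (use Ti Q in \<open>auto simp: absolutely_integrable_on_def\<close>)
  then show "(\<lambda>n. integral {0..1} (T n)) \<longlonglongrightarrow> 0" by simp
qed

text \<open>\<open>Q\<close> is split at height \<open>n\<close>, giving D Q \<le> n D + C T with T
  the excess of Q over n. The second term is small uniformly in \<open>k\<close> for large
  \<open>n\<close>; then \<open>k\<close> is taken large for this fixed \<open>n\<close>.\<close>

lemma weighted_L1_tendsto:
  fixes D :: "nat \<Rightarrow> real \<Rightarrow> real" and Q :: "real \<Rightarrow> real"
  assumes D: "\<And>k. bounded_measurable (D k)" "\<And>k x. x \<in> {0..1} \<Longrightarrow> 0 \<le> D k x" "\<And>k x. x \<in> {0..1} \<Longrightarrow> D k x \<le> C"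
    and lim: "(\<lambda>k. integral {0..1} (D k)) \<longlonglongrightarrow> 0"
    and Q: "Q absolutely_integrable_on {0..1}" "\<And>x. x \<in> {0..1} \<Longrightarrow> 0 \<le> Q x"
  shows "(\<lambda>k. integral {0..1} (\<lambda>t. D k t * Q t)) \<longlonglongrightarrow> 0"
proof -
  have C: "0 \<le> C" using D(2)[of 0 0] D(3)[of 0 0] by simp
  have Di: "D k integrable_on {0..1}" for k
    using bounded_measurable_absint[OF D(1)] by (simp add: absolutely_integrable_on_def)
  have DQ: "(\<lambda>t. D k t * Q t) integrable_on {0..1}" for k
    using absint_bounded_measurable_mult(1)[OF D(1) Q(1)] by (simp add: absolutely_integrable_on_def)
  define T where "T n t = max (Q t - real n) 0" for n t
  have Ti: "T n integrable_on {0..1}" for n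
    using truncated_integral_tendsto(1)[OF Q] by (simp add: T_def[abs_def])
  have T0: "(\<lambda>n. integral {0..1} (T n)) \<longlonglongrightarrow> 0"
    using truncated_integral_tendsto(2)[OF Q] by (simp add: T_def[abs_def])
  show ?thesis
  proof (rule LIMSEQ_I)
    fix e :: real assume e: "0 < e"
    have "0 < e / (2 * (C + 1))" using e C by simp
    from LIMSEQ_D[OF T0 this] obtain n where n: "integral {0..1} (T n) < e / (2 * (C + 1))"
      by (metis abs_ge_self diff_zero order.refl le_less_trans real_norm_def)
    have "0 < e / (2 * (real n + 1))" using e by simp
    from LIMSEQ_D[OF lim this] obtain k0 where k0: "\<And>k. k \<ge> k0 \<Longrightarrow> \<bar>integral {0..1} (D k)\<bar> < e / (2 * (real n + 1))"
      by auto
    show "\<exists>k0. \<forall>k\<ge>k0. norm (integral {0..1} (\<lambda>t. D k t * Q t) - 0) < e"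
    proof (intro exI allI impI)
      fix k assume "k \<ge> k0"
      have nn: "0 \<le> integral {0..1} (\<lambda>t. D k t * Q t)"
        using D Q by (intro Henstock_Kurzweil_Integration.integral_nonneg DQ) auto
      have "integral {0..1} (\<lambda>t. D k t * Q t) \<le> integral {0..1} (\<lambda>t. real n * D k t + C * T n t)"
      proof (rule integral_le[OF DQ])
        show "(\<lambda>t. real n * D k t + C * T n t) integrable_on {0..1}"
          by (intro integrable_add integrable_on_mult_right Di Ti)
        fix t :: real assume t: "t \<in> {0..1}"
        have "Q t \<le> real n + T n t" by (simp add: T_def)
        then have "D k t * Q t \<le> D k t * (real n + T n t)" using D(2)[OF t] by (intro mult_left_mono)
        also have "\<dots> \<le> real n * D k t + C * T n t"
          using mult_right_mono[OF D(3)[OF t, of k], of "T n t"] by (simp add: T_def algebra_simps)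
        finally show "D k t * Q t \<le> real n * D k t + C * T n t" .
      qed
      also have "\<dots> = real n * integral {0..1} (D k) + C * integral {0..1} (T n)"
        by (subst Henstock_Kurzweil_Integration.integral_add) (auto intro!: integrable_on_mult_right Di Ti)
      also have "\<dots> < e"
      proof -
        have "0 \<le> integral {0..1} (D k)"
          using D(2) by (intro Henstock_Kurzweil_Integration.integral_nonneg Di)
        then have "real n * integral {0..1} (D k) \<le> (real n + 1) * \<bar>integral {0..1} (D k)\<bar>"
          by (intro mult_mono) auto
        also have "\<dots> < (real n + 1) * (e / (2 * (real n + 1)))"
          by (intro mult_strict_left_mono k0 \<open>k \<ge> k0\<close>) auto
        also have "\<dots> = e / 2" by (simp add: field_simps)
        finally have 1: "real n * integral {0..1} (D k) < e / 2" .
        have "C * integral {0..1} (T n) \<le> C * (e / (2 * (C + 1)))" using C n by (intro mult_left_mono) auto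
        also have "\<dots> \<le> (C + 1) * (e / (2 * (C + 1)))" using C e by (intro mult_right_mono) auto
        also have "\<dots> = e / 2" using C by (simp add: field_simps)
        finally show ?thesis using 1 by simp
      qed
      finally show "norm (integral {0..1} (\<lambda>t. D k t * Q t) - 0) < e" using nn by simp
    qed
  qed
qed

section \<open>A sequence of distribution functions converging in L1 and at 1\<close>

context sturm_bounds
begin

context
  fixes Fs :: "nat \<Rightarrow> real \<Rightarrow> real" and F :: "real \<Rightarrow> real"
  assumes Fs: "\<And>k. admissible (Fs k)" and F: "admissible F"
    and L1: "(\<lambda>k. integral {0..1} (\<lambda>t. \<bar>Fs k t - F t\<bar>)) \<longlonglongrightarrow> 0"
    and at1: "(\<lambda>k. Fs k 1) \<longlonglongrightarrow> F 1"
begin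

lemma diff_bounded_measurable: "bounded_measurable (\<lambda>t. Fs k t - F t)"
  using bounded_measurable_add[OF admissible_bm[OF Fs] bounded_measurable_uminus[OF admissible_bm[OF F]]] by simp

lemma abs_diff_bounded_measurable: "bounded_measurable (\<lambda>t. \<bar>Fs k t - F t\<bar>)"
  by (rule bounded_measurable_compose[OF diff_bounded_measurable]) (intro continuous_intros)

lemma sq_diff_integrable: "(\<lambda>t. (Fs k t - F t)\<^sup>2) integrable_on {0..1}"
proof -
  have "bounded_measurable (\<lambda>t. (Fs k t - F t)\<^sup>2)"
    by (rule bounded_measurable_compose[OF diff_bounded_measurable]) (intro continuous_intros)
  then show ?thesis using bounded_measurable_absint by (auto simp: absolutely_integrable_on_def)
qed

lemma abs_diff_le: "x \<in> {0..1} \<Longrightarrow> \<bar>Fs k x - F x\<bar> \<le> 2 * B"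
  using admissible_le[OF Fs, of x k] admissible_le[OF F, of x] by auto

text \<open>The uniform bound upgrades L1 convergence to L2 convergence.\<close>

lemma sq_diff_tendsto: "(\<lambda>k. integral {0..1} (\<lambda>t. (Fs k t - F t)\<^sup>2)) \<longlonglongrightarrow> 0"
proof (rule tendsto_sandwich[of "\<lambda>_. 0" _ _ "\<lambda>k. 2 * B * integral {0..1} (\<lambda>t. \<bar>Fs k t - F t\<bar>)"])
  show "\<forall>\<^sub>F k in sequentially. 0 \<le> integral {0..1} (\<lambda>t. (Fs k t - F t)\<^sup>2)"
    by (intro always_eventually allI Henstock_Kurzweil_Integration.integral_nonneg sq_diff_integrable) auto
  have "integral {0..1} (\<lambda>t. (Fs k t - F t)\<^sup>2) \<le> 2 * B * integral {0..1} (\<lambda>t. \<bar>Fs k t - F t\<bar>)" for k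
  proof -
    have i: "(\<lambda>t. \<bar>Fs k t - F t\<bar>) integrable_on {0..1}"
      using bounded_measurable_absint[OF abs_diff_bounded_measurable] by (simp add: absolutely_integrable_on_def)
    have "integral {0..1} (\<lambda>t. (Fs k t - F t)\<^sup>2) \<le> integral {0..1} (\<lambda>t. 2 * B * \<bar>Fs k t - F t\<bar>)"
    proof (rule integral_le[OF sq_diff_integrable integrable_on_mult_right[OF i]])
      show "(Fs k t - F t)\<^sup>2 \<le> 2 * B * \<bar>Fs k t - F t\<bar>" if "t \<in> {0..1}" for t
        using mult_right_mono[OF abs_diff_le[OF that, of k], of "\<bar>Fs k t - F t\<bar>"]
        by (simp add: power2_eq_square)
    qed
    then show ?thesis by simp
  qed
  then show "\<forall>\<^sub>F k in sequentially. integral {0..1} (\<lambda>t. (Fs k t - F t)\<^sup>2) \<le> 2 * B * integral {0..1} (\<lambda>t. \<bar>Fs k t - F t\<bar>)"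
    by simp
  show "(\<lambda>k. 2 * B * integral {0..1} (\<lambda>t. \<bar>Fs k t - F t\<bar>)) \<longlonglongrightarrow> 0"
    using tendsto_mult_left[OF L1, of "2 * B"] by simp
qed simp

lemma deviation_tendsto: "(\<lambda>k. deviation (Fs k) F) \<longlonglongrightarrow> 0"
proof -
  have "(\<lambda>k. integral {0..1} (\<lambda>t. \<bar>Fs k t - F t\<bar> * Q t)) \<longlonglongrightarrow> 0"
    by (rule weighted_L1_tendsto[OF abs_diff_bounded_measurable _ abs_diff_le L1 Q_absint]) (auto simp: Q_nonneg)
  then have "(\<lambda>k. deviation (Fs k) F) \<longlonglongrightarrow> K * (2 * (1 + B) * K * 0 + sqrt 0)"
    unfolding deviation_def by (intro tendsto_intros sq_diff_tendsto)
  then show ?thesis by simp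
qed

lemma deviation_at_1_tendsto: "(\<lambda>k. (1 + B) * deviation (Fs k) F + K * \<bar>Fs k 1 - F 1\<bar>) \<longlonglongrightarrow> 0"
proof -
  have "(\<lambda>k. (1 + B) * deviation (Fs k) F + K * \<bar>Fs k 1 - F 1\<bar>) \<longlonglongrightarrow> (1 + B) * 0 + K * \<bar>F 1 - F 1\<bar>"
    by (intro tendsto_intros deviation_tendsto at1)
  then show ?thesis by simp
qed

lemma shooting_tendsto: "(\<lambda>k. shooting q z (Fs k)) \<longlonglongrightarrow> shooting q z F"
proof (rule LIM_zero_cancel, rule tendsto_norm_zero_cancel, rule tendsto_sandwich[OF _ _ tendsto_const deviation_at_1_tendsto])
  show "\<forall>\<^sub>F k in sequentially. norm (shooting q z (Fs k) - shooting q z F) \<le> (1 + B) * deviation (Fs k) F + K * \<bar>Fs k 1 - F 1\<bar>"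
    unfolding shooting_def by (intro always_eventually allI sturm_fun_dist Fs F) auto
qed simp

text \<open>The pointwise bound of \<open>resolvent_fun_dist\<close> contains |F_k(x) - F(x)|, so it
  is squared and integrated; it is the same for all \<open>g\<close> in the unit ball. It holds
  eventually, once the denominators exceed half of the limit.\<close>

lemma resolvent_fun_normL2_dist:
  assumes sh: "shooting q z F \<noteq> 0"
  obtains \<epsilon> where "\<epsilon> \<longlonglongrightarrow> 0"
    "\<forall>\<^sub>F k in sequentially. \<forall>g\<in>L2_space. normL2 g \<le> 1 \<longrightarrow> normL2 (\<lambda>x. resolvent_fun (Fs k) g x - resolvent_fun F g x) \<le> \<epsilon> k"
proof -
  define S \<sigma> where "S = (1 + B) * K" and "\<sigma> = norm (shooting q z F)"
  have \<sigma>0: "0 < \<sigma>" using sh by (simp add: \<sigma>_def)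
  define \<alpha> \<beta> where "\<alpha> = 1 + S / \<sigma>" and "\<beta> = 2 * S / \<sigma> + 2 * S\<^sup>2 / \<sigma>\<^sup>2"
  define e where "e k = \<alpha> * ((1 + B) * deviation (Fs k) F) + \<beta> * ((1 + B) * deviation (Fs k) F + K * \<bar>Fs k 1 - F 1\<bar>)" for k
  have "e \<longlonglongrightarrow> \<alpha> * ((1 + B) * 0) + \<beta> * 0"
    unfolding e_def by (intro tendsto_intros deviation_tendsto deviation_at_1_tendsto)
  then have e0: "e \<longlonglongrightarrow> 0" by simp
  \<comment> \<open>From (a + b)^2 \<le> 2 a^2 + 2 b^2, with \<open>e k\<close> the part of the
    bound that is constant in x and \<open>\<alpha> * K\<close> the coefficient of the pointwise
    difference.\<close>
  define m where "m k x = 2 * (e k)\<^sup>2 + 2 * (\<alpha> * K)\<^sup>2 * (Fs k x - F x)\<^sup>2" for k x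
  have mi: "m k integrable_on {0..1}" for k
    unfolding m_def by (intro integrable_add integrable_on_mult_right sq_diff_integrable integrable_const_ivl)
  have "integral {0..1} (m k) = 2 * (e k)\<^sup>2 + 2 * (\<alpha> * K)\<^sup>2 * integral {0..1} (\<lambda>t. (Fs k t - F t)\<^sup>2)" for k
    unfolding m_def
    by (subst Henstock_Kurzweil_Integration.integral_add) (auto intro!: integrable_on_mult_right sq_diff_integrable)
  then have "(\<lambda>k. integral {0..1} (m k)) \<longlonglongrightarrow> 2 * 0\<^sup>2 + 2 * (\<alpha> * K)\<^sup>2 * 0"
    by (simp only:) (intro tendsto_intros e0 sq_diff_tendsto)
  then have "(\<lambda>k. sqrt (integral {0..1} (m k))) \<longlonglongrightarrow> sqrt 0" by (intro tendsto_real_sqrt) simp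
  then have lim: "(\<lambda>k. sqrt (integral {0..1} (m k))) \<longlonglongrightarrow> 0" by simp
  have "(\<lambda>k. norm (shooting q z (Fs k))) \<longlonglongrightarrow> \<sigma>" unfolding \<sigma>_def by (intro tendsto_norm shooting_tendsto)
  then have ev: "\<forall>\<^sub>F k in sequentially. \<sigma> / 2 < norm (shooting q z (Fs k))"
    using \<sigma>0 by (intro order_tendstoD) auto
  show thesis
  proof (rule that[OF lim])
    show "\<forall>\<^sub>F k in sequentially. \<forall>g\<in>L2_space. normL2 g \<le> 1 \<longrightarrow>
        normL2 (\<lambda>x. resolvent_fun (Fs k) g x - resolvent_fun F g x) \<le> sqrt (integral {0..1} (m k))"
      using ev
    proof eventually_elim
      case (elim k)
      show ?case
      proof (intro ballI impI)
        fix g assume g: "g \<in> L2_space" "normL2 g \<le> 1"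
        have bm: "bounded_measurable (\<lambda>x. resolvent_fun (Fs k) g x - resolvent_fun F g x)"
          using bounded_measurable_add[OF resolvent_fun_bounded_measurable[OF Fs g(1)]
              bounded_measurable_uminus[OF resolvent_fun_bounded_measurable[OF F g(1)]]] by simp
        show "normL2 (\<lambda>x. resolvent_fun (Fs k) g x - resolvent_fun F g x) \<le> sqrt (integral {0..1} (m k))"
        proof (rule normL2_le[OF bounded_measurable_L2[OF bm] mi])
          fix x assume x: "x \<in> unit_ivl"
          have "norm (resolvent_fun (Fs k) g x - resolvent_fun F g x) \<le>
             \<alpha> * ((1 + B) * deviation (Fs k) F + K * \<bar>Fs k x - F x\<bar>) + \<beta> * ((1 + B) * deviation (Fs k) F + K * \<bar>Fs k 1 - F 1\<bar>)"
            unfolding \<alpha>_def \<beta>_def S_def \<sigma>_def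
            by (rule resolvent_fun_dist[OF Fs F g _ sh]) (use x elim in \<open>auto simp: \<sigma>_def\<close>)
          also have "\<dots> = e k + (\<alpha> * K) * \<bar>Fs k x - F x\<bar>" by (simp add: e_def algebra_simps)
          finally have "(norm (resolvent_fun (Fs k) g x - resolvent_fun F g x))\<^sup>2 \<le> (e k + (\<alpha> * K) * \<bar>Fs k x - F x\<bar>)\<^sup>2"
            by (intro power_mono) auto
          also have "\<dots> \<le> 2 * (e k)\<^sup>2 + 2 * ((\<alpha> * K) * \<bar>Fs k x - F x\<bar>)\<^sup>2"
          proof -
            have "0 \<le> (e k - (\<alpha> * K) * \<bar>Fs k x - F x\<bar>)\<^sup>2" by simp
            moreover have "(a + b)\<^sup>2 + (a - b)\<^sup>2 = 2 * a\<^sup>2 + 2 * b\<^sup>2" for a b :: real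
              by (simp add: power2_eq_square algebra_simps)
            ultimately show ?thesis by (metis add_increasing2 le_add_same_cancel1)
          qed
          also have "\<dots> = m k x" by (simp add: m_def power_mult_distrib)
          finally show "(norm (resolvent_fun (Fs k) g x - resolvent_fun F g x))\<^sup>2 \<le> m k x" .
        qed
      qed
    qed
  qed
qed

end

lemma dirichlet_resolvent_tendsto:
  assumes Ps: "\<And>k. finite_signed_measure (Ps k)" and P: "finite_signed_measure P"
    and Fs: "\<And>k. admissible (dist_fun (Ps k))" and F: "admissible (dist_fun P)"
    and L1: "(\<lambda>k. integral {0..1} (\<lambda>t. \<bar>dist_fun (Ps k) t - dist_fun P t\<bar>)) \<longlonglongrightarrow> 0"
    and at1: "(\<lambda>k. dist_fun (Ps k) 1) \<longlonglongrightarrow> dist_fun P 1"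
    and shs: "\<And>k. shooting q z (dist_fun (Ps k)) \<noteq> 0" and sh: "shooting q z (dist_fun P) \<noteq> 0"
  shows "(\<lambda>k. operator_norm (\<lambda>g x. resolvent (dirichlet q (Ps k)) z g x - resolvent (dirichlet q P) z g x)) \<longlonglongrightarrow> 0"
proof -
  obtain \<epsilon> where \<epsilon>: "\<epsilon> \<longlonglongrightarrow> 0"
    "\<forall>\<^sub>F k in sequentially. \<forall>g\<in>L2_space. normL2 g \<le> 1 \<longrightarrow>
       normL2 (\<lambda>x. resolvent_fun (dist_fun (Ps k)) g x - resolvent_fun (dist_fun P) g x) \<le> \<epsilon> k"
    using resolvent_fun_normL2_dist[OF Fs F L1 at1 sh] by blast
  let ?D = "\<lambda>k g x. resolvent (dirichlet q (Ps k)) z g x - resolvent (dirichlet q P) z g x"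
  let ?G = "{g \<in> L2_space. normL2 g \<le> 1}"
  \<comment> \<open>The resolvents are arbitrary choices from the graphs; they agree with the
    explicit solutions almost everywhere, which is all the norm sees.\<close>
  have eq: "normL2 (?D k g) = normL2 (\<lambda>x. resolvent_fun (dist_fun (Ps k)) g x - resolvent_fun (dist_fun P) g x)"
    if g: "g \<in> L2_space" for k g
  proof (rule normL2_cong_AE)
    note r = resolvent_AE[OF Ps Fs shs g, of k] resolvent_AE[OF P F sh g]
    show "AE x in lebesgue_on unit_ivl. ?D k g x = resolvent_fun (dist_fun (Ps k)) g x - resolvent_fun (dist_fun P) g x"
      using r(1,3) by eventually_elim simp
    show "?D k g \<in> borel_measurable (lebesgue_on unit_ivl)" using r(2,4) by (auto simp: L2_space_def)
    show "(\<lambda>x. resolvent_fun (dist_fun (Ps k)) g x - resolvent_fun (dist_fun P) g x) \<in> borel_measurable (lebesgue_on unit_ivl)"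
      using bounded_measurable_unit_ivl[OF resolvent_fun_bounded_measurable[OF Fs g, of k]]
        bounded_measurable_unit_ivl[OF resolvent_fun_bounded_measurable[OF F g]] by simp
  qed
  have zero: "(\<lambda>x. 0) \<in> ?G" by simp
  then have ne: "?G \<noteq> {}" by blast
  have "\<forall>\<^sub>F k in sequentially. 0 \<le> operator_norm (?D k) \<and> operator_norm (?D k) \<le> \<epsilon> k"
    using \<epsilon>(2)
  proof eventually_elim
    case (elim k)
    then have le: "normL2 (?D k g) \<le> \<epsilon> k" if "g \<in> ?G" for g using that eq by auto
    have "operator_norm (?D k) \<le> \<epsilon> k"
      unfolding operator_norm_def using le by (rule cSUP_least[OF ne])
    \<comment> \<open>The real supremum needs a set that is bounded above, which \<open>le\<close>
      supplies; the member g = 0 then shows that it is nonnegative.\<close>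
    moreover have "normL2 (?D k (\<lambda>x. 0)) \<le> operator_norm (?D k)"
      unfolding operator_norm_def using zero le by (intro cSUP_upper bdd_aboveI2[where M = "\<epsilon> k"]) auto
    ultimately show ?case using normL2_nonneg order_trans by blast
  qed
  then have "\<forall>\<^sub>F k in sequentially. 0 \<le> operator_norm (?D k)" "\<forall>\<^sub>F k in sequentially. operator_norm (?D k) \<le> \<epsilon> k"
    by (auto elim: eventually_mono)
  then show ?thesis by (rule tendsto_sandwich[OF _ _ tendsto_const \<epsilon>(1)])
qed

end

section \<open>The Pruefer angle\<close>

lemma abs_sin_diff_le: "\<bar>sin a - sin b\<bar> \<le> \<bar>a - b :: real\<bar>"
proof -
  have "\<bar>sin a - sin b\<bar> = 2 * \<bar>sin ((a - b) / 2)\<bar> * \<bar>cos ((a + b) / 2)\<bar>"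
    by (simp add: sin_diff_sin abs_mult)
  also have "\<dots> \<le> 2 * \<bar>(a - b) / 2\<bar> * 1"
    by (intro mult_mono abs_sin_x_le_abs_x) auto
  finally show ?thesis by simp
qed

lemma abs_cos_diff_le: "\<bar>cos a - cos b\<bar> \<le> \<bar>a - b :: real\<bar>"
  using abs_sin_diff_le[of "pi / 2 - a" "pi / 2 - b"] by (simp add: cos_sin_eq[of a] cos_sin_eq[of b] abs_minus_commute)

text \<open>In polar coordinates w = R sin phi, h = R cos phi this is (f / R)^2 for f = w + F h, so
  it vanishes exactly at the zeros of f.\<close>

definition pruefer_speed :: "(real \<Rightarrow> real) \<Rightarrow> real \<Rightarrow> real \<Rightarrow> real" where
  "pruefer_speed F t \<phi> = (sin \<phi> + F t * cos \<phi>)\<^sup>2"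

definition pruefer_angle :: "(real \<Rightarrow> real) \<Rightarrow> (real \<Rightarrow> real) \<Rightarrow> real \<Rightarrow> real \<Rightarrow> real" where
  "pruefer_angle q F l = (SOME \<phi>. \<phi> 0 = 0 \<and> is_primitive 0 1 (\<lambda>t. (l - q t) * pruefer_speed F t (\<phi> t)) \<phi>)"

lemma pruefer_speed_nonneg: "0 \<le> pruefer_speed F t \<phi>"
  by (simp add: pruefer_speed_def)

lemma abs_sin_add_cos_le:
  fixes c \<phi> :: real
  assumes "\<bar>c\<bar> \<le> B"
  shows "\<bar>sin \<phi> + c * cos \<phi>\<bar> \<le> 1 + B"
proof -
  have "\<bar>c * cos \<phi>\<bar> \<le> B * 1" unfolding abs_mult using assms by (intro mult_mono) auto
  moreover have "\<bar>sin \<phi>\<bar> \<le> 1" by simp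
  ultimately show ?thesis by linarith
qed

lemma pruefer_speed_le:
  assumes "\<bar>F t\<bar> \<le> B"
  shows "pruefer_speed F t \<phi> \<le> (1 + B)\<^sup>2"
  unfolding pruefer_speed_def using power_mono[OF abs_sin_add_cos_le[OF assms, of \<phi>], of 2] by simp

lemma pruefer_speed_diff_le:
  assumes "\<bar>F t\<bar> \<le> B" "\<bar>G t\<bar> \<le> B"
  shows "\<bar>pruefer_speed F t \<phi> - pruefer_speed G t \<psi>\<bar> \<le> 2 * (1 + B)\<^sup>2 * \<bar>\<phi> - \<psi>\<bar> + 2 * (1 + B) * \<bar>F t - G t\<bar>"
proof -
  have B: "0 \<le> B" using assms(1) by linarith
  let ?a = "sin \<phi> + F t * cos \<phi>" and ?b = "sin \<psi> + G t * cos \<psi>"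
  have "?a - ?b = (sin \<phi> - sin \<psi>) + (F t * (cos \<phi> - cos \<psi>) + (F t - G t) * cos \<psi>)"
    by (simp add: algebra_simps)
  also have "\<bar>\<dots>\<bar> \<le> \<bar>\<phi> - \<psi>\<bar> + (B * \<bar>\<phi> - \<psi>\<bar> + \<bar>F t - G t\<bar> * 1)"
  proof -
    have "\<bar>F t * (cos \<phi> - cos \<psi>)\<bar> \<le> B * \<bar>\<phi> - \<psi>\<bar>"
      unfolding abs_mult using B by (intro mult_mono assms abs_cos_diff_le) auto
    moreover have "\<bar>(F t - G t) * cos \<psi>\<bar> \<le> \<bar>F t - G t\<bar> * 1" unfolding abs_mult by (intro mult_mono) auto
    ultimately show ?thesis using abs_sin_diff_le[of \<phi> \<psi>] by linarith
  qed
  finally have d: "\<bar>?a - ?b\<bar> \<le> (1 + B) * \<bar>\<phi> - \<psi>\<bar> + \<bar>F t - G t\<bar>" by (simp add: algebra_simps)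
  have s: "\<bar>?a + ?b\<bar> \<le> 2 * (1 + B)"
    using order_trans[OF abs_triangle_ineq add_mono[OF abs_sin_add_cos_le[OF assms(1), of \<phi>] abs_sin_add_cos_le[OF assms(2), of \<psi>]]]
    by simp
  have "pruefer_speed F t \<phi> - pruefer_speed G t \<psi> = (?a - ?b) * (?a + ?b)"
    by (simp add: pruefer_speed_def power2_eq_square algebra_simps)
  then have "\<bar>pruefer_speed F t \<phi> - pruefer_speed G t \<psi>\<bar> = \<bar>?a - ?b\<bar> * \<bar>?a + ?b\<bar>" by (simp add: abs_mult)
  also have "\<dots> \<le> ((1 + B) * \<bar>\<phi> - \<psi>\<bar> + \<bar>F t - G t\<bar>) * (2 * (1 + B))"
    using B by (intro mult_mono d s) auto
  finally show ?thesis by (simp add: power2_eq_square algebra_simps)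
qed

lemma pruefer_speed_bounded_measurable:
  assumes F: "bounded_measurable F" and y: "continuous_on {0..1} y"
  shows "bounded_measurable (\<lambda>t. pruefer_speed F t (y t))"
proof -
  have "bounded_measurable (\<lambda>t. sin (y t) + F t * cos (y t))"
    by (intro bounded_measurable_add bounded_measurable_mult F bounded_measurable_continuous continuous_intros y)
  then show ?thesis unfolding pruefer_speed_def
    by (rule bounded_measurable_compose) (intro continuous_intros)
qed

lemma pruefer_rhs_absint:
  assumes "q absolutely_integrable_on {0..1}" "bounded_measurable F" "continuous_on {0..1} y"
  shows "(\<lambda>t. (l - q t) * pruefer_speed F t (y t)) absolutely_integrable_on {0..1}"
  by (intro absint_bounded_measurable_mult(2) pruefer_speed_bounded_measurable assms set_integral_diff(1)
      bounded_measurable_absint bounded_measurable_const)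

lemma pruefer_angle:
  assumes q: "q absolutely_integrable_on {0..1}" and F: "bounded_measurable F"
  shows "pruefer_angle q F l 0 = 0"
    and "is_primitive 0 1 (\<lambda>t. (l - q t) * pruefer_speed F t (pruefer_angle q F l t)) (pruefer_angle q F l)"
proof -
  obtain B where B: "B > 0" "\<And>x. x \<in> {0..1} \<Longrightarrow> norm (F x) \<le> B" using bounded_measurable_bound[OF F] by blast
  have lq: "(\<lambda>t. l - q t) absolutely_integrable_on {0..1}"
    by (intro set_integral_diff(1) q bounded_measurable_absint bounded_measurable_const)
  have "\<exists>\<phi>. \<phi> 0 = 0 \<and> is_primitive 0 1 (\<lambda>t. (l - q t) * pruefer_speed F t (\<phi> t)) \<phi>"
  proof (rule caratheodory_existence[where L = "\<lambda>t. 2 * (1 + B)\<^sup>2 * \<bar>l - q t\<bar>"])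
    show "(\<lambda>t. 2 * (1 + B)\<^sup>2 * \<bar>l - q t\<bar>) absolutely_integrable_on {0..1}"
      using absolutely_integrable_norm[OF lq] by (intro set_integrable_mult_right) (simp add: o_def)
    show "norm ((l - q t) * pruefer_speed F t u - (l - q t) * pruefer_speed F t v) \<le> 2 * (1 + B)\<^sup>2 * \<bar>l - q t\<bar> * norm (u - v)"
      if "t \<in> {0..1}" for t u v
      using mult_left_mono[OF pruefer_speed_diff_le[of F t B F u v], of "\<bar>l - q t\<bar>"] B(2)[OF that]
      by (simp add: right_diff_distrib[symmetric] abs_mult mult.commute mult.left_commute)
  qed (use pruefer_rhs_absint[OF q F] in auto)
  from someI_ex[OF this]
  show "pruefer_angle q F l 0 = 0"
    "is_primitive 0 1 (\<lambda>t. (l - q t) * pruefer_speed F t (pruefer_angle q F l t)) (pruefer_angle q F l)"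
    by (simp_all only: pruefer_angle_def)
qed

text \<open>One estimate for two purposes: \<open>F = G\<close> gives continuity in the spectral
  parameter, \<open>l = m\<close> continuity in the distribution function.\<close>

lemma pruefer_angle_dist:
  assumes q: "q absolutely_integrable_on {0..1}"
    and F: "bounded_measurable F" "\<And>t. t \<in> {0..1} \<Longrightarrow> \<bar>F t\<bar> \<le> B"
    and G: "bounded_measurable G" "\<And>t. t \<in> {0..1} \<Longrightarrow> \<bar>G t\<bar> \<le> B"
  shows "\<bar>pruefer_angle q F l 1 - pruefer_angle q G m 1\<bar> \<le>
    (2 * (1 + B) * integral {0..1} (\<lambda>t. \<bar>F t - G t\<bar> * (\<bar>l\<bar> + \<bar>q t\<bar>)) + (1 + B)\<^sup>2 * \<bar>l - m\<bar>)
      * exp (integral {0..1} (\<lambda>t. 2 * (1 + B)\<^sup>2 * (\<bar>l\<bar> + \<bar>q t\<bar>)))"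
proof -
  let ?f = "pruefer_angle q F l" and ?g = "pruefer_angle q G m"
  note f = pruefer_angle[OF q F(1), of l] and g = pruefer_angle[OF q G(1), of m]
  have B: "0 \<le> B" using F(2)[of 0] by auto
  define L where "L t = 2 * (1 + B)\<^sup>2 * (\<bar>l\<bar> + \<bar>q t\<bar>)" for t
  define r where "r t = 2 * (1 + B) * (\<bar>F t - G t\<bar> * (\<bar>l\<bar> + \<bar>q t\<bar>)) + (1 + B)\<^sup>2 * \<bar>l - m\<bar>" for t
  define p where "p t = (l - q t) * pruefer_speed F t (?f t) - (m - q t) * pruefer_speed G t (?g t)" for t
  have d: "is_primitive 0 1 p (\<lambda>t. ?f t - ?g t)"
    unfolding p_def by (rule is_primitive_diff_fun[OF f(2) g(2)])
  have qa: "(\<lambda>t. \<bar>l\<bar> + \<bar>q t\<bar>) absolutely_integrable_on {0..1}"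
    using set_integral_add(1)[OF bounded_measurable_absint[OF bounded_measurable_const] absolutely_integrable_norm[OF q]]
    by (simp add: o_def)
  have La: "L absolutely_integrable_on {0..1}" unfolding L_def by (intro set_integrable_mult_right qa)
  have "bounded_measurable (\<lambda>t. F t - G t)"
    using bounded_measurable_add[OF F(1) bounded_measurable_uminus[OF G(1)]] by simp
  then have "bounded_measurable (\<lambda>t. \<bar>F t - G t\<bar>)" by (rule bounded_measurable_compose) (intro continuous_intros)
  then have FGq: "(\<lambda>t. \<bar>F t - G t\<bar> * (\<bar>l\<bar> + \<bar>q t\<bar>)) absolutely_integrable_on {0..1}"
    by (intro absint_bounded_measurable_mult(1) qa)
  have ra: "r absolutely_integrable_on {0..1}"
    unfolding r_def by (intro set_integral_add(1) set_integrable_mult_right FGq bounded_measurable_absint bounded_measurable_const)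
  \<comment> \<open>\<open>pair_gronwall\<close> concerns pairs of complex functions; the real
    difference of angles is embedded with zero second component.\<close>
  have "norm (complex_of_real (?f 1 - ?g 1)) + norm (0 :: complex)
     \<le> (norm (complex_of_real (?f 0 - ?g 0)) + norm (0 :: complex) + integral {0..1} r) * exp (integral {0..1} L)"
  proof (rule pair_gronwall[where pw = "\<lambda>t. complex_of_real (p t)" and w = "\<lambda>t. complex_of_real (?f t - ?g t)"
        and ph = "\<lambda>t. 0" and h = "\<lambda>t. 0"])
    show "is_primitive 0 1 (\<lambda>t. complex_of_real (p t)) (\<lambda>t. complex_of_real (?f t - ?g t))"
      by (rule is_primitive_linear[OF d bounded_linear_of_real])
    show "is_primitive 0 1 (\<lambda>t. 0 :: complex) (\<lambda>t. 0)" by (rule is_primitive_const)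
    show "0 \<le> L t" "0 \<le> r t" for t using B by (simp_all add: L_def r_def)
    fix t :: real assume t: "t \<in> {0..1}"
    have "p t = (l - q t) * (pruefer_speed F t (?f t) - pruefer_speed G t (?g t)) + (l - m) * pruefer_speed G t (?g t)"
      by (simp add: p_def algebra_simps)
    then have "\<bar>p t\<bar> \<le> \<bar>l - q t\<bar> * \<bar>pruefer_speed F t (?f t) - pruefer_speed G t (?g t)\<bar> + \<bar>l - m\<bar> * \<bar>pruefer_speed G t (?g t)\<bar>"
      by (metis abs_mult abs_triangle_ineq)
    also have "\<dots> \<le> (\<bar>l\<bar> + \<bar>q t\<bar>) * (2 * (1 + B)\<^sup>2 * \<bar>?f t - ?g t\<bar> + 2 * (1 + B) * \<bar>F t - G t\<bar>) + \<bar>l - m\<bar> * (1 + B)\<^sup>2"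
    proof (intro add_mono mult_mono pruefer_speed_diff_le F(2) G(2) t)
      show "\<bar>pruefer_speed G t (?g t)\<bar> \<le> (1 + B)\<^sup>2"
        using pruefer_speed_le[of G t B] pruefer_speed_nonneg G(2)[OF t] by simp
    qed auto
    also have "\<dots> = L t * \<bar>?f t - ?g t\<bar> + r t" by (simp add: L_def r_def algebra_simps)
    finally show "norm (complex_of_real (p t)) + norm (0 :: complex) \<le> L t * (norm (complex_of_real (?f t - ?g t)) + norm (0 :: complex)) + r t"
      by (simp flip: of_real_diff)
  qed (use La ra in auto)
  moreover have "integral {0..1} r = 2 * (1 + B) * integral {0..1} (\<lambda>t. \<bar>F t - G t\<bar> * (\<bar>l\<bar> + \<bar>q t\<bar>)) + (1 + B)\<^sup>2 * \<bar>l - m\<bar>"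
    unfolding r_def using FGq
    by (subst Henstock_Kurzweil_Integration.integral_add) (auto intro!: integrable_on_mult_right simp: absolutely_integrable_on_def)
  ultimately show ?thesis using f(1) g(1) by (simp add: L_def[abs_def] flip: of_real_diff)
qed

lemma pruefer_angle_isCont:
  assumes "q absolutely_integrable_on {0..1}" "bounded_measurable F"
  shows "isCont (\<lambda>l. pruefer_angle q F l 1) l"
proof -
  obtain B where B: "B > 0" "\<And>x. x \<in> {0..1} \<Longrightarrow> norm (F x) \<le> B" using bounded_measurable_bound[OF assms(2)] by blast
  define E where "E = exp (integral {0..1} (\<lambda>t. 2 * (1 + B)\<^sup>2 * (\<bar>l\<bar> + \<bar>q t\<bar>)))"
  have le: "\<bar>pruefer_angle q F m 1 - pruefer_angle q F l 1\<bar> \<le> (1 + B)\<^sup>2 * \<bar>l - m\<bar> * E" for m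
    using pruefer_angle_dist[OF assms(1,2) _ assms(2), of B l m] B by (simp add: E_def abs_minus_commute)
  have "((\<lambda>m. (1 + B)\<^sup>2 * \<bar>l - m\<bar> * E) \<longlongrightarrow> (1 + B)\<^sup>2 * \<bar>l - l\<bar> * E) (at l)" by (intro tendsto_intros)
  then have lim: "((\<lambda>m. (1 + B)\<^sup>2 * \<bar>l - m\<bar> * E) \<longlongrightarrow> 0) (at l)" by simp
  have "((\<lambda>m. pruefer_angle q F m 1 - pruefer_angle q F l 1) \<longlongrightarrow> 0) (at l)"
    by (rule Lim_null_comparison[OF always_eventually lim]) (use le in simp)
  then show ?thesis unfolding isCont_def by (rule LIM_zero_cancel)
qed

lemma pruefer_angle_tendsto:
  assumes q: "q absolutely_integrable_on {0..1}"
    and F: "bounded_measurable F" "\<And>t. t \<in> {0..1} \<Longrightarrow> \<bar>F t\<bar> \<le> B"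
    and Fs: "\<And>k. bounded_measurable (Fs k)" "\<And>k t. t \<in> {0..1} \<Longrightarrow> \<bar>Fs k t\<bar> \<le> B"
    and L1: "(\<lambda>k. integral {0..1} (\<lambda>t. \<bar>Fs k t - F t\<bar>)) \<longlonglongrightarrow> 0"
  shows "(\<lambda>k. pruefer_angle q (Fs k) l 1) \<longlonglongrightarrow> pruefer_angle q F l 1"
proof -
  let ?E = "exp (integral {0..1} (\<lambda>t. 2 * (1 + B)\<^sup>2 * (\<bar>l\<bar> + \<bar>q t\<bar>)))"
  have qa: "(\<lambda>t. \<bar>l\<bar> + \<bar>q t\<bar>) absolutely_integrable_on {0..1}"
    using set_integral_add(1)[OF bounded_measurable_absint[OF bounded_measurable_const] absolutely_integrable_norm[OF q]]
    by (simp add: o_def)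
  have "(\<lambda>k. integral {0..1} (\<lambda>t. \<bar>Fs k t - F t\<bar> * (\<bar>l\<bar> + \<bar>q t\<bar>))) \<longlonglongrightarrow> 0"
  proof (rule weighted_L1_tendsto[OF _ _ _ L1 qa])
    show "bounded_measurable (\<lambda>t. \<bar>Fs k t - F t\<bar>)" for k
    proof -
      have "bounded_measurable (\<lambda>t. Fs k t - F t)"
        using bounded_measurable_add[OF Fs(1) bounded_measurable_uminus[OF F(1)]] by simp
      then show ?thesis by (rule bounded_measurable_compose) (intro continuous_intros)
    qed
    show "\<bar>Fs k x - F x\<bar> \<le> 2 * B" if "x \<in> {0..1}" for k x using F(2)[OF that] Fs(2)[OF that, of k] by linarith
  qed auto
  then have "(\<lambda>k. 2 * (1 + B) * integral {0..1} (\<lambda>t. \<bar>Fs k t - F t\<bar> * (\<bar>l\<bar> + \<bar>q t\<bar>)) * ?E) \<longlonglongrightarrow> 2 * (1 + B) * 0 * ?E"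
    by (intro tendsto_intros)
  then have lim: "(\<lambda>k. 2 * (1 + B) * integral {0..1} (\<lambda>t. \<bar>Fs k t - F t\<bar> * (\<bar>l\<bar> + \<bar>q t\<bar>)) * ?E) \<longlonglongrightarrow> 0" by simp
  have "(\<lambda>k. pruefer_angle q (Fs k) l 1 - pruefer_angle q F l 1) \<longlonglongrightarrow> 0"
    by (rule Lim_null_comparison[OF always_eventually lim])
      (use pruefer_angle_dist[OF q Fs F, where l = l and m = l] in simp)
  then show ?thesis by (rule LIM_zero_cancel)
qed

lemma not_negligible_Icc: "\<not> negligible {0..1::real}"
  by (simp add: negligible_iff_null_sets null_sets_def)

text \<open>What nonnegative measures provide. \<open>F_growth\<close> says that F increases at
  least as fast as the Lebesgue part dx of dP; it makes arctan F strictly increasing and F nonzero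
  on (0,1].\<close>

locale pruefer =
  fixes q F :: "real \<Rightarrow> real" and B :: real
  assumes q: "q absolutely_integrable_on {0..1}"
    and F: "bounded_measurable F" and F_le: "\<And>t. t \<in> {0..1} \<Longrightarrow> \<bar>F t\<bar> \<le> B"
    and F_0: "F 0 = 0" and F_growth: "\<And>x y. 0 \<le> x \<Longrightarrow> x \<le> y \<Longrightarrow> y \<le> 1 \<Longrightarrow> y - x \<le> F y - F x"
    and F_left: "\<And>x. 0 < x \<Longrightarrow> x \<le> 1 \<Longrightarrow> (F \<longlongrightarrow> F x) (at_left x)"
begin

abbreviation angle :: "real \<Rightarrow> real \<Rightarrow> real" where "angle \<equiv> pruefer_angle q F"

abbreviation speed :: "real \<Rightarrow> real \<Rightarrow> real" where "speed \<equiv> pruefer_speed F"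

lemma B_nonneg: "0 \<le> B" using F_le[of 0] by auto

lemmas angle_0 = pruefer_angle(1)[OF q F] and angle_primitive = pruefer_angle(2)[OF q F]

lemma angle_continuous: "continuous_on {0..1} (angle l)"
  by (rule is_primitive_continuous[OF angle_primitive])

lemma speed_le: "t \<in> {0..1} \<Longrightarrow> speed t \<phi> \<le> (1 + B)\<^sup>2"
  using pruefer_speed_le[of F t B \<phi>] F_le by simp

lemma F_ge: "x \<in> {0..1} \<Longrightarrow> x \<le> F x"
  using F_growth[of 0 x] F_0 by auto

text \<open>Zero speed almost everywhere would freeze the angle at 0, where the speed is
  \<open>(F t)\<^sup>2\<close>; but F t is at least t.\<close>

lemma speed_angle_not_null:
  assumes N: "negligible N" and zero: "\<And>t. t \<in> {0..1} - N \<Longrightarrow> speed t (angle l t) = 0"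
  shows False
proof -
  have "is_primitive 0 1 (\<lambda>t. 0) (angle l)"
    by (rule is_primitive_spike[OF angle_primitive N]) (simp add: zero)
  then have "angle l t = 0" if "t \<in> {0..1}" for t
    using is_primitive_eq[of 0 1 "\<lambda>t. 0" "angle l" t] angle_0 that by auto
  then have "F t = 0" if "t \<in> {0..1} - N" for t
    using zero[OF that] that by (simp add: pruefer_speed_def)
  then have "t = 0" if "t \<in> {0..1} - N" for t using F_ge[of t] that by force
  then have "{0..1} \<subseteq> insert 0 N" by blast
  then have "negligible {0..1::real}" using N by (meson negligible_insert negligible_subset)
  then show False using not_negligible_Icc by simp
qed

text \<open>The difference quotient of the speed with respect to the angle is a bounded measurable
  coefficient, so the difference of two angles satisfies a linear equation to which the comparison
  lemma applies.\<close>

lemma angle_diff_linear: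
  assumes "l \<le> m"
  obtains k where "k absolutely_integrable_on {0..1}"
    "is_primitive 0 1 (\<lambda>t. k t * (angle m t - angle l t) + (m - l) * speed t (angle m t)) (\<lambda>t. angle m t - angle l t)"
proof -
  \<comment> \<open>Where the angles coincide, division by zero gives 0, consistent with
    \<open>Qeq\<close>, whose right-hand side vanishes there.\<close>
  define Q where "Q t = (speed t (angle m t) - speed t (angle l t)) / (angle m t - angle l t)" for t
  have sm: "bounded_measurable (\<lambda>t. speed t (angle x t))" for x
    by (rule pruefer_speed_bounded_measurable[OF F angle_continuous])
  have Qb: "bounded_measurable Q"
  proof (rule bounded_measurableI)
    have "(\<lambda>t. speed t (angle x t)) \<in> borel_measurable (lebesgue_on {0..1})"
      "angle x \<in> borel_measurable (lebesgue_on {0..1})" for x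
      using bounded_measurableD[OF sm] bounded_measurableD[OF bounded_measurable_continuous[OF angle_continuous]] by auto
    then show "Q \<in> borel_measurable (lebesgue_on {0..1})"
      unfolding Q_def by (intro borel_measurable_divide borel_measurable_diff)
    show "norm (Q t) \<le> 2 * (1 + B)\<^sup>2" if "t \<in> {0..1}" for t
      using pruefer_speed_diff_le[of F t B F "angle m t" "angle l t"] F_le[OF that] B_nonneg
      by (cases "angle m t = angle l t") (auto simp: Q_def abs_divide divide_le_eq)
  qed
  have Qeq: "Q t * (angle m t - angle l t) = speed t (angle m t) - speed t (angle l t)" for t
    by (simp add: Q_def)
  show thesis
  proof (rule that)
    show "(\<lambda>t. (l - q t) * Q t) absolutely_integrable_on {0..1}"
      by (intro absint_bounded_measurable_mult(2) Qb set_integral_diff(1) q bounded_measurable_absint bounded_measurable_const)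
    show "is_primitive 0 1 (\<lambda>t. (l - q t) * Q t * (angle m t - angle l t) + (m - l) * speed t (angle m t)) (\<lambda>t. angle m t - angle l t)"
    proof (rule is_primitive_cong[OF is_primitive_diff_fun[OF angle_primitive angle_primitive]])
      show "(m - q t) * speed t (angle m t) - (l - q t) * speed t (angle l t) =
          (l - q t) * Q t * (angle m t - angle l t) + (m - l) * speed t (angle m t)" for t
        unfolding mult.assoc Qeq by (simp add: algebra_simps)
    qed simp
  qed
qed

lemma angle_mono:
  assumes "l \<le> m" "x \<in> {0..1}"
  shows "angle l x \<le> angle m x"
proof -
  obtain k where k: "k absolutely_integrable_on {0..1}"
    "is_primitive 0 1 (\<lambda>t. k t * (angle m t - angle l t) + (m - l) * speed t (angle m t)) (\<lambda>t. angle m t - angle l t)"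
    using angle_diff_linear[OF assms(1)] by blast
  have "exp (integral {0..x} k) * (angle m 0 - angle l 0) \<le> angle m x - angle l x"
    using assms by (intro linear_ode_lower_bound[OF k(2,1)]) (auto simp: pruefer_speed_nonneg)
  then show ?thesis by (simp add: angle_0)
qed

text \<open>Equal end values force the nonnegative inhomogeneity to vanish almost everywhere, which
  \<open>speed_angle_not_null\<close> excludes.\<close>

lemma angle_strict_mono:
  assumes "l < m"
  shows "angle l 1 < angle m 1"
proof (rule ccontr)
  assume "\<not> ?thesis"
  then have e: "angle m 1 = angle l 1" using angle_mono[of l m 1] assms by simp
  obtain k where k: "k absolutely_integrable_on {0..1}"
    "is_primitive 0 1 (\<lambda>t. k t * (angle m t - angle l t) + (m - l) * speed t (angle m t)) (\<lambda>t. angle m t - angle l t)"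
    using angle_diff_linear[of l m] assms by auto
  let ?p = "\<lambda>t. exp (- integral {0..t} k) * ((m - l) * speed t (angle m t))"
  note v = variation_of_constants[OF k(2,1)]
  have "integral {0..1} ?p = 0"
    using is_primitive_eq[OF v, of 1] by (simp add: e angle_0)
  moreover have "0 \<le> ?p t" for t using assms by (simp add: pruefer_speed_nonneg)
  ultimately obtain N where N: "negligible N" "\<And>t. t \<in> {0..1} - N \<Longrightarrow> ?p t = 0"
    using integral_zero_imp_negligible[OF is_primitive_absint[OF v]] by blast
  then have "speed t (angle m t) = 0" if "t \<in> {0..1} - N" for t
    using N(2)[OF that] assms by simp
  then show False using speed_angle_not_null[OF N(1)] by blast
qed

text \<open>The zeros of f correspond to angles equal to - arctan F modulo pi, so it is
  \<open>angle l t + shift t\<close> that is compared with multiples of pi.\<close>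

definition shift :: "real \<Rightarrow> real" where "shift x = arctan (F x)"

lemma shift_mono: "0 \<le> x \<Longrightarrow> x \<le> y \<Longrightarrow> y \<le> 1 \<Longrightarrow> shift x \<le> shift y"
  unfolding shift_def using F_growth[of x y] by (intro arctan_monotone') simp

lemma shift_strict_mono: "0 \<le> x \<Longrightarrow> x < y \<Longrightarrow> y \<le> 1 \<Longrightarrow> shift x < shift y"
  unfolding shift_def using F_growth[of x y] by (intro arctan_monotone) simp

lemma shift_0: "shift 0 = 0" by (simp add: shift_def F_0)

lemma shift_lt: "shift x < pi / 2" using arctan_ubound[of "F x"] by (simp add: shift_def)

lemma speed_eq: "speed t \<phi> = (1 + (F t)\<^sup>2) * (sin (\<phi> + shift t))\<^sup>2"
proof -
  have "sin (\<phi> + shift t) = (sin \<phi> + F t * cos \<phi>) / sqrt (1 + (F t)\<^sup>2)"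
    by (simp add: sin_add shift_def sin_arctan cos_arctan add_divide_distrib)
  then have "(sin (\<phi> + shift t))\<^sup>2 = (sin \<phi> + F t * cos \<phi>)\<^sup>2 / (1 + (F t)\<^sup>2)"
    by (simp add: power_divide)
  moreover have "1 + (F t)\<^sup>2 \<noteq> 0" by (metis add_pos_nonneg less_irrefl zero_le_power2 zero_less_one)
  ultimately show ?thesis by (simp add: pruefer_speed_def)
qed

text \<open>Growth coefficient in |phi'| \<le> c |phi + arctan F|, obtained from 1 + F^2 \<le> 1 +
  B^2 and sin^2 x \<le> |x|.\<close>

definition c :: "real \<Rightarrow> real \<Rightarrow> real" where "c l t = (1 + B\<^sup>2) * (\<bar>l\<bar> + \<bar>q t\<bar>)"

lemma c_absint: "c l absolutely_integrable_on {0..1}"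
  using set_integral_add(1)[OF bounded_measurable_absint[OF bounded_measurable_const] absolutely_integrable_norm[OF q]]
  unfolding c_def by (intro set_integrable_mult_right) (simp add: o_def)

lemma c_nonneg: "0 \<le> c l t"
  by (simp add: c_def)

lemma rhs_le:
  assumes "t \<in> {0..1}"
  shows "\<bar>(l - q t) * speed t \<phi>\<bar> \<le> c l t * \<bar>\<phi> + shift t\<bar>"
proof -
  let ?s = "sin (\<phi> + shift t)"
  have "?s\<^sup>2 = \<bar>?s\<bar> * \<bar>?s\<bar>" by (simp add: power2_eq_square)
  also have "\<dots> \<le> 1 * \<bar>\<phi> + shift t\<bar>" by (intro mult_mono abs_sin_x_le_abs_x) auto
  finally have s: "?s\<^sup>2 \<le> \<bar>\<phi> + shift t\<bar>" by simp
  have "(F t)\<^sup>2 \<le> B\<^sup>2" using F_le[OF assms] by (metis abs_le_square_iff abs_of_nonneg B_nonneg)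
  then have "speed t \<phi> \<le> (1 + B\<^sup>2) * \<bar>\<phi> + shift t\<bar>"
    unfolding speed_eq using s by (intro mult_mono) auto
  then have "\<bar>l - q t\<bar> * speed t \<phi> \<le> (\<bar>l\<bar> + \<bar>q t\<bar>) * ((1 + B\<^sup>2) * \<bar>\<phi> + shift t\<bar>)"
    by (intro mult_mono) (auto simp: pruefer_speed_nonneg)
  moreover have "\<bar>(l - q t) * speed t \<phi>\<bar> = \<bar>l - q t\<bar> * speed t \<phi>"
    by (simp add: abs_mult pruefer_speed_nonneg)
  ultimately show ?thesis by (simp add: c_def mult_ac)
qed

text \<open>The curve \<open>- arctan F\<close> of zeros of the fundamental solution is crossed upwards only: at the last
  point where \<open>angle + shift \<ge> 0\<close>, Gronwall's inequality applies to the negative part.\<close>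

lemma angle_shift_nonneg:
  assumes y: "y \<in> {0..1}"
  shows "0 \<le> angle l y + shift y"
proof (rule ccontr)
  define u where "u x = angle l x + shift x" for x
  assume "\<not> ?thesis"
  then have uy: "u y < 0" by (simp add: u_def)
  define A where "A = {x \<in> {0..y}. 0 \<le> u x}"
  define s where "s = Sup A"
  have A0: "0 \<in> A" using y by (auto simp: A_def u_def angle_0 shift_0)
  have bdd: "bdd_above A" by (auto simp: A_def intro!: bdd_aboveI[of _ y])
  have s: "0 \<le> s" "s \<le> y"
    using A0 bdd by (auto simp: s_def A_def intro: cSup_upper2 cSup_least)
  \<comment> \<open>The supremum belongs to \<open>A\<close>: \<open>u\<close> is left-continuous,
    so \<open>u s < 0\<close> would persist on an interval to the left of \<open>s\<close>.\<close>
  have us: "0 \<le> u s"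
  proof (rule ccontr)
    assume neg: "\<not> 0 \<le> u s"
    then have "s \<notin> A" by (simp add: A_def)
    then have s0: "0 < s" using s A0 by (cases "s = 0") auto
    have "continuous_on {0..s} (angle l)" using angle_continuous by (rule continuous_on_subset) (use s y in auto)
    then have "(angle l \<longlongrightarrow> angle l s) (at_left s)" using s0 by (rule continuous_on_Icc_at_leftD)
    moreover have "(shift \<longlongrightarrow> shift s) (at_left s)"
      unfolding shift_def using s0 s y by (intro tendsto_arctan F_left) auto
    ultimately have "(u \<longlongrightarrow> u s) (at_left s)" unfolding u_def by (rule tendsto_add)
    then have "\<forall>\<^sub>F x in at_left s. u x < 0" using neg by (intro order_tendstoD) auto
    then obtain b where b: "b < s" "\<And>x. b < x \<Longrightarrow> x < s \<Longrightarrow> u x < 0" by (auto simp: eventually_at_left_field)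
    obtain x where "x \<in> A" "b < x" using less_cSupD[of A b] A0 b(1) unfolding s_def by blast
    moreover have "x \<le> s" unfolding s_def by (rule cSup_upper[OF \<open>x \<in> A\<close> bdd])
    ultimately show False using b(2)[of x] \<open>s \<notin> A\<close> by (cases "x = s") (auto simp: A_def)
  qed
  have neg: "u x < 0" if "s < x" "x \<le> y" for x
  proof (rule ccontr)
    assume "\<not> u x < 0"
    then have "x \<in> A" using that s by (auto simp: A_def)
    then have "x \<le> s" unfolding s_def by (rule cSup_upper[OF _ bdd])
    then show False using that by simp
  qed
  \<comment> \<open>The negative part may jump with F, so it is merely bounded and measurable; this
    is enough for \<open>gronwall\<close>.\<close>
  define v where "v x = max (- u x) 0" for x
  have vb: "bounded_measurable v"
  proof -
    have "bounded_measurable u" unfolding u_def shift_def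
      by (intro bounded_measurable_add bounded_measurable_continuous[OF angle_continuous] bounded_measurable_compose[OF F] continuous_intros)
    then show ?thesis unfolding v_def by (rule bounded_measurable_compose) (intro continuous_intros)
  qed
  have cv: "(\<lambda>t. c l t * v t) absolutely_integrable_on {0..1}"
    by (rule absint_bounded_measurable_mult(2)[OF vb c_absint])
  have sub: "f absolutely_integrable_on {s..y}" if "f absolutely_integrable_on {0..1}" for f :: "real \<Rightarrow> real"
    by (rule absolutely_integrable_on_subinterval_real[OF that]) (use s y in auto)
  have "v y \<le> 0 * exp (integral {s..y} (c l))"
  proof (rule gronwall[OF sub[OF c_absint] c_nonneg sub[OF cv]])
    show "y \<in> {s..y}" using s by simp
    fix x assume x: "x \<in> {s..y}"
    show "v x \<le> 0 + integral {s..x} (\<lambda>t. c l t * v t)"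
    proof (cases "x = s")
      case True then show ?thesis using us by (simp add: v_def)
    next
      case False
      let ?p = "\<lambda>t. (l - q t) * speed t (angle l t)"
      have sx: "0 \<le> s" "s \<le> x" "x \<le> 1" using x s y by auto
      have "v x = - u x" using neg[of x] x False by (simp add: v_def)
      \<comment> \<open>Upward jumps of arctan F only help: \<open>shift x\<close> is at least
        \<open>shift s\<close>.\<close>
      also have "\<dots> \<le> - (angle l x - angle l s) - u s"
        using shift_mono[OF sx] by (simp add: u_def)
      also have "\<dots> \<le> - integral {s..x} ?p"
        using us is_primitive_diff[OF angle_primitive sx] by simp
      also have "\<dots> \<le> norm (integral {s..x} ?p)" by simp
      \<comment> \<open>At \<open>s\<close> itself \<open>u\<close> may be positive and the bound by
        \<open>v\<close> may fail, so the integrand is changed at this point.\<close>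
      also have "\<dots> = norm (integral {s..x} (\<lambda>t. if t = s then 0 else ?p t))"
        by (intro arg_cong[where f = norm] integral_spike[of "{s}"]) auto
      also have "\<dots> \<le> 1 * integral {s..x} (\<lambda>t. c l t * v t)"
      proof (rule norm_integral_le_mult)
        have "?p integrable_on {s..x}"
          by (rule integrable_on_subinterval_real[OF is_primitive_absint[OF angle_primitive]]) (use sx in auto)
        then show "(\<lambda>t. if t = s then 0 else ?p t) integrable_on {s..x}"
          by (rule integrable_spike[of _ _ "{s}"]) auto
        show "(\<lambda>t. c l t * v t) integrable_on {s..x}"
          by (rule integrable_on_subinterval_real[OF cv]) (use sx in auto)
        fix t assume t: "t \<in> {s..x}"
        show "norm (if t = s then 0 else ?p t) \<le> 1 * (c l t * v t)"
        proof (cases "t = s")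
          case True then show ?thesis by (simp add: c_nonneg v_def)
        next
          case False
          then have "u t < 0" using neg[of t] t x by auto
          then have "\<bar>angle l t + shift t\<bar> = v t" by (simp add: v_def u_def)
          then show ?thesis using rhs_le[of t l "angle l t"] t sx False by simp
        qed
      qed
      finally show ?thesis by simp
    qed
  qed
  then show False using uy by (simp add: v_def)
qed

text \<open>With the constant \<open>shift 1\<close> in place of \<open>shift t\<close> the function
  \<open>d\<close> is absolutely continuous, and |phi'| \<le> c d because 0 \<le> phi + shift t
  \<le> d. Thus d' \<ge> - c d, and \<open>d\<close> stays positive from its initial value
  \<open>shift 1\<close>.\<close>

lemma angle_shift_pos: "0 < angle l 1 + shift 1"
proof -
  define d where "d x = angle l x + shift 1" for x
  define r where "r t = (l - q t) * speed t (angle l t) + c l t * d t" for t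
  have "is_primitive 0 1 (\<lambda>t. (l - q t) * speed t (angle l t) + 0) d"
    unfolding d_def by (rule is_primitive_add[OF angle_primitive is_primitive_const])
  then have d: "is_primitive 0 1 (\<lambda>t. (- c l t) * d t + r t) d"
    by (rule is_primitive_cong) (auto simp: r_def)
  have k: "(\<lambda>t. - c l t) absolutely_integrable_on {0..1}"
    using absolutely_integrable_linear[OF c_absint bounded_linear_minus[OF bounded_linear_ident]] by (simp add: o_def)
  have "exp (integral {0..1} (\<lambda>t. - c l t)) * d 0 \<le> d 1"
  proof (rule linear_ode_lower_bound[OF d k])
    fix t :: real assume t: "t \<in> {0..1}"
    have "\<bar>angle l t + shift t\<bar> \<le> d t"
      using angle_shift_nonneg[OF t, of l] shift_mono[of t 1] t by (simp add: d_def)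
    then have "\<bar>(l - q t) * speed t (angle l t)\<bar> \<le> c l t * d t"
      using order_trans[OF rhs_le[OF t] mult_left_mono[OF _ c_nonneg]] by blast
    then show "0 \<le> r t" by (simp add: r_def)
  qed auto
  moreover have "0 < d 0" using shift_strict_mono[of 0 1] by (simp add: d_def angle_0 shift_0)
  ultimately show ?thesis unfolding d_def using exp_gt_zero by (smt (verit) mult_pos_pos)
qed

text \<open>For \<open>l = - n\<close> the angle grows at most by the integrated excess of |q| over
  n times the maximal speed; \<open>pi / 2\<close> suffices since arctan F < pi / 2. This yields a
  parameter below the first eigenvalue.\<close>

lemma angle_small: "\<exists>l. angle l 1 < pi - shift 1"
proof -
  have qn: "(\<lambda>t. \<bar>q t\<bar>) absolutely_integrable_on {0..1}"
    using absolutely_integrable_norm[OF q] by (simp add: o_def)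
  let ?T = "\<lambda>n t. max (\<bar>q t\<bar> - real n) 0"
  have "(\<lambda>n. integral {0..1} (?T n)) \<longlonglongrightarrow> 0"
    by (rule truncated_integral_tendsto(2)[OF qn]) simp
  then have "(\<lambda>n. (1 + B)\<^sup>2 * integral {0..1} (?T n)) \<longlonglongrightarrow> (1 + B)\<^sup>2 * 0" by (intro tendsto_intros)
  then have "\<forall>\<^sub>F n in sequentially. (1 + B)\<^sup>2 * integral {0..1} (?T n) < pi / 2"
    by (intro order_tendstoD) auto
  then obtain n where n: "(1 + B)\<^sup>2 * integral {0..1} (?T n) < pi / 2"
    by (auto simp: eventually_sequentially)
  let ?l = "- real n"
  have Ti: "?T n integrable_on {0..1}" by (rule truncated_integral_tendsto(1)[OF qn]) simp
  have "angle ?l 1 = integral {0..1} (\<lambda>t. (?l - q t) * speed t (angle ?l t))"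
    using is_primitive_eq[OF angle_primitive, of 1 ?l] by (simp add: angle_0)
  also have "\<dots> \<le> integral {0..1} (\<lambda>t. (1 + B)\<^sup>2 * ?T n t)"
  proof (rule integral_le)
    show "(\<lambda>t. (?l - q t) * speed t (angle ?l t)) integrable_on {0..1}"
      using is_primitive_absint[OF angle_primitive] by (simp add: absolutely_integrable_on_def)
    show "(\<lambda>t. (1 + B)\<^sup>2 * ?T n t) integrable_on {0..1}" by (rule integrable_on_mult_right[OF Ti])
    fix t :: real assume t: "t \<in> {0..1}"
    have "(?l - q t) * speed t (angle ?l t) \<le> ?T n t * speed t (angle ?l t)"
      by (intro mult_right_mono pruefer_speed_nonneg) (auto simp: max_def)
    also have "\<dots> \<le> ?T n t * (1 + B)\<^sup>2" by (intro mult_left_mono speed_le[OF t]) auto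
    finally show "(?l - q t) * speed t (angle ?l t) \<le> (1 + B)\<^sup>2 * ?T n t" by (simp add: mult.commute)
  qed
  also have "\<dots> = (1 + B)\<^sup>2 * integral {0..1} (?T n)" by simp
  finally have "angle ?l 1 < pi / 2" using n by simp
  then have "angle ?l 1 < pi - shift 1" using shift_lt[of 1] by simp
  then show ?thesis ..
qed

end

section \<open>Unboundedness of the angle and enumeration of the eigenvalues\<close>

context pruefer
begin

text \<open>If the angles stayed bounded as \<open>l \<rightarrow> \<infinity>\<close>, their limit would satisfy \<open>sin (\<phi> + arctan F) = 0\<close>
  almost everywhere and be nondecreasing, while \<open>arctan F\<close> is strictly increasing.\<close>

lemma angle_unbounded: "\<exists>n :: nat. M < angle (real n) 1"
proof (rule ccontr)
  assume "\<not> ?thesis"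
  then have M: "angle (real n) 1 \<le> M" for n by (simp add: not_less)
  define b where "b t = (1 + B)\<^sup>2 * \<bar>q t\<bar>" for t
  have qn: "(\<lambda>t. \<bar>q t\<bar>) absolutely_integrable_on {0..1}"
    using absolutely_integrable_norm[OF q] by (simp add: o_def)
  have ba: "b absolutely_integrable_on {0..1}" unfolding b_def by (rule set_integrable_mult_right[OF qn])
  define C where "C = integral {0..1} b"
  define p where "p n t = (real n - q t) * speed t (angle (real n) t)" for n t
  have P: "is_primitive 0 1 (p n) (angle (real n))" for n
    unfolding p_def by (rule angle_primitive)
  have sub: "f integrable_on {x..y}" if "f absolutely_integrable_on {0..1}" "0 \<le> x" "y \<le> 1" for f :: "real \<Rightarrow> real" and x y
    by (rule integrable_on_subinterval_real[OF that])
  have sp: "(\<lambda>t. speed t (angle (real n) t)) absolutely_integrable_on {0..1}" for n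
    by (intro bounded_measurable_absint pruefer_speed_bounded_measurable F angle_continuous)
  have qs: "(\<lambda>t. q t * speed t (angle (real n) t)) absolutely_integrable_on {0..1}" for n
    by (intro absint_bounded_measurable_mult(2) pruefer_speed_bounded_measurable F angle_continuous q)
  have qs_le: "\<bar>q t * speed t (angle (real n) t)\<bar> \<le> b t" if "t \<in> {0..1}" for n t
    unfolding b_def abs_mult using speed_le[OF that] pruefer_speed_nonneg[of F t]
    by (simp add: mult.commute[of _ "\<bar>q t\<bar>"] mult_left_mono)
  \<comment> \<open>For \<open>l = n\<close> the term with n is nonnegative, so any decrease of the
    angle is at most the integral of q times the speed, which is bounded uniformly in n.\<close>
  have decr: "angle (real n) y - angle (real n) x \<ge> - integral {x..y} (\<lambda>t. q t * speed t (angle (real n) t))"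
    if xy: "0 \<le> x" "x \<le> y" "y \<le> 1" for n x y
  proof -
    have "- integral {x..y} (\<lambda>t. q t * speed t (angle (real n) t)) = integral {x..y} (\<lambda>t. - (q t * speed t (angle (real n) t)))" by simp
    also have "\<dots> \<le> integral {x..y} (p n)"
    proof (rule integral_le)
      show "(\<lambda>t. - (q t * speed t (angle (real n) t))) integrable_on {x..y}"
        using sub[OF qs xy(1,3)] by (rule integrable_neg)
      show "p n integrable_on {x..y}" by (rule sub[OF is_primitive_absint[OF P] xy(1,3)])
      show "- (q t * speed t (angle (real n) t)) \<le> p n t" for t
        using pruefer_speed_nonneg[of F t "angle (real n) t"] by (simp add: p_def left_diff_distrib)
    qed
    also have "\<dots> = angle (real n) y - angle (real n) x" by (rule is_primitive_diff[OF P xy, symmetric])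
    finally show ?thesis .
  qed
  have qi_le: "\<bar>integral {x..y} (\<lambda>t. q t * speed t (angle (real n) t))\<bar> \<le> C"
    if xy: "0 \<le> x" "x \<le> y" "y \<le> 1" for n x y
  proof -
    have "norm (integral {x..y} (\<lambda>t. q t * speed t (angle (real n) t))) \<le> 1 * integral {x..y} b"
      using qs_le xy by (intro norm_integral_le_mult sub qs ba) auto
    also have "integral {x..y} b \<le> C"
      unfolding C_def using xy by (intro integral_subset_le sub ba) (auto simp: b_def)
    finally show ?thesis by simp
  qed
  \<comment> \<open>A bound at 1 therefore bounds the angles on the whole interval; being monotone
    in n, they converge pointwise.\<close>
  have upper: "angle (real n) x \<le> M + C" if "x \<in> {0..1}" for n x
    using decr[of x 1 n] qi_le[of x 1 n] M[of n] that by auto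
  have "\<exists>L. (\<lambda>n. angle (real n) x) \<longlonglongrightarrow> L" if "x \<in> {0..1}" for x
  proof -
    have "incseq (\<lambda>n. angle (real n) x)" using angle_mono that by (auto simp: incseq_def)
    then show ?thesis using upper[OF that] by (meson incseq_convergent)
  qed
  then obtain \<phi> where \<phi>: "\<And>x. x \<in> {0..1} \<Longrightarrow> (\<lambda>n. angle (real n) x) \<longlonglongrightarrow> \<phi> x" by metis
  have s_lim: "(\<lambda>n. speed t (angle (real n) t)) \<longlonglongrightarrow> speed t (\<phi> t)" if "t \<in> {0..1}" for t
    unfolding pruefer_speed_def by (intro tendsto_intros \<phi> that)
  have s_norm: "norm (speed t (angle (real n) t)) \<le> (1 + B)\<^sup>2" if "t \<in> {0..1}" for t n
    using speed_le[OF that] by (simp add: pruefer_speed_nonneg)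
  have si: "(\<lambda>t. speed t (angle (real n) t)) integrable_on {0..1}" for n by (rule sub[OF sp]) auto
  note dc = dominated_convergence[OF si integrable_const_ivl s_norm s_lim]
  \<comment> \<open>The speed integral multiplied by n is the bounded angle at 1 plus a bounded
    term, so the speeds tend to 0 in the mean.\<close>
  have "real n * integral {0..1} (\<lambda>t. speed t (angle (real n) t)) \<le> M + C" for n
  proof -
    have "angle (real n) 1 = integral {0..1} (p n)" using is_primitive_eq[OF P, of 1 n] by (simp add: angle_0)
    also have "\<dots> = integral {0..1} (\<lambda>t. real n * speed t (angle (real n) t) - q t * speed t (angle (real n) t))"
      by (simp add: p_def[abs_def] left_diff_distrib)
    also have "\<dots> = real n * integral {0..1} (\<lambda>t. speed t (angle (real n) t)) - integral {0..1} (\<lambda>t. q t * speed t (angle (real n) t))"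
      by (subst Henstock_Kurzweil_Integration.integral_diff) (auto intro!: integrable_on_mult_right si sub[OF qs])
    finally show ?thesis using M[of n] qi_le[of 0 1 n] by simp
  qed
  then have "integral {0..1} (\<lambda>t. speed t (angle (real n) t)) \<le> (M + C) / real n" if "0 < n" for n
    using that by (simp add: field_simps)
  then have "\<forall>\<^sub>F n in sequentially. integral {0..1} (\<lambda>t. speed t (angle (real n) t)) \<le> (M + C) / real n"
    using eventually_gt_at_top[of 0] by (rule eventually_mono[rotated])
  moreover have "(\<lambda>n. (M + C) / real n) \<longlonglongrightarrow> 0" by (rule lim_const_over_n)
  ultimately have "integral {0..1} (\<lambda>t. speed t (\<phi> t)) \<le> 0"
    using tendsto_le[OF sequentially_bot _ dc(2)] by blast
  moreover have "0 \<le> integral {0..1} (\<lambda>t. speed t (\<phi> t))"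
    by (intro Henstock_Kurzweil_Integration.integral_nonneg dc(1) pruefer_speed_nonneg)
  ultimately have I0: "integral {0..1} (\<lambda>t. speed t (\<phi> t)) = 0" by simp
  have "(\<lambda>t. speed t (\<phi> t)) absolutely_integrable_on {0..1}"
    by (rule nonnegative_absolutely_integrable_1[OF dc(1) pruefer_speed_nonneg])
  then obtain N where N: "negligible N" "\<And>t. t \<in> {0..1} - N \<Longrightarrow> speed t (\<phi> t) = 0"
    using integral_zero_imp_negligible[OF _ pruefer_speed_nonneg I0] by blast
  \<comment> \<open>In the limit the speed vanishes almost everywhere, and with it the possible
    decrease of the angle.\<close>
  have \<phi>_mono: "\<phi> x \<le> \<phi> y" if xy: "0 \<le> x" "x \<le> y" "y \<le> 1" for x y
  proof -
    have "(\<lambda>n. integral {x..y} (\<lambda>t. q t * speed t (angle (real n) t))) \<longlonglongrightarrow> integral {x..y} (\<lambda>t. q t * speed t (\<phi> t))"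
    proof (rule dominated_convergence(2)[where h = b])
      show "(\<lambda>t. q t * speed t (angle (real n) t)) integrable_on {x..y}" for n by (rule sub[OF qs xy(1,3)])
      show "b integrable_on {x..y}" by (rule sub[OF ba xy(1,3)])
      show "norm (q t * speed t (angle (real n) t)) \<le> b t" if "t \<in> {x..y}" for n t using qs_le[of t n] that xy by auto
      show "(\<lambda>n. q t * speed t (angle (real n) t)) \<longlonglongrightarrow> q t * speed t (\<phi> t)" if "t \<in> {x..y}" for t
        using that xy by (intro tendsto_intros s_lim) auto
    qed
    also have "integral {x..y} (\<lambda>t. q t * speed t (\<phi> t)) = integral {x..y} (\<lambda>t :: real. 0 :: real)"
      by (rule integral_spike[OF N(1)]) (use N(2) xy in auto)
    finally have "(\<lambda>n. - integral {x..y} (\<lambda>t. q t * speed t (angle (real n) t))) \<longlonglongrightarrow> - 0"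
      by (intro tendsto_minus) simp
    moreover have "(\<lambda>n. angle (real n) y - angle (real n) x) \<longlonglongrightarrow> \<phi> y - \<phi> x"
      using xy by (intro tendsto_diff \<phi>) auto
    ultimately have "- 0 \<le> \<phi> y - \<phi> x"
      by (intro tendsto_le[OF sequentially_bot]) (use decr[OF xy] in \<open>auto intro!: always_eventually\<close>)
    then show ?thesis by simp
  qed
  \<comment> \<open>\<open>u\<close> is strictly increasing, and off a null set its values are
    multiples of pi between \<open>u 0\<close> and \<open>u 1\<close>; the interval minus a null set
    would be finite.\<close>
  define u where "u x = \<phi> x + shift x" for x
  have u_strict: "u x < u y" if "0 \<le> x" "x < y" "y \<le> 1" for x y
    using \<phi>_mono[of x y] shift_strict_mono[of x y] that by (simp add: u_def)
  have "sin (u t) = 0" if "t \<in> {0..1} - N" for t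
  proof -
    have "1 + (F t)\<^sup>2 \<noteq> 0" by (metis add_pos_nonneg less_irrefl zero_le_power2 zero_less_one)
    then show ?thesis using N(2)[OF that] unfolding speed_eq by (simp add: u_def)
  qed
  then have "\<exists>i :: int. u t = of_int i * pi" if "t \<in> {0..1} - N" for t
    using that by (auto simp: sin_zero_iff_int2)
  then obtain i where i: "\<And>t. t \<in> {0..1} - N \<Longrightarrow> u t = of_int (i t) * pi" by metis
  have "inj_on i ({0..1} - N)"
  proof (rule inj_onI)
    fix s t assume st: "s \<in> {0..1} - N" "t \<in> {0..1} - N" "i s = i t"
    then have "u s = u t" using i by simp
    then show "s = t" using u_strict[of s t] u_strict[of t s] st by (cases s t rule: linorder_cases) auto
  qed
  moreover have "i ` ({0..1} - N) \<subseteq> {\<lfloor>u 0 / pi\<rfloor>..\<lceil>u 1 / pi\<rceil>}"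
  proof
    fix j assume "j \<in> i ` ({0..1} - N)"
    then obtain t where t: "t \<in> {0..1} - N" "j = i t" by blast
    have "u 0 \<le> u t" "u t \<le> u 1" using u_strict[of 0 t] u_strict[of t 1] t by (cases "t = 0"; cases "t = 1"; auto)+
    then have "u 0 / pi \<le> of_int j" "of_int j \<le> u 1 / pi"
      using i[OF t(1)] t(2) by (simp_all add: divide_le_eq le_divide_eq)
    then show "j \<in> {\<lfloor>u 0 / pi\<rfloor>..\<lceil>u 1 / pi\<rceil>}" by (simp add: floor_le_iff le_ceiling_iff; linarith)
  qed
  ultimately have "finite ({0..1} - N)" by (meson finite_atLeastAtMost_int finite_subset inj_on_finite)
  then have "negligible (({0..1} - N) \<union> N)" using N(1) by (intro negligible_Un) (auto intro: negligible_finite)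
  then have "negligible {0..1::real}" by (rule negligible_subset) auto
  then show False using not_negligible_Icc by simp
qed

text \<open>Counting starts at 0: the sum is positive for every \<open>l\<close> by
  \<open>angle_shift_pos\<close>, so \<open>pi\<close> is the first multiple of pi that can be
  attained.\<close>

definition eigenvalue :: "nat \<Rightarrow> real" where
  "eigenvalue n = (THE l. angle l 1 + shift 1 = (real n + 1) * pi)"

lemma eigenvalue_exists: "\<exists>l. angle l 1 + shift 1 = (real n + 1) * pi"
proof -
  obtain l0 where l0: "angle l0 1 < pi - shift 1" using angle_small by blast
  obtain m :: nat where m: "(real n + 1) * pi < angle (real m) 1" using angle_unbounded by blast
  have "pi \<le> (real n + 1) * pi" by simp
  then have low: "angle l0 1 \<le> (real n + 1) * pi - shift 1" using l0 by linarith
  have sh: "0 \<le> shift 1" using shift_mono[of 0 1] by (simp add: shift_0)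
  have high: "(real n + 1) * pi - shift 1 \<le> angle (real m) 1" using m sh by linarith
  have "l0 \<le> real m"
  proof (rule ccontr)
    assume "\<not> l0 \<le> real m"
    then show False using angle_strict_mono[of "real m" l0] low high by simp
  qed
  then have "\<exists>l\<ge>l0. l \<le> real m \<and> angle l 1 = (real n + 1) * pi - shift 1"
    using low high by (intro IVT) (auto intro: pruefer_angle_isCont[OF q F])
  then show ?thesis by (auto simp: algebra_simps)
qed

lemma angle_inj: "angle l 1 = angle m 1 \<Longrightarrow> l = m"
  using angle_strict_mono[of l m] angle_strict_mono[of m l] by (cases l m rule: linorder_cases) auto

lemma eigenvalue: "angle (eigenvalue n) 1 + shift 1 = (real n + 1) * pi"
  unfolding eigenvalue_def
proof (rule theI')
  show "\<exists>!l. angle l 1 + shift 1 = (real n + 1) * pi"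
    using eigenvalue_exists[of n] angle_inj by (metis add_right_cancel)
qed

lemma eigenvalue_strict_mono: "m < n \<Longrightarrow> eigenvalue m < eigenvalue n"
proof (rule ccontr)
  assume mn: "m < n" "\<not> eigenvalue m < eigenvalue n"
  then have "angle (eigenvalue n) 1 \<le> angle (eigenvalue m) 1" by (intro angle_mono) auto
  then have "(real n + 1) * pi \<le> (real m + 1) * pi" using eigenvalue[of n] eigenvalue[of m] by linarith
  then show False using mn(1) by simp
qed

lemma sin_angle_zero_iff: "sin (angle l 1) + F 1 * cos (angle l 1) = 0 \<longleftrightarrow> (\<exists>n. l = eigenvalue n)"
proof -
  have pos: "1 + (F 1)\<^sup>2 \<noteq> 0" by (metis add_pos_nonneg less_irrefl zero_le_power2 zero_less_one)
  have "sin (angle l 1) + F 1 * cos (angle l 1) = 0 \<longleftrightarrow> speed 1 (angle l 1) = 0"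
    by (simp add: pruefer_speed_def)
  also have "\<dots> \<longleftrightarrow> sin (angle l 1 + shift 1) = 0" using pos by (simp add: speed_eq)
  also have "\<dots> \<longleftrightarrow> (\<exists>n. l = eigenvalue n)"
  proof
    assume "sin (angle l 1 + shift 1) = 0"
    then obtain i :: int where i: "angle l 1 + shift 1 = of_int i * pi" by (auto simp: sin_zero_iff_int2)
    \<comment> \<open>Positivity excludes the multiples with \<open>i \<le> 0\<close>; the index of
      the eigenvalue is \<open>i - 1\<close>.\<close>
    then have "0 < of_int i * pi" using angle_shift_pos[of l] by simp
    then have "0 < i" by (simp add: zero_less_mult_iff)
    then have "real (nat (i - 1)) + 1 = of_int i" by simp
    then have "angle l 1 + shift 1 = angle (eigenvalue (nat (i - 1))) 1 + shift 1" using i eigenvalue by simp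
    then show "\<exists>n. l = eigenvalue n" using angle_inj by auto
  next
    assume "\<exists>n. l = eigenvalue n"
    then obtain n where "l = eigenvalue n" ..
    then have "angle l 1 + shift 1 = of_int (int n + 1) * pi" using eigenvalue by simp
    then show "sin (angle l 1 + shift 1) = 0" unfolding sin_zero_iff_int2 by blast
  qed
  finally show ?thesis .
qed

end

section \<open>Eigenvalues\<close>

lemma (in sturm_bounds) sturm_fun_homogeneous:
  assumes "admissible F" "x \<in> {0..1}"
  shows "sturm_fun q z F (\<lambda>x. 0) a x = a * sturm_fun q z F (\<lambda>x. 0) 1 x"
proof -
  have "sturm_fun q z F (\<lambda>x. 0) 0 x = 0"
    using sturm_fun_le[OF assms(1) zero_L2_space assms(2), of 0] by simp
  then show ?thesis using sturm_fun_eq[OF assms(1) zero_L2_space assms(2), of a] by simp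
qed

lemma (in sturm_bounds) eigenspace_dirichlet:
  assumes P: "finite_signed_measure P" and F: "admissible (dist_fun P)" and f: "f \<in> eigenspace (dirichlet q P) z"
  obtains a where "AE x in lebesgue_on unit_ivl. f x = a * sturm_fun q z (dist_fun P) (\<lambda>x. 0) 1 x"
    "a * shooting q z (dist_fun P) = 0"
proof -
  have "(f, \<lambda>x. 0 + z * f x) \<in> dirichlet q P" using f by (simp add: eigenspace_def)
  then obtain a where a: "AE x in lebesgue_on unit_ivl. f x = sturm_fun q z (dist_fun P) (\<lambda>x. 0) a x"
    "sturm_fun q z (dist_fun P) (\<lambda>x. 0) 0 1 + a * shooting q z (dist_fun P) = 0"
    using dirichlet_imp_sturm_fun[OF P F zero_L2_space] by blast
  show thesis
  proof (rule that[of a])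
    have "AE x in lebesgue_on unit_ivl. x \<in> unit_ivl" by (rule AE_I2) simp
    with a(1) show "AE x in lebesgue_on unit_ivl. f x = a * sturm_fun q z (dist_fun P) (\<lambda>x. 0) 1 x"
    proof eventually_elim
      case (elim x)
      then show ?case using sturm_fun_homogeneous[OF F, of x a] by simp
    qed
    show "a * shooting q z (dist_fun P) = 0"
      using a(2) sturm_fun_homogeneous[OF F, of 1 0] by simp
  qed
qed

text \<open>All eigenfunctions are multiples of the fundamental solution, so multiplicities are at
  most 1. At a zero of \<open>shooting\<close> the fundamental solution is an eigenfunction, and it
  is not a null function because F is not.\<close>

lemma (in sturm_bounds) eigenspace_dim:
  assumes P: "finite_signed_measure P" and F: "admissible (dist_fun P)"
    and F0: "integral {0..1} (\<lambda>t. \<bar>dist_fun P t\<bar>) \<noteq> 0"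
  shows "has_dim_ae (eigenspace (dirichlet q P) z) (if shooting q z (dist_fun P) = 0 then 1 else 0)"
proof (cases "shooting q z (dist_fun P) = 0")
  case False
  have "\<not> independent_ae (Suc 0) u" if u: "u 0 \<in> eigenspace (dirichlet q P) z" for u
  proof
    assume ind: "independent_ae (Suc 0) u"
    obtain a where a: "AE x in lebesgue_on unit_ivl. u 0 x = a * sturm_fun q z (dist_fun P) (\<lambda>x. 0) 1 x"
      "a * shooting q z (dist_fun P) = 0"
      using eigenspace_dirichlet[OF P F u] by blast
    then have "a = 0" using False by simp
    then have "AE x in lebesgue_on unit_ivl. (\<Sum>i<Suc 0. 1 * u i x) = 0" using a(1) by simp
    then show False
      using ind[unfolded independent_ae_def, THEN spec, of "\<lambda>_. 1"] by auto
  qed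
  then show ?thesis using False by (auto simp: has_dim_ae_def independent_ae_def[of 0])
next
  case True
  let ?f = "sturm_fun q z (dist_fun P) (\<lambda>x. 0) 1"
  have E: "?f \<in> eigenspace (dirichlet q P) z"
    using sturm_fun_imp_dirichlet[OF P F zero_L2_space, of 1] True sturm_fun_homogeneous[OF F, of 1 0]
    by (simp add: eigenspace_def)
  have "independent_ae 1 (\<lambda>_. ?f)"
    unfolding independent_ae_def
  proof (intro allI impI)
    fix c :: "nat \<Rightarrow> complex" and i :: nat
    assume ae: "AE x in lebesgue_on unit_ivl. (\<Sum>i<1. c i * ?f x) = 0" and i: "i < 1"
    show "c i = 0"
    proof (rule ccontr)
      assume "c i \<noteq> 0"
      then have "AE x in lebesgue_on unit_ivl. ?f x = 0" using ae i by simp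
      then obtain N where N: "negligible N" "\<forall>x\<in>unit_ivl - N. ?f x = 0" by (auto simp: AE_unit_ivl_iff)
      have "negligible (N \<union> {0, 1})" using N(1) by (intro negligible_Un) auto
      then have "integral {0..1} (\<lambda>t. \<bar>dist_fun P t\<bar>) = 0"
        by (rule sturm_fun_null_imp[OF F]) (use N(2) in auto)
      then show False using F0 by simp
    qed
  qed
  moreover have "\<not> independent_ae 2 u"
    if u: "u 0 \<in> eigenspace (dirichlet q P) z" "u 1 \<in> eigenspace (dirichlet q P) z" for u
  proof
    assume ind: "independent_ae 2 u"
    obtain a where a: "AE x in lebesgue_on unit_ivl. u 0 x = a * ?f x"
      using eigenspace_dirichlet[OF P F u(1)] by blast
    obtain b where b: "AE x in lebesgue_on unit_ivl. u 1 x = b * ?f x"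
      using eigenspace_dirichlet[OF P F u(2)] by blast
    \<comment> \<open>For \<open>a = 0\<close> the function \<open>u 0\<close> is itself null;
      otherwise b u_0 - a u_1 is null with the nonzero coefficient - a.\<close>
    define c where "c i = (if a = 0 then (if i = 0 then 1 else 0) else (if i = 0 then b else - a))" for i :: nat
    have "AE x in lebesgue_on unit_ivl. (\<Sum>i<2. c i * u i x) = 0"
      using a b by eventually_elim (simp add: c_def numeral_2_eq_2)
    then have "\<forall>i<2. c i = 0" using ind unfolding independent_ae_def by blast
    then have "c 0 = 0" "c 1 = 0" by auto
    then show False by (auto simp: c_def split: if_splits)
  qed
  ultimately show ?thesis
    unfolding has_dim_ae_def using True E by (auto simp: numeral_2_eq_2 intro!: exI[of _ "\<lambda>_. ?f"])
qed

section \<open>Eigenvalues as zeros of the shooting function\<close>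

context pruefer
begin

lemma F_not_null: "integral {0..1} (\<lambda>t. \<bar>F t\<bar>) \<noteq> 0"
proof
  assume I: "integral {0..1} (\<lambda>t. \<bar>F t\<bar>) = 0"
  have "bounded_measurable (\<lambda>t. \<bar>F t\<bar>)" by (rule bounded_measurable_compose[OF F]) (intro continuous_intros)
  then obtain N where N: "negligible N" "\<And>x. x \<in> {0..1} - N \<Longrightarrow> \<bar>F x\<bar> = 0"
    using integral_zero_imp_negligible[OF bounded_measurable_absint _ I] by (metis abs_ge_zero)
  then have "t = 0" if "t \<in> {0..1} - N" for t using F_ge[of t] that by force
  then have "{0..1} \<subseteq> insert 0 N" by blast
  then have "negligible {0..1::real}" using N(1) by (meson negligible_insert negligible_subset)
  then show False using not_negligible_Icc by simp
qed

text \<open>The angle is turned back into a solution: with a suitable positive amplitude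
  \<open>R\<close>, the products of \<open>R\<close> with sine and cosine of the angle solve the
  homogeneous system with \<open>h 0 = 1\<close>, so they give the fundamental solution.\<close>

lemma shooting_zero_iff: "shooting q (complex_of_real l) F = 0 \<longleftrightarrow> (\<exists>n. l = eigenvalue n)"
proof -
  interpret sb: sturm_bounds q "complex_of_real l" B using q B_nonneg by unfold_locales
  have adm: "sb.admissible F" using F F_le by (simp add: sb.admissible_def)
  let ?\<theta> = "angle l"
  \<comment> \<open>Logarithmic derivative of the amplitude, read off from R R' = w w' + h h' = h'
    (h - F w).\<close>
  define \<rho> where "\<rho> t = (q t - l) * ((sin (?\<theta> t) + F t * cos (?\<theta> t)) * (cos (?\<theta> t) - F t * sin (?\<theta> t)))" for t
  have "bounded_measurable (\<lambda>t. (sin (?\<theta> t) + F t * cos (?\<theta> t)) * (cos (?\<theta> t) + - F t * sin (?\<theta> t)))"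
    by (intro bounded_measurable_add bounded_measurable_mult bounded_measurable_uminus F
        bounded_measurable_continuous continuous_intros angle_continuous)
  then have \<rho>: "\<rho> absolutely_integrable_on {0..1}"
    unfolding \<rho>_def by (intro absint_bounded_measurable_mult(2) set_integral_diff(1) q bounded_measurable_absint
        bounded_measurable_const) simp
  define R where "R t = exp (1 * integral {0..t} \<rho>)" for t
  have R: "is_primitive 0 1 (\<lambda>t. R t * (1 * \<rho> t)) R"
    unfolding R_def by (rule exp_integral_primitive[OF \<rho>])
  have S: "is_primitive 0 1 (\<lambda>t. cos (?\<theta> t) * ((l - q t) * speed t (?\<theta> t))) (\<lambda>t. sin (?\<theta> t))"
    by (rule is_primitive_compose[OF angle_primitive DERIV_sin]) (intro continuous_intros)
  have C: "is_primitive 0 1 (\<lambda>t. - sin (?\<theta> t) * ((l - q t) * speed t (?\<theta> t))) (\<lambda>t. cos (?\<theta> t))"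
    by (rule is_primitive_compose[OF angle_primitive DERIV_cos]) (intro continuous_intros)
  define w h where "w t = R t * sin (?\<theta> t)" and "h t = R t * cos (?\<theta> t)" for t
  define k where "k t = (q t - l) * (w t + F t * h t)" for t
  \<comment> \<open>The two product rules in abstract form; \<open>y\<close> and \<open>x\<close>
    stand for sine and cosine, so \<open>y\<^sup>2 + x\<^sup>2\<close> becomes 1.\<close>
  have alg: "r * (Q * (s * (x - d * y))) * y + r * (x * (- Q * s\<^sup>2)) = - d * (Q * (r * s)) * (y\<^sup>2 + x\<^sup>2)"
    "r * (Q * (s * (x - d * y))) * x + r * (- y * (- Q * s\<^sup>2)) = Q * (r * s) * (y\<^sup>2 + x\<^sup>2)"
    if "s = y + d * x" for r Q s x y d :: real
    unfolding that by (simp_all add: power2_eq_square algebra_simps)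
  have k: "k t = (q t - l) * (R t * (sin (?\<theta> t) + F t * cos (?\<theta> t)))" for t
    by (simp add: k_def w_def h_def algebra_simps)
  have w: "is_primitive 0 1 (\<lambda>t. - F t * k t) w"
  proof (rule is_primitive_cong[OF is_primitive_mult[OF R S]])
    show "R t * (1 * \<rho> t) * sin (?\<theta> t) + R t * (cos (?\<theta> t) * ((l - q t) * speed t (?\<theta> t))) = - F t * k t" for t
      using alg(1)[OF refl, of "R t" "q t - l" "sin (?\<theta> t)" "F t" "cos (?\<theta> t)"]
      by (simp add: \<rho>_def pruefer_speed_def k)
  qed (simp add: w_def)
  have h: "is_primitive 0 1 k h"
  proof (rule is_primitive_cong[OF is_primitive_mult[OF R C]])
    show "R t * (1 * \<rho> t) * cos (?\<theta> t) + R t * (- sin (?\<theta> t) * ((l - q t) * speed t (?\<theta> t))) = k t" for t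
      using alg(2)[OF refl, of "R t" "q t - l" "sin (?\<theta> t)" "F t" "cos (?\<theta> t)"]
      by (simp add: \<rho>_def pruefer_speed_def k)
  qed (simp add: h_def)
  have kc: "sturm_rhs q (complex_of_real l) F (\<lambda>x. 0) (\<lambda>t. complex_of_real (w t)) (\<lambda>t. complex_of_real (h t)) = (\<lambda>t. complex_of_real (k t))"
    by (auto simp: sturm_rhs_def k_def)
  have "sturm_system q (complex_of_real l) F (\<lambda>x. 0) (\<lambda>t. complex_of_real (w t)) (\<lambda>t. complex_of_real (h t))"
    unfolding sturm_system_def kc
    using is_primitive_linear[OF w bounded_linear_of_real[where 'a = complex]] is_primitive_linear[OF h bounded_linear_of_real[where 'a = complex]]
    by simp
  moreover have "w 0 = 0" "h 0 = 1" by (simp_all add: w_def h_def R_def angle_0)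
  ultimately have "complex_of_real (w 1 + F 1 * h 1) = shooting q (complex_of_real l) F"
    using sb.sturm_system_unique[OF adm zero_L2_space, of "\<lambda>t. complex_of_real (w t)" "\<lambda>t. complex_of_real (h t)" 1]
      sb.sturm_fun_homogeneous[OF adm, of 1 0] by (simp add: shooting_def)
  then have "shooting q (complex_of_real l) F = 0 \<longleftrightarrow> w 1 + F 1 * h 1 = 0"
    by (metis of_real_eq_0_iff)
  also have "w 1 + F 1 * h 1 = R 1 * (sin (?\<theta> 1) + F 1 * cos (?\<theta> 1))"
    by (simp add: w_def h_def algebra_simps)
  also have "\<dots> = 0 \<longleftrightarrow> sin (?\<theta> 1) + F 1 * cos (?\<theta> 1) = 0" by (simp add: R_def)
  finally show ?thesis using sin_angle_zero_iff by simp
qed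

text \<open>Nonreal \<open>z\<close> are excluded by Green's identity, real ones are settled by
  \<open>shooting_zero_iff\<close>; injectivity of the enumeration matches the simplicity of the
  eigenvalues.\<close>

lemma eigenvalue_listing_dirichlet:
  assumes P: "finite_signed_measure P" and FP: "F = dist_fun P"
  shows "eigenvalue_listing (dirichlet q P) eigenvalue"
  unfolding eigenvalue_listing_def
proof (intro conjI allI)
  show "mono eigenvalue"
    using eigenvalue_strict_mono by (intro monoI) (metis le_less order.strict_implies_order order_refl)
  fix z :: complex
  interpret sb: sturm_bounds q z B using q B_nonneg by unfold_locales
  have adm: "sb.admissible (dist_fun P)" using F F_le by (simp add: sb.admissible_def FP)
  have F0: "integral {0..1} (\<lambda>t. \<bar>dist_fun P t\<bar>) \<noteq> 0" using F_not_null by (simp add: FP)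
  have inj: "m = n" if "eigenvalue m = eigenvalue n" for m n
    using eigenvalue_strict_mono[of m n] eigenvalue_strict_mono[of n m] that by (cases m n rule: linorder_cases) auto
  have sh: "shooting q z (dist_fun P) = 0 \<longleftrightarrow> (\<exists>n. complex_of_real (eigenvalue n) = z)"
  proof (cases "Im z = 0")
    case True
    then have "z = complex_of_real (Re z)" by (simp add: complex_eq_iff)
    then show ?thesis using shooting_zero_iff[of "Re z"] by (metis FP of_real_eq_iff)
  next
    case False
    then show ?thesis using sb.shooting_nonzero[OF adm False F0] by auto
  qed
  have set: "\<exists>n. {n. complex_of_real (eigenvalue n) = z} = {n}" if "\<exists>n. complex_of_real (eigenvalue n) = z"
  proof -
    obtain n where "complex_of_real (eigenvalue n) = z" using \<open>\<exists>n. complex_of_real (eigenvalue n) = z\<close> by blast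
    then have "{n. complex_of_real (eigenvalue n) = z} = {n}" using inj by (auto simp flip: \<open>complex_of_real (eigenvalue n) = z\<close>)
    then show ?thesis by blast
  qed
  show "finite {n. complex_of_real (eigenvalue n) = z}"
    using set by (cases "\<exists>n. complex_of_real (eigenvalue n) = z") auto
  have "card {n. complex_of_real (eigenvalue n) = z} = (if shooting q z (dist_fun P) = 0 then 1 else 0)"
    using set sh by (cases "\<exists>n. complex_of_real (eigenvalue n) = z") auto
  then show "has_dim_ae (eigenspace (dirichlet q P) z) (card {n. complex_of_real (eigenvalue n) = z})"
    using sb.eigenspace_dim[OF P adm F0] by simp
qed

end

text \<open>For \<open>a\<close> on one side of the limit eigenvalue, strict monotonicity gives a
  strict inequality against \<open>(real n + 1) * pi\<close> that persists for large
  \<open>k\<close>; monotonicity of the \<open>k\<close>-th angle then puts its eigenvalue on the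
  same side of \<open>a\<close> as the limit.\<close>

lemma pruefer_eigenvalue_tendsto:
  assumes F: "pruefer q F B" and Fs: "\<And>k. pruefer q (Fs k) B"
    and L1: "(\<lambda>k. integral {0..1} (\<lambda>t. \<bar>Fs k t - F t\<bar>)) \<longlonglongrightarrow> 0"
    and at1: "(\<lambda>k. Fs k 1) \<longlonglongrightarrow> F 1"
  shows "(\<lambda>k. pruefer.eigenvalue q (Fs k) n) \<longlonglongrightarrow> pruefer.eigenvalue q F n"
proof -
  interpret f: pruefer q F B by fact
  interpret fs: pruefer q "Fs k" B for k by (rule Fs)
  have lim: "(\<lambda>k. fs.angle k l 1 + fs.shift k 1) \<longlonglongrightarrow> f.angle l 1 + f.shift 1" for l
    unfolding f.shift_def fs.shift_def
    by (intro tendsto_add tendsto_arctan at1 pruefer_angle_tendsto[OF f.q f.F f.F_le fs.F fs.F_le L1])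
  let ?l = "f.eigenvalue n"
  show ?thesis
  proof (rule order_tendstoI)
    fix a assume "a < ?l"
    then have "f.angle a 1 + f.shift 1 < (real n + 1) * pi"
      using f.angle_strict_mono[of a ?l] f.eigenvalue[of n] by simp
    then have "\<forall>\<^sub>F k in sequentially. fs.angle k a 1 + fs.shift k 1 < (real n + 1) * pi"
      by (rule order_tendstoD(2)[OF lim])
    then show "\<forall>\<^sub>F k in sequentially. a < fs.eigenvalue k n"
    proof eventually_elim
      case (elim k)
      show ?case
      proof (rule ccontr)
        assume "\<not> a < fs.eigenvalue k n"
        then show False using fs.angle_mono[of "fs.eigenvalue k n" a 1 k] fs.eigenvalue[of k n] elim by simp
      qed
    qed
  next
    fix a assume "?l < a"
    then have "(real n + 1) * pi < f.angle a 1 + f.shift 1"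
      using f.angle_strict_mono[of ?l a] f.eigenvalue[of n] by simp
    then have "\<forall>\<^sub>F k in sequentially. (real n + 1) * pi < fs.angle k a 1 + fs.shift k 1"
      by (rule order_tendstoD(1)[OF lim])
    then show "\<forall>\<^sub>F k in sequentially. fs.eigenvalue k n < a"
    proof eventually_elim
      case (elim k)
      show ?case
      proof (rule ccontr)
        assume "\<not> fs.eigenvalue k n < a"
        then show False using fs.angle_mono[of a "fs.eigenvalue k n" 1 k] fs.eigenvalue[of k n] elim by simp
      qed
    qed
  qed
qed

section \<open>The measures \<open>dx + d\<nu>\<close>\<close>

lemma dist_fun_dx_plus:
  assumes "x \<in> {0..1}"
  shows "dist_fun (dx_plus \<nu>) x = x + dist_fun \<nu> x"
  using assms by (simp add: dist_fun_def dx_plus_def)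

text \<open>The two variations agree on the intervals \<open>{0<..<x}\<close>, which determine a
  finite measure on (0,1), so they coincide.\<close>

lemma signed_measure_eq_0:
  assumes P: "finite_signed_measure P" and 0: "\<And>x. x \<in> {0..1} \<Longrightarrow> dist_fun P x = 0" and A: "A \<in> borel_unit"
  shows "P A = 0"
proof -
  interpret p: finite_measure "pos_variation P" by (rule finite_measure_pos_variation[OF P])
  interpret n: finite_measure "neg_variation P" by (rule finite_measure_neg_variation[OF P])
  have um: "uminus \<in> measurable M borel" if "sets M = borel_unit" for M :: "real measure"
    by (rule continuous_on_borel_unit[OF _ that]) (intro continuous_intros)
  \<comment> \<open>Reflection turns initial intervals into the rays \<open>{y<..}\<close> on which
    \<open>measure_eqI_lessThan\<close> tests equality.\<close>
  let ?p = "distr (pos_variation P) borel uminus" and ?n = "distr (neg_variation P) borel uminus"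
  have ray: "\<exists>x\<in>{0..1}. uminus -` {y<..} \<inter> unit_ivl = {0<..<x}" for y :: real
  proof (rule bexI)
    show "uminus -` {y<..} \<inter> unit_ivl = {0<..<min 1 (max 0 (- y))}" by (auto simp: min_def max_def)
  qed auto
  have "?p = ?n"
  proof (rule measure_eqI_lessThan)
    fix y :: real
    obtain x where x: "x \<in> {0..1}" "uminus -` {y<..} \<inter> unit_ivl = {0<..<x}" using ray by blast
    have b: "{0<..<x} \<in> borel_unit" using x(1) by (auto simp: borel_unit_iff)
    have e: "emeasure ?p {y<..} = emeasure (pos_variation P) {0<..<x}"
      "emeasure ?n {y<..} = emeasure (neg_variation P) {0<..<x}"
      using x(2) by (simp_all add: emeasure_distr[OF um])
    show "emeasure ?p {y<..} < \<infinity>" unfolding e by (simp add: p.emeasure_eq_measure)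
    have "measure (pos_variation P) {0<..<x} = measure (neg_variation P) {0<..<x}"
      using 0[OF x(1)] jordan_decomposition[OF P b] by (simp add: dist_fun_def)
    then show "emeasure ?p {y<..} = emeasure ?n {y<..}"
      unfolding e by (simp add: p.emeasure_eq_measure n.emeasure_eq_measure)
  qed auto
  define A' where "A' = uminus -` A"
  have "A' \<in> sets borel"
  proof -
    have "(uminus :: real \<Rightarrow> real) \<in> borel_measurable borel" by simp
    from measurable_sets[OF this, of A] show ?thesis using A by (simp add: A'_def borel_unit_iff)
  qed
  moreover have "uminus -` A' \<inter> unit_ivl = A" using A by (auto simp: A'_def borel_unit_iff)
  ultimately have "measure ?p A' = measure (pos_variation P) A" "measure ?n A' = measure (neg_variation P) A"
    by (simp_all add: measure_distr[OF um])
  then show ?thesis using \<open>?p = ?n\<close> jordan_decomposition[OF P A] by simp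
qed

text \<open>If F vanished almost everywhere, it would vanish everywhere by left continuity, and dx +
  d nu would be 0. But on the complement of the Lebesgue null set carrying nu this measure is dx and
  has mass 1.\<close>

lemma singular_dist_fun_not_null:
  assumes \<nu>: "finite_signed_measure \<nu>" and sing: "singular_signed_measure \<nu>"
  shows "integral {0..1} (\<lambda>t. \<bar>dist_fun (dx_plus \<nu>) t\<bar>) \<noteq> 0"
proof
  let ?P = "dx_plus \<nu>"
  assume I: "integral {0..1} (\<lambda>t. \<bar>dist_fun ?P t\<bar>) = 0"
  have P: "finite_signed_measure ?P" by (rule finite_signed_measure_dx_plus[OF \<nu>])
  have "bounded_measurable (\<lambda>t. \<bar>dist_fun ?P t\<bar>)"
    by (rule bounded_measurable_compose[OF dist_fun_bounded_measurable[OF P]]) (intro continuous_intros)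
  then obtain N where N: "negligible N" "\<And>x. x \<in> {0..1} - N \<Longrightarrow> \<bar>dist_fun ?P x\<bar> = 0"
    using integral_zero_imp_negligible[OF bounded_measurable_absint _ I] by (metis abs_ge_zero)
  have zero: "dist_fun ?P x = 0" if x: "x \<in> {0..1}" for x
  proof (rule ccontr)
    assume nz: "dist_fun ?P x \<noteq> 0"
    then have x0: "0 < x" using x P by (cases "x = 0") auto
    have "(dist_fun ?P \<longlongrightarrow> dist_fun ?P x) (at_left x)" using x x0 by (intro dist_fun_left_continuous[OF P]) auto
    then have "\<forall>\<^sub>F y in at_left x. dist_fun ?P y \<noteq> 0" using nz by (rule tendsto_imp_eventually_ne)
    then obtain b where b: "b < x" "\<And>y. b < y \<Longrightarrow> y < x \<Longrightarrow> dist_fun ?P y \<noteq> 0" by (auto simp: eventually_at_left_field)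
    have "{max 0 b<..<x} \<subseteq> N"
    proof
      fix y assume "y \<in> {max 0 b<..<x}"
      then show "y \<in> N" using b(2)[of y] x N(2)[of y] by auto
    qed
    then have "negligible {max 0 b<..<x}" using N(1) negligible_subset by blast
    moreover have "open {max 0 b<..<x}" "{max 0 b<..<x} \<noteq> {}" using b x0 by auto
    ultimately show False using open_not_negligible by blast
  qed
  obtain N' where N': "N' \<in> borel_unit" "N' \<in> null_sets lborel" "\<And>A. A \<in> borel_unit \<Longrightarrow> A \<inter> N' = {} \<Longrightarrow> \<nu> A = 0"
    using sing unfolding singular_signed_measure_def by blast
  define A where "A = unit_ivl - N'"
  have A: "A \<in> borel_unit" using N'(1) by (auto simp: A_def borel_unit_iff)
  have "?P A = 0" by (rule signed_measure_eq_0[OF P zero A])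
  moreover have "\<nu> A = 0" using A by (intro N'(3)) (auto simp: A_def)
  moreover have "measure lborel A = 1"
    unfolding A_def using measure_Diff_null_set[OF _ N'(2), of unit_ivl] by simp
  ultimately show False by (simp add: dx_plus_def)
qed

text \<open>Nonzero L1 norms are demanded for every \<open>k\<close> because
  \<open>norm_resolvent_tendsto\<close> asks for \<open>z\<close> in the resolvent set of every
  operator of the sequence. They make all the shooting denominators nonzero.\<close>

lemma norm_resolvent_tendsto_dirichlet:
  assumes q: "q absolutely_integrable_on {0..1}"
    and Ps: "\<And>k. finite_signed_measure (Ps k)" and P: "finite_signed_measure P"
    and B: "\<And>k x. x \<in> {0..1} \<Longrightarrow> \<bar>dist_fun (Ps k) x\<bar> \<le> B" "\<And>x. x \<in> {0..1} \<Longrightarrow> \<bar>dist_fun P x\<bar> \<le> B"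
    and L1: "(\<lambda>k. integral {0..1} (\<lambda>t. \<bar>dist_fun (Ps k) t - dist_fun P t\<bar>)) \<longlonglongrightarrow> 0"
    and at1: "(\<lambda>k. dist_fun (Ps k) 1) \<longlonglongrightarrow> dist_fun P 1"
    and nz: "\<And>k. integral {0..1} (\<lambda>t. \<bar>dist_fun (Ps k) t\<bar>) \<noteq> 0" "integral {0..1} (\<lambda>t. \<bar>dist_fun P t\<bar>) \<noteq> 0"
  shows "norm_resolvent_tendsto (\<lambda>k. dirichlet q (Ps k)) (dirichlet q P)"
  unfolding norm_resolvent_tendsto_def
proof (intro allI impI)
  fix z :: complex assume z: "Im z \<noteq> 0"
  have "0 \<le> B" using B(2)[of 0] by auto
  then interpret sb: sturm_bounds q z B using q by unfold_locales
  have adms: "sb.admissible (dist_fun (Ps k))" for k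
    using dist_fun_bounded_measurable[OF Ps] B(1) by (simp add: sb.admissible_def)
  have adm: "sb.admissible (dist_fun P)"
    using dist_fun_bounded_measurable[OF P] B(2) by (simp add: sb.admissible_def)
  note shs = sb.shooting_nonzero[OF adms z nz(1)] and sh = sb.shooting_nonzero[OF adm z nz(2)]
  show "in_resolvent_set (dirichlet q P) z \<and> (\<forall>k. in_resolvent_set (dirichlet q (Ps k)) z) \<and>
     (\<lambda>k. operator_norm (\<lambda>g x. resolvent (dirichlet q (Ps k)) z g x - resolvent (dirichlet q P) z g x)) \<longlonglongrightarrow> 0"
    by (intro conjI allI sb.dirichlet_in_resolvent_set[OF P adm sh] sb.dirichlet_in_resolvent_set[OF Ps adms shs]
        sb.dirichlet_resolvent_tendsto[OF Ps P adms adm L1 at1 shs sh])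
qed

lemma weak_star_dist_fun_dx_plus:
  assumes \<nu>s: "\<And>k. finite_signed_measure (\<nu>s k)" and \<nu>: "finite_signed_measure \<nu>"
    and w: "weak_star_tendsto \<nu>s \<nu>"
  obtains B where "\<And>k x. x \<in> {0..1} \<Longrightarrow> \<bar>dist_fun (dx_plus (\<nu>s k)) x\<bar> \<le> B"
    "\<And>x. x \<in> {0..1} \<Longrightarrow> \<bar>dist_fun (dx_plus \<nu>) x\<bar> \<le> B"
    "(\<lambda>k. integral {0..1} (\<lambda>t. \<bar>dist_fun (dx_plus (\<nu>s k)) t - dist_fun (dx_plus \<nu>) t\<bar>)) \<longlonglongrightarrow> 0"
    "(\<lambda>k. dist_fun (dx_plus (\<nu>s k)) 1) \<longlonglongrightarrow> dist_fun (dx_plus \<nu>) 1"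
proof -
  obtain C where C: "C \<ge> 0" "\<And>k f B. continuous_on {0..1} f \<Longrightarrow> (\<And>x. x \<in> {0..1} \<Longrightarrow> \<bar>f x\<bar> \<le> B) \<Longrightarrow>
      \<bar>signed_integral (\<nu>s k) f\<bar> \<le> C * (B::real)"
    using weak_star_uniformly_bounded[OF \<nu>s w] by blast
  obtain C' where C': "C' > 0" "\<And>x. x \<in> {0..1} \<Longrightarrow> norm (dist_fun \<nu> x) \<le> C'"
    using bounded_measurable_bound[OF dist_fun_bounded_measurable[OF \<nu>]] by blast
  have Cs: "\<bar>dist_fun (\<nu>s k) x\<bar> \<le> C" if "x \<in> {0..1}" for k x
    by (rule weak_star_dist_fun_bounded[OF \<nu>s C(2) that])
  show thesis
  proof (rule that[of "1 + C + C'"])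
    show "\<bar>dist_fun (dx_plus (\<nu>s k)) x\<bar> \<le> 1 + C + C'" if "x \<in> {0..1}" for k x
      using Cs[OF that, of k] C'(1) that unfolding dist_fun_dx_plus[OF that] atLeastAtMost_iff by linarith
    show "\<bar>dist_fun (dx_plus \<nu>) x\<bar> \<le> 1 + C + C'" if "x \<in> {0..1}" for x
      using C'(2)[OF that] C(1) that unfolding dist_fun_dx_plus[OF that] atLeastAtMost_iff real_norm_def by linarith
    have "integral {0..1} (\<lambda>t. \<bar>dist_fun (dx_plus (\<nu>s k)) t - dist_fun (dx_plus \<nu>) t\<bar>)
        = integral {0..1} (\<lambda>t. \<bar>dist_fun (\<nu>s k) t - dist_fun \<nu> t\<bar>)" for k
      by (intro Henstock_Kurzweil_Integration.integral_cong) (simp add: dist_fun_dx_plus)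
    then show "(\<lambda>k. integral {0..1} (\<lambda>t. \<bar>dist_fun (dx_plus (\<nu>s k)) t - dist_fun (dx_plus \<nu>) t\<bar>)) \<longlonglongrightarrow> 0"
      using weak_star_dist_fun_L1[OF \<nu>s \<nu> w] by simp
    \<comment> \<open>Convergence at the end point 1 is convergence of total masses, tested by the
      constant function.\<close>
    have "continuous_on {0..1} (\<lambda>x :: real. 1 :: real)" by simp
    then have "(\<lambda>k. signed_integral (\<nu>s k) (\<lambda>x. 1 :: real)) \<longlonglongrightarrow> signed_integral \<nu> (\<lambda>x. 1)"
      using w unfolding weak_star_tendsto_def by blast
    then have "(\<lambda>k. dist_fun (\<nu>s k) 1) \<longlonglongrightarrow> dist_fun \<nu> 1"
      by (simp add: signed_integral_const[OF \<nu>] signed_integral_const[OF \<nu>s])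
    then show "(\<lambda>k. dist_fun (dx_plus (\<nu>s k)) 1) \<longlonglongrightarrow> dist_fun (dx_plus \<nu>) 1"
      by (simp add: dist_fun_dx_plus tendsto_add)
  qed
qed

lemma nonneg_imp_pruefer:
  assumes q: "q absolutely_integrable_on {0..1}" and \<nu>: "finite_signed_measure \<nu>" "nonneg_signed_measure \<nu>"
    and B: "\<And>x. x \<in> {0..1} \<Longrightarrow> \<bar>dist_fun (dx_plus \<nu>) x\<bar> \<le> B"
  shows "pruefer q (dist_fun (dx_plus \<nu>)) B"
proof
  have P: "finite_signed_measure (dx_plus \<nu>)" by (rule finite_signed_measure_dx_plus[OF \<nu>(1)])
  show "bounded_measurable (dist_fun (dx_plus \<nu>))" by (rule dist_fun_bounded_measurable[OF P])
  show "dist_fun (dx_plus \<nu>) 0 = 0" by (rule dist_fun_0[OF P])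
  show "(dist_fun (dx_plus \<nu>) \<longlongrightarrow> dist_fun (dx_plus \<nu>) x) (at_left x)" if "0 < x" "x \<le> 1" for x
    by (rule dist_fun_left_continuous[OF P that])
  show "y - x \<le> dist_fun (dx_plus \<nu>) y - dist_fun (dx_plus \<nu>) x" if xy: "0 \<le> x" "x \<le> y" "y \<le> 1" for x y
  proof -
    have "0 \<le> \<nu> ({x..<y} \<inter> unit_ivl)"
      using \<nu>(2) unfolding nonneg_signed_measure_def by (auto simp: borel_unit_iff)
    then show ?thesis using dist_fun_diff[OF \<nu>(1) xy] xy by (simp add: dist_fun_dx_plus)
  qed
qed (use q B in auto)

section \<open>Norm resolvent convergence and convergence of eigenvalues\<close>

theorem theorem6p1:
  fixes q :: "real \<Rightarrow> real"
    and \<nu> :: "real set \<Rightarrow> real"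
    and \<nu>s :: "nat \<Rightarrow> real set \<Rightarrow> real"
  assumes "integrable (lebesgue_on unit_ivl) q"
    and "finite_signed_measure \<nu>"
    and "singular_signed_measure \<nu>"
    and "\<And>k. finite_signed_measure (\<nu>s k)"
  shows "(weak_star_tendsto \<nu>s \<nu> \<longrightarrow>
      (\<exists>r :: nat \<Rightarrow> nat. strict_mono r \<and>
        norm_resolvent_tendsto (\<lambda>j. dirichlet q (dx_plus (\<nu>s (r j)))) (dirichlet q (dx_plus \<nu>))))
    \<and>
     (nonneg_signed_measure \<nu> \<and> (\<forall>k. nonneg_signed_measure (\<nu>s k)) \<and> weak_star_tendsto \<nu>s \<nu> \<longrightarrow>
      norm_resolvent_tendsto (\<lambda>k. dirichlet q (dx_plus (\<nu>s k))) (dirichlet q (dx_plus \<nu>)) \<and>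
      (\<exists>ev evs. eigenvalue_listing (dirichlet q (dx_plus \<nu>)) ev \<and>
        (\<forall>k. eigenvalue_listing (dirichlet q (dx_plus (\<nu>s k))) (evs k)) \<and>
        (\<forall>n. (\<lambda>k. evs k n) \<longlonglongrightarrow> ev n)))"
proof (intro conjI impI)
  note \<nu> = assms(2) and \<nu>s = assms(4)
  have q: "q absolutely_integrable_on {0..1}"
    using assms(1) by (simp add: absolutely_integrable_on_Icc_iff_Ioo absint_iff_integrable)
  have P: "finite_signed_measure (dx_plus \<nu>)" and Ps: "\<And>k. finite_signed_measure (dx_plus (\<nu>s k))"
    by (intro finite_signed_measure_dx_plus \<nu> \<nu>s)+
  let ?F = "dist_fun (dx_plus \<nu>)" and ?Fs = "\<lambda>k. dist_fun (dx_plus (\<nu>s k))"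
  have nz: "integral {0..1} (\<lambda>t. \<bar>?F t\<bar>) \<noteq> 0"
    by (rule singular_dist_fun_not_null[OF \<nu> assms(3)])
  {
    assume w: "weak_star_tendsto \<nu>s \<nu>"
    obtain B where B: "\<And>k x. x \<in> {0..1} \<Longrightarrow> \<bar>?Fs k x\<bar> \<le> B" "\<And>x. x \<in> {0..1} \<Longrightarrow> \<bar>?F x\<bar> \<le> B"
      and L1: "(\<lambda>k. integral {0..1} (\<lambda>t. \<bar>?Fs k t - ?F t\<bar>)) \<longlonglongrightarrow> 0" and at1: "(\<lambda>k. ?Fs k 1) \<longlonglongrightarrow> ?F 1"
      using weak_star_dist_fun_dx_plus[OF \<nu>s \<nu> w] by blast
    have ai: "(\<lambda>t. \<bar>g t\<bar>) integrable_on {0..1}" if "bounded_measurable g" for g :: "real \<Rightarrow> real"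
      using absolutely_integrable_norm[OF bounded_measurable_absint[OF that]]
      by (simp add: o_def absolutely_integrable_on_def)
    have Fb: "bounded_measurable ?F" "bounded_measurable (?Fs k)" for k
      by (intro dist_fun_bounded_measurable P Ps)+
    have Db: "bounded_measurable (\<lambda>t. ?Fs k t - ?F t)" for k
      using bounded_measurable_add[OF Fb(2) bounded_measurable_uminus[OF Fb(1)]] by simp
    \<comment> \<open>The limit has positive L1 norm, so every F_k closer to it than this norm is
      not null either; this fixes where the subsequence starts.\<close>
    have "0 < integral {0..1} (\<lambda>t. \<bar>?F t\<bar>)"
      using Henstock_Kurzweil_Integration.integral_nonneg[OF ai[OF Fb(1)]] nz by simp
    with L1 have "\<forall>\<^sub>F k in sequentially. integral {0..1} (\<lambda>t. \<bar>?Fs k t - ?F t\<bar>) < integral {0..1} (\<lambda>t. \<bar>?F t\<bar>)"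
      by (rule order_tendstoD)
    then obtain K where K: "\<And>k. K \<le> k \<Longrightarrow> integral {0..1} (\<lambda>t. \<bar>?Fs k t - ?F t\<bar>) < integral {0..1} (\<lambda>t. \<bar>?F t\<bar>)"
      by (auto simp: eventually_sequentially)
    have nzs: "integral {0..1} (\<lambda>t. \<bar>?Fs k t\<bar>) \<noteq> 0" if "K \<le> k" for k
    proof -
      have "integral {0..1} (\<lambda>t. \<bar>?F t\<bar>) \<le> integral {0..1} (\<lambda>t. \<bar>?Fs k t - ?F t\<bar> + \<bar>?Fs k t\<bar>)"
        by (intro integral_le integrable_add ai Fb Db) auto
      also have "\<dots> = integral {0..1} (\<lambda>t. \<bar>?Fs k t - ?F t\<bar>) + integral {0..1} (\<lambda>t. \<bar>?Fs k t\<bar>)"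
        by (intro Henstock_Kurzweil_Integration.integral_add ai Fb Db)
      finally show ?thesis using K[OF that] by linarith
    qed
    have "norm_resolvent_tendsto (\<lambda>j. dirichlet q (dx_plus (\<nu>s (j + K)))) (dirichlet q (dx_plus \<nu>))"
      by (rule norm_resolvent_tendsto_dirichlet[OF q Ps P B LIMSEQ_ignore_initial_segment[OF L1]
            LIMSEQ_ignore_initial_segment[OF at1] nzs nz]) auto
    moreover have "strict_mono (\<lambda>j. j + K)" by (simp add: strict_mono_def)
    ultimately show "\<exists>r :: nat \<Rightarrow> nat. strict_mono r \<and>
        norm_resolvent_tendsto (\<lambda>j. dirichlet q (dx_plus (\<nu>s (r j)))) (dirichlet q (dx_plus \<nu>))"
      by blast
  }
  {
    assume A: "nonneg_signed_measure \<nu> \<and> (\<forall>k. nonneg_signed_measure (\<nu>s k)) \<and> weak_star_tendsto \<nu>s \<nu>"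
    then have w: "weak_star_tendsto \<nu>s \<nu>" by simp
    obtain B where B: "\<And>k x. x \<in> {0..1} \<Longrightarrow> \<bar>?Fs k x\<bar> \<le> B" "\<And>x. x \<in> {0..1} \<Longrightarrow> \<bar>?F x\<bar> \<le> B"
      and L1: "(\<lambda>k. integral {0..1} (\<lambda>t. \<bar>?Fs k t - ?F t\<bar>)) \<longlonglongrightarrow> 0" and at1: "(\<lambda>k. ?Fs k 1) \<longlonglongrightarrow> ?F 1"
      using weak_star_dist_fun_dx_plus[OF \<nu>s \<nu> w] by blast
    have pr: "pruefer q ?F B" and prs: "\<And>k. pruefer q (?Fs k) B"
      using A by (auto intro!: nonneg_imp_pruefer q \<nu> \<nu>s B)
    \<comment> \<open>The whole sequence is admissible here: F_k(x) is at least x, so no F_k is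
      null.\<close>
    show "norm_resolvent_tendsto (\<lambda>k. dirichlet q (dx_plus (\<nu>s k))) (dirichlet q (dx_plus \<nu>))"
      by (rule norm_resolvent_tendsto_dirichlet[OF q Ps P B L1 at1 pruefer.F_not_null[OF prs] nz])
    show "\<exists>ev evs. eigenvalue_listing (dirichlet q (dx_plus \<nu>)) ev \<and>
        (\<forall>k. eigenvalue_listing (dirichlet q (dx_plus (\<nu>s k))) (evs k)) \<and>
        (\<forall>n. (\<lambda>k. evs k n) \<longlonglongrightarrow> ev n)"
      by (intro exI[of _ "pruefer.eigenvalue q ?F"] exI[of _ "\<lambda>k. pruefer.eigenvalue q (?Fs k)"] conjI allI
          pruefer.eigenvalue_listing_dirichlet[OF pr P refl] pruefer.eigenvalue_listing_dirichlet[OF prs Ps refl]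
          pruefer_eigenvalue_tendsto[OF pr prs L1 at1])
  }
qed

end
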